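(* Let $D$ be a Dedekind domain with quotient field $F\neq D$, let $M_1,\ldots,M_n$ ($n>1$) be distinct maximal ideals of $D$, let $I=M_1^{e_1}\cdots M_n^{e_n}$ be an ideal in $D$, where $e_1,\ldots,e_n$ are positive integers, and let $m$ be a positive integer. Let $S'=\{S'(M_1),\ldots,S'(M_n)\}$ be a realizable $m$-consistent system for $\{D_{M_1},\ldots,D_{M_n}\}$, where $S'(M_i)=\{(K_{i,j},f_{i,j},e_{i,j})\mid j=1,\ldots,s_i\}$ for $i=1,\ldots,n$, and let $E$ be the integral closure of $D$ in a finite separable field extension $L$ of $F$ which realizes $S'$ for $\{D_{M_1},\ldots,D_{M_n}\}$, so $[L:F]=m$. Then the following hold: (1) $IE=J^t$ for some radical ideal $J$ in $E$ and for some positive integer $t$ if and only if the products $e_ie_{i,j}$ are equal for all $i,j$, and then $J=\mathrm{Rad}(IE)$ and $e_ie_{i,j}=t$. (2) If $IE=J^m$ for some radical ideal $J$ in $E$, then $\sum_{j=1}^{s_i}f_{i,j}=e_i$ for $i=1,\ldots,n$. (3) If $IE=J^t$ for some radical ideal $J$ in $E$ and some positive integer $t$, and if no prime integer divides each $e_i$, then $m$ is a positive multiple of $t$ and $t$ (and hence $m$) is a positive multiple of each $e_i$.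
   Context: A DVR is a rank one discrete valuation ring. $\mathrm{Rad}(J)$ is the radical of the ideal $J$. Let $(V_1,N_1),\ldots,(V_n,N_n)$ be distinct DVRs with quotient field $F$ (here $V_i=D_{M_i}$, and one writes $S'(M_i)$ for $S'(D_{M_i})$), and put $K_i=V_i/N_i$ ($=D/M_i$). For a positive integer $m$, an $m$-consistent system for $\{V_1,\ldots,V_n\}$ is a collection $S=\{S(V_1),\ldots,S(V_n)\}$ such that: (1) $S(V_i)=\{(K_{i,j},f_{i,j},e_{i,j})\mid j=1,\ldots,s_i\}$ is a finite family indexed by $j$ (repetitions of triples are allowed), where $K_{i,j}$ is a simple algebraic field extension of $K_i$, $f_{i,j}=[K_{i,j}:K_i]$, and $s_i,e_{i,j}$ are positive integers; (2) for each $i$, $\sum_{j=1}^{s_i}e_{i,j}f_{i,j}=m$. Such a system $S$ is realizable for $\{V_1,\ldots,V_n\}$ if there exists a separable algebraic extension field $L$ of $F$ such that: (a) $[L:F]=m$; (b) for $1\le i\le n$, $V_i$ has exactly $s_i$ extensions $(V_{i,1},N_{i,1}),\ldots,(V_{i,s_i},N_{i,s_i})$ to valuation rings of $L$; (c) (for a suitable numbering) the residue field $V_{i,j}/N_{i,j}$ is $K_i$-isomorphic to $K_{i,j}$, and the ramification index of $V_{i,j}$ over $V_i$ is $e_{i,j}$, i.e. $N_iV_{i,j}=N_{i,j}^{e_{i,j}}$. Such an $L$ is said to realize $S$ for $\{V_1,\ldots,V_n\}$. *)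

theory Defs
  imports "HOL-Algebra.Algebra" "HOL-Computational_Algebra.Primes"
begin

text \<open>
  Subrings are carrier sets of an ambient field: \<open>D\<close> and its localizations live in \<open>F\<close>,
  the integral closure and the valuation rings above live in \<open>L\<close>.  The ring structure of a
  subring \<open>A\<close> of \<open>R\<close> is \<open>R\<lparr>carrier := A\<rparr>\<close>.  A field extension of \<open>F\<close> is a field \<open>L\<close>
  together with a homomorphism \<open>\<phi> \<in> ring_hom F L\<close>.
\<close>

definition is_quotient_field :: "'a ring \<Rightarrow> 'a set \<Rightarrow> bool" where
  "is_quotient_field F D \<longleftrightarrow> field F \<and> subring D F \<and>
     (\<forall>x\<in>carrier F. \<exists>a\<in>D. \<exists>b\<in>D - {\<zero>\<^bsub>F\<^esub>}. x = a \<otimes>\<^bsub>F\<^esub> inv\<^bsub>F\<^esub> b)"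

text \<open>Polynomials are coefficient lists with the leading coefficient first.\<close>

definition integral_closure :: "'a ring \<Rightarrow> 'a set \<Rightarrow> 'a set" where
  "integral_closure R A =
     {x \<in> carrier R. \<exists>p. p \<noteq> [] \<and> set p \<subseteq> A \<and> lead_coeff p = \<one>\<^bsub>R\<^esub> \<and> ring.eval R p x = \<zero>\<^bsub>R\<^esub>}"

definition dedekind_domain_with_quotient_field :: "'a set \<Rightarrow> 'a ring \<Rightarrow> bool" where
  "dedekind_domain_with_quotient_field D F \<longleftrightarrow>
     is_quotient_field F D \<and>
     noetherian_domain (F\<lparr>carrier := D\<rparr>) \<and>
     integral_closure F D = D \<and>
     (\<forall>P. primeideal P (F\<lparr>carrier := D\<rparr>) \<and> P \<noteq> {\<zero>\<^bsub>F\<^esub>} \<longrightarrow> maximalideal P (F\<lparr>carrier := D\<rparr>))"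

definition localization_at :: "'a ring \<Rightarrow> 'a set \<Rightarrow> 'a set \<Rightarrow> 'a set" where
  "localization_at F D P = {a \<otimes>\<^bsub>F\<^esub> inv\<^bsub>F\<^esub> b | a b. a \<in> D \<and> b \<in> D - P}"

definition ideal_power :: "'a ring \<Rightarrow> 'a set \<Rightarrow> nat \<Rightarrow> 'a set" where
  "ideal_power R J k = J [^]\<^bsub>ideals_set R\<^esub> k"

definition radical_of :: "'a ring \<Rightarrow> 'a set \<Rightarrow> 'a set" where
  "radical_of R J = {x \<in> carrier R. \<exists>k::nat. k > 0 \<and> x [^]\<^bsub>R\<^esub> k \<in> J}"

definition radical_ideal :: "'a ring \<Rightarrow> 'a set \<Rightarrow> bool" where
  "radical_ideal R J \<longleftrightarrow> ideal J R \<and> radical_of R J = J"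

text \<open>
  The entry at position \<open>i\<close> of \<open>p\<close> is the coefficient of degree \<open>degree p - i\<close>, and the
  constant term, at position \<open>degree p\<close>, is dropped.
\<close>

definition formal_derivative :: "'a ring \<Rightarrow> 'a list \<Rightarrow> 'a list" where
  "formal_derivative R p =
     ring.normalize R (map (\<lambda>i. add_pow R (degree p - i) (p ! i)) [0..<degree p])"

text \<open>
  \<open>p\<close> is coprime to its derivative in \<open>K[X]\<close>: for nonzero \<open>p\<close>, the common divisors of
  degree 0 are exactly the units.
\<close>

definition separable_polynomial :: "'a ring \<Rightarrow> 'a set \<Rightarrow> 'a list \<Rightarrow> bool" where
  "separable_polynomial R K p \<longleftrightarrow> p \<noteq> [] \<and>
     (\<forall>q\<in>carrier (univ_poly R K).
        q divides\<^bsub>univ_poly R K\<^esub> p \<and> q divides\<^bsub>univ_poly R K\<^esub> formal_derivative R p \<longrightarrow> degree q = 0)"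

definition separable_algebraic_extension :: "'a ring \<Rightarrow> 'a set \<Rightarrow> bool" where
  "separable_algebraic_extension L K \<longleftrightarrow> subfield K L \<and>
     (\<forall>x\<in>carrier L. ring.algebraic L K x \<and> separable_polynomial L K (ring.Irr L K x))"

definition simple_algebraic_extension :: "'a ring \<Rightarrow> 'a set \<Rightarrow> bool" where
  "simple_algebraic_extension L K \<longleftrightarrow> subfield K L \<and>
     (\<exists>\<theta>\<in>carrier L. ring.algebraic L K \<theta> \<and> generate_field L (insert \<theta> K) = carrier L)"

definition valuation_ring_of :: "'a ring \<Rightarrow> 'a set \<Rightarrow> bool" where
  "valuation_ring_of L W \<longleftrightarrow> subring W L \<and> (\<forall>x\<in>carrier L - {\<zero>\<^bsub>L\<^esub>}. x \<in> W \<or> inv\<^bsub>L\<^esub> x \<in> W)"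

text \<open>The maximal ideal of a local subring \<open>V\<close> is its set of nonunits.\<close>

definition max_ideal_of :: "'a ring \<Rightarrow> 'a set \<Rightarrow> 'a set" where
  "max_ideal_of R V = V - Units (R\<lparr>carrier := V\<rparr>)"

definition residue_field_of :: "'a ring \<Rightarrow> 'a set \<Rightarrow> 'a set ring" where
  "residue_field_of R V = (R\<lparr>carrier := V\<rparr>) Quot (max_ideal_of R V)"

definition residue_class :: "'a ring \<Rightarrow> 'a set \<Rightarrow> 'a \<Rightarrow> 'a set" where
  "residue_class R V x = max_ideal_of R V +>\<^bsub>R\<lparr>carrier := V\<rparr>\<^esub> x"

definition valuation_extensions ::
  "'a ring \<Rightarrow> 'l ring \<Rightarrow> ('a \<Rightarrow> 'l) \<Rightarrow> 'a set \<Rightarrow> 'l set set" where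
  "valuation_extensions F L \<phi> V = {W. valuation_ring_of L W \<and> W \<inter> \<phi> ` carrier F = \<phi> ` V}"

text \<open>
  A system for the DVRs \<open>V 1, \<dots>, V n\<close> of \<open>F\<close> consists of the family lengths \<open>s i\<close>, the fields
  \<open>K i j\<close> with the embeddings \<open>\<kappa> i j\<close> of the residue field of \<open>V i\<close> which make them extensions
  of it, the degrees \<open>f i j\<close>, and the ramification indices \<open>r i j\<close> (where \<open>1 \<le> i \<le> n\<close> and
  \<open>1 \<le> j \<le> s i\<close>; values at other indices are irrelevant).  That all \<open>K i j\<close> have carriers in
  one type is no restriction, since finitely many types embed into their sum type.
  The definitions make sense without the DVR condition on \<open>V i\<close>, which is automatic
  for localizations of a Dedekind domain at nonzero primes.
\<close>

definition consistent_system ::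
  "nat \<Rightarrow> 'a ring \<Rightarrow> nat \<Rightarrow> (nat \<Rightarrow> 'a set) \<Rightarrow> (nat \<Rightarrow> nat) \<Rightarrow> (nat \<Rightarrow> nat \<Rightarrow> 'k ring) \<Rightarrow>
   (nat \<Rightarrow> nat \<Rightarrow> 'a set \<Rightarrow> 'k) \<Rightarrow> (nat \<Rightarrow> nat \<Rightarrow> nat) \<Rightarrow> (nat \<Rightarrow> nat \<Rightarrow> nat) \<Rightarrow> bool" where
  "consistent_system m F n V s K \<kappa> f r \<longleftrightarrow>
     (\<forall>i\<in>{1..n}. s i > 0 \<and>
        (\<forall>j\<in>{1..s i}.
           field (K i j) \<and>
           \<kappa> i j \<in> ring_hom (residue_field_of F (V i)) (K i j) \<and>
           simple_algebraic_extension (K i j) (\<kappa> i j ` carrier (residue_field_of F (V i))) \<and>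
           ring.dimension (K i j) (f i j) (\<kappa> i j ` carrier (residue_field_of F (V i))) (carrier (K i j)) \<and>
           r i j > 0) \<and>
        (\<Sum>j=1..s i. r i j * f i j) = m)"

text \<open>
  The bijection \<open>W\<close> is the numbering of the extensions of \<open>V i\<close>; the isomorphism \<open>h\<close> is
  \<open>K\<^sub>i\<close>-linear in the sense that it commutes with the two embeddings of the residue field of \<open>V i\<close>.
  The degrees \<open>f i j\<close> play no role here, as they are determined by \<open>K i j\<close>.
\<close>

definition realizes ::
  "'l ring \<Rightarrow> ('a \<Rightarrow> 'l) \<Rightarrow> nat \<Rightarrow> 'a ring \<Rightarrow> nat \<Rightarrow> (nat \<Rightarrow> 'a set) \<Rightarrow> (nat \<Rightarrow> nat) \<Rightarrow>
   (nat \<Rightarrow> nat \<Rightarrow> 'k ring) \<Rightarrow> (nat \<Rightarrow> nat \<Rightarrow> 'a set \<Rightarrow> 'k) \<Rightarrow> (nat \<Rightarrow> nat \<Rightarrow> nat) \<Rightarrow> bool" where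
  "realizes L \<phi> m F n V s K \<kappa> r \<longleftrightarrow>
     field L \<and> \<phi> \<in> ring_hom F L \<and>
     separable_algebraic_extension L (\<phi> ` carrier F) \<and>
     ring.dimension L m (\<phi> ` carrier F) (carrier L) \<and>
     (\<forall>i\<in>{1..n}. \<exists>W. bij_betw W {1..s i} (valuation_extensions F L \<phi> (V i)) \<and>
        (\<forall>j\<in>{1..s i}.
           (\<exists>h\<in>ring_iso (residue_field_of L (W j)) (K i j).
              \<forall>x\<in>V i. h (residue_class L (W j) (\<phi> x)) = \<kappa> i j (residue_class F (V i) x)) \<and>
           Idl\<^bsub>L\<lparr>carrier := W j\<rparr>\<^esub> (\<phi> ` max_ideal_of F (V i)) =
             ideal_power (L\<lparr>carrier := W j\<rparr>) (max_ideal_of L (W j)) (r i j)))"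

text \<open>HOL cannot quantify over types, so the type carrying the realizing field is a
  parameter.  (A finite extension of an infinite field \<open>F\<close> has the cardinality of \<open>F\<close>.)\<close>

definition realizable ::
  "'l itself \<Rightarrow> nat \<Rightarrow> 'a ring \<Rightarrow> nat \<Rightarrow> (nat \<Rightarrow> 'a set) \<Rightarrow> (nat \<Rightarrow> nat) \<Rightarrow>
   (nat \<Rightarrow> nat \<Rightarrow> 'k ring) \<Rightarrow> (nat \<Rightarrow> nat \<Rightarrow> 'a set \<Rightarrow> 'k) \<Rightarrow> (nat \<Rightarrow> nat \<Rightarrow> nat) \<Rightarrow> bool" where
  "realizable T m F n V s K \<kappa> r \<longleftrightarrow>
     (\<exists>(L::'l ring) \<phi>. realizes L \<phi> m F n V s K \<kappa> r)"

end

theory Submission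
  imports Defs
begin

text \<open>
  Let \<open>W i j\<close> be the valuation rings of \<open>L\<close> above the localization of \<open>D\<close> at \<open>M i\<close>. Each of them is
  the set of nonnegative elements of a normalized discrete valuation \<open>v i j\<close>, and \<open>r i j\<close> is the
  value of a generator of \<open>M i\<close> at \<open>v i j\<close>. Everything follows from a description of ideals of \<open>E\<close>
  by these finitely many valuations: \<open>IE\<close> consists of the \<open>x \<in> E\<close> with
  \<open>v i j x \<ge> e i * r i j\<close> for all \<open>i\<close>, \<open>j\<close> (\<open>extended_ideal_iff\<close>), and its radical of those with
  \<open>v i j x \<ge> 1\<close> (\<open>radical_extended_ideal\<close>). If \<open>IE\<close> is the \<open>t\<close>-th power of a radical ideal \<open>J\<close>, then
  \<open>J\<close> is the radical of \<open>IE\<close>. It contains an element \<open>y\<close> that has value 1 at every \<open>v i j\<close>, so the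
  least value of \<open>J\<close> to the power \<open>t\<close> is \<open>t\<close>, while that of \<open>IE\<close> is \<open>e i * r i j\<close>. Conversely, if all
  these products equal \<open>t\<close>, then an element \<open>x\<close> of \<open>IE\<close> is locally a multiple of \<open>y\<close> to the power \<open>t\<close>,
  and it lies in \<open>J\<close> to the power \<open>t\<close> because denominators can be cancelled.
  The statements about degrees are then arithmetic with \<open>\<Sum>j. r i j * f i j = m\<close>: multiplying by
  \<open>e i\<close> gives \<open>m * e i = t * (\<Sum>j. f i j)\<close>.
  
  The factorization of ideals of \<open>E\<close> into primes is replaced by the following facts.
  
  \<^item> The integral closure of a subring is the intersection of the valuation rings above it
    (\<open>integral_closure_eq_Inter_valuation_rings\<close>), by Zorn's lemma.
  
  \<^item> The \<open>W i j\<close> are discrete (\<open>exists_extension_valuation\<close>). The localization of \<open>D\<close> at \<open>M i\<close> is the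
    trace of \<open>W i j\<close>, hence a valuation ring, and so the finitely generated ideal \<open>M i\<close> becomes
    principal there. As nonzero primes of \<open>D\<close> are maximal and \<open>L\<close> is algebraic over \<open>F\<close>, the ring
    \<open>W i j\<close> is archimedean. Finally, a principal power of the maximal ideal of a valuation ring
    forces the maximal ideal to be principal.
  
  \<^item> Weak approximation for finitely many discrete valuations (\<open>simultaneous_uniformizer\<close>) gives \<open>y\<close>.
  
  \<^item> Every element of the intersection of the \<open>W i j\<close> lies in \<open>E\<close> after multiplication by some
    \<open>d \<in> D\<close> outside all \<open>M i\<close> (\<open>exists_denominator\<close>), because a valuation ring above \<open>D\<close> in which all
    such \<open>d\<close> are units is \<open>L\<close> or one of the \<open>W i j\<close>. Such a \<open>d\<close> is comaximal to \<open>I\<close>, so it can be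
    cancelled modulo ideals that contain a power of each element of \<open>I\<close> (\<open>cancel_denominator\<close>).
\<close>

section \<open>Valuation rings of a field\<close>

text \<open>Valuation rings and their maximal ideals are defined for records of type \<open>'a ring\<close> only, hence
  the restriction of the record type.\<close>

locale plain_field = field R for R :: "'a ring" (structure)

lemma (in plain_field) nonzero_inv:
  assumes "x \<in> carrier R" "x \<noteq> \<zero>"
  shows "inv x \<in> carrier R" "inv x \<noteq> \<zero>" "x \<otimes> inv x = \<one>" "inv x \<otimes> x = \<one>"
proof -
  have "x \<in> Units R" using assms field_Units by simp
  then show "inv x \<in> carrier R" "x \<otimes> inv x = \<one>" "inv x \<otimes> x = \<one>" by auto
  then show "inv x \<noteq> \<zero>" using assms by auto
qed

lemma (in plain_field) inv_eqI:
  assumes "x \<in> carrier R" "y \<in> carrier R" "x \<otimes> y = \<one>"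
  shows "inv x = y"
  by (metis assms comm_inv_char)

lemma (in plain_field) nonzero_mult:
  assumes "x \<in> carrier R" "y \<in> carrier R" "x \<noteq> \<zero>" "y \<noteq> \<zero>"
  shows "x \<otimes> y \<noteq> \<zero>"
  using assms integral by blast

lemma (in plain_field) nonzero_pow:
  assumes "x \<in> carrier R" "x \<noteq> \<zero>"
  shows "x [^] (n::nat) \<noteq> \<zero>"
  using assms by (induction n) (auto simp: nonzero_mult)

lemma (in plain_field) inv_mult:
  assumes "x \<in> carrier R" "y \<in> carrier R" "x \<noteq> \<zero>" "y \<noteq> \<zero>"
  shows "inv (x \<otimes> y) = inv x \<otimes> inv y"
proof (rule inv_eqI)
  note i = nonzero_inv[OF assms(1,3)] nonzero_inv[OF assms(2,4)]
  have "x \<otimes> y \<otimes> (inv x \<otimes> inv y) = (x \<otimes> inv x) \<otimes> (y \<otimes> inv y)" using assms(1,2) i(1,5) by algebra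
  then show "x \<otimes> y \<otimes> (inv x \<otimes> inv y) = \<one>" using i by simp
qed (use assms nonzero_inv in simp_all)

lemma (in plain_field) inv_inv:
  assumes "x \<in> carrier R" "x \<noteq> \<zero>"
  shows "inv (inv x) = x"
  using inv_eqI[of "inv x" x] nonzero_inv[OF assms] assms(1) by blast

lemma valuation_ring_ofE:
  assumes "valuation_ring_of L W"
  shows "subring W L" "\<And>x. x \<in> carrier L \<Longrightarrow> x \<noteq> \<zero>\<^bsub>L\<^esub> \<Longrightarrow> x \<notin> W \<Longrightarrow> inv\<^bsub>L\<^esub> x \<in> W"
  using assms unfolding valuation_ring_of_def by auto

lemma (in plain_field) Units_subring:
  assumes "subring W R"
  shows "Units (R\<lparr>carrier := W\<rparr>) = {x \<in> W. x \<noteq> \<zero> \<and> inv x \<in> W}"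
proof -
  note W = subringE[OF assms]
  have "x \<in> W \<and> x \<noteq> \<zero> \<and> inv x \<in> W" if x: "x \<in> Units (R\<lparr>carrier := W\<rparr>)" for x
  proof -
    from x obtain z where z: "x \<in> W" "z \<in> W" "x \<otimes> z = \<one>" unfolding Units_def by auto
    then have "inv x = z" using W(1) inv_eqI by blast
    moreover have "x \<noteq> \<zero>" using z W(1) by auto
    ultimately show ?thesis using z by simp
  qed
  moreover have "x \<in> Units (R\<lparr>carrier := W\<rparr>)" if x: "x \<in> W" "x \<noteq> \<zero>" "inv x \<in> W" for x
    using x nonzero_inv[of x] W(1) unfolding Units_def by auto
  ultimately show ?thesis by blast
qed

lemma (in plain_field) max_ideal_of_subring:
  assumes "subring W R"
  shows "max_ideal_of R W = {x \<in> W. x = \<zero> \<or> inv x \<notin> W}"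
  unfolding max_ideal_of_def Units_subring[OF assms] by auto

lemma (in plain_field) subring_pow_closed:
  assumes "subring W R" "x \<in> W"
  shows "x [^] (n::nat) \<in> W"
  using subringE[OF assms(1)] assms(2) by (induction n) auto

text \<open>
  If \<open>x\<close> were outside \<open>W\<close>, then its inverse would be in \<open>W\<close>. Dividing the monic equation of degree
  \<open>n\<close> by the power \<open>n - 1\<close> of \<open>x\<close> expresses \<open>x\<close> by the coefficients and the inverse.
\<close>

lemma (in plain_field) valuation_ring_integrally_closed:
  assumes W: "valuation_ring_of R W" and x: "x \<in> carrier R"
    and p: "p \<noteq> []" "set p \<subseteq> W" "lead_coeff p = \<one>" "eval p x = \<zero>"
  shows "x \<in> W"
proof (rule ccontr)
  assume xW: "x \<notin> W"
  note W' = subringE[OF valuation_ring_ofE(1)[OF W]]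
  have x0: "x \<noteq> \<zero>" using xW W'(2) by auto
  define y where "y = inv x"
  have y: "y \<in> W" using valuation_ring_ofE(2)[OF W x x0 xW] by (simp add: y_def)
  have yx: "x \<otimes> y = \<one>" "y \<in> carrier R" using nonzero_inv[OF x x0] by (auto simp: y_def)
  have pow: "x [^] n \<otimes> y [^] n = \<one>" for n :: nat
    using nat_pow_distrib[of x y n] x yx by simp
  \<comment> \<open>each monomial of \<open>q\<close> has a degree below \<open>length q\<close>, so only powers of \<open>y\<close> remain\<close>
  have ev: "eval q x \<otimes> y [^] length q \<in> W" if "set q \<subseteq> W" for q
    using that
  proof (induction q)
    case Nil
    then show ?case using W'(2) yx by simp
  next
    case (Cons a q)
    have a: "a \<in> W" "a \<in> carrier R" and q: "set q \<subseteq> W" "set q \<subseteq> carrier R" using Cons W'(1) by auto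
    have e: "eval q x \<in> carrier R" using eval_in_carrier[OF q(2) x] .
    have c: "x [^] length q \<in> carrier R" "y [^] length q \<in> carrier R" using x yx by auto
    have "eval (a # q) x \<otimes> y [^] length (a # q)
        = (a \<otimes> (x [^] length q \<otimes> y [^] length q)) \<otimes> y \<oplus> (eval q x \<otimes> y [^] length q) \<otimes> y"
      using a e c x yx(2) by (simp add: l_distr m_assoc)
    also have "\<dots> = a \<otimes> y \<oplus> (eval q x \<otimes> y [^] length q) \<otimes> y" using pow a by simp
    also have "\<dots> \<in> W" using W' a(1) y Cons.IH[OF q(1)] by simp
    finally show ?case .
  qed
  obtain q where pq: "p = \<one> # q" using p by (cases p) auto
  have q: "set q \<subseteq> W" "set q \<subseteq> carrier R" using p pq W'(1) by auto
  have e: "eval q x \<in> carrier R" using eval_in_carrier[OF q(2) x] .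
  have c: "x [^] length q \<in> carrier R" "y [^] length q \<in> carrier R" using x yx by auto
  have eq: "x [^] length q \<oplus> eval q x = \<zero>" using p(4) pq c by simp
  show False
  proof (cases q)
    case Nil
    then show False using eq by simp
  next
    case (Cons a q')
    have aq: "a \<in> W" "a \<in> carrier R" "set q' \<subseteq> W" "set q' \<subseteq> carrier R" using q Cons by auto
    define n where "n = length q'"
    have cn: "x [^] n \<in> carrier R" "y [^] n \<in> carrier R" "eval q' x \<in> carrier R"
      using x yx eval_in_carrier[OF aq(4) x] by auto
    have "x [^] n \<otimes> x \<oplus> (a \<otimes> x [^] n \<oplus> eval q' x) = \<zero>"
      using eq Cons n_def by simp
    then have "(x [^] n \<otimes> x \<oplus> (a \<otimes> x [^] n \<oplus> eval q' x)) \<otimes> y [^] n = \<zero>" using cn by simp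
    then have "(x [^] n \<otimes> y [^] n) \<otimes> x \<oplus> (a \<otimes> (x [^] n \<otimes> y [^] n) \<oplus> eval q' x \<otimes> y [^] n) = \<zero>"
      using cn x aq(2) by (simp add: l_distr m_assoc m_comm[of x "y [^] n"])
    then have "x \<oplus> (a \<oplus> eval q' x \<otimes> y [^] n) = \<zero>" using pow[of n] x aq by simp
    then have "x = \<ominus> (a \<oplus> eval q' x \<otimes> y [^] n)"
      using x aq cn by (metis a_closed m_closed minus_equality a_comm minus_minus)
    moreover have "\<ominus> (a \<oplus> eval q' x \<otimes> y [^] n) \<in> W"
      using W' aq(1) ev[OF aq(3)] n_def by simp
    ultimately show False using xW by simp
  qed
qed

section \<open>Integral closure and valuation rings\<close>

text \<open>The values at \<open>z\<close> of the polynomials of degree at most \<open>n\<close> over \<open>B\<close>, built by Horner's rule, which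
  is also how \<open>simple_extension\<close> is generated.\<close>

fun (in ring) poly_values :: "'a set \<Rightarrow> 'a \<Rightarrow> nat \<Rightarrow> 'a set" where
  "poly_values B z 0 = B"
| "poly_values B z (Suc n) = {u \<otimes> z \<oplus> b | u b. u \<in> poly_values B z n \<and> b \<in> B}"

context plain_field
begin

context
  fixes B z
  assumes B: "subring B R" and z: "z \<in> carrier R"
begin

lemma poly_values_carrier: "poly_values B z n \<subseteq> carrier R"
  using subringE(1)[OF B] z by (induction n) auto

lemma poly_values_zero: "\<zero> \<in> poly_values B z n"
proof (induction n)
  case (Suc n)
  have "\<zero> = \<zero> \<otimes> z \<oplus> \<zero>" using z by simp
  then show ?case using Suc subringE(2)[OF B] by (auto intro!: exI)
qed (simp add: subringE(2)[OF B])

lemma poly_values_subring_subset: "B \<subseteq> poly_values B z n"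
proof (cases n)
  case (Suc k)
  have "b = \<zero> \<otimes> z \<oplus> b" if "b \<in> B" for b using that z subringE(1)[OF B] by auto
  then show ?thesis using Suc poly_values_zero[of k] by auto
qed simp

lemma poly_values_Suc_subset: "poly_values B z n \<subseteq> poly_values B z (Suc n)"
proof (induction n)
  case 0
  show ?case using poly_values_subring_subset[of 1] by simp
next
  case (Suc n)
  then show ?case by auto
qed

lemma poly_values_add:
  "u \<in> poly_values B z n \<Longrightarrow> w \<in> poly_values B z n \<Longrightarrow> u \<oplus> w \<in> poly_values B z n"
proof (induction n arbitrary: u w)
  case 0
  then show ?case using subringE(7)[OF B] by simp
next
  case (Suc n)
  obtain u' b where u: "u = u' \<otimes> z \<oplus> b" "u' \<in> poly_values B z n" "b \<in> B" using Suc(2) by auto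
  obtain w' c where w: "w = w' \<otimes> z \<oplus> c" "w' \<in> poly_values B z n" "c \<in> B" using Suc(3) by auto
  have c: "u' \<in> carrier R" "w' \<in> carrier R" "b \<in> carrier R" "c \<in> carrier R"
    using u w poly_values_carrier subringE(1)[OF B] by auto
  have "u \<oplus> w = (u' \<oplus> w') \<otimes> z \<oplus> (b \<oplus> c)" using c z unfolding u w by algebra
  then show ?case using Suc(1)[OF u(2) w(2)] subringE(7)[OF B u(3) w(3)] by auto
qed

lemma poly_values_smult:
  "a \<in> B \<Longrightarrow> u \<in> poly_values B z n \<Longrightarrow> a \<otimes> u \<in> poly_values B z n"
proof (induction n arbitrary: u)
  case 0
  then show ?case using subringE(6)[OF B] by simp
next
  case (Suc n)
  obtain u' b where u: "u = u' \<otimes> z \<oplus> b" "u' \<in> poly_values B z n" "b \<in> B" using Suc(3) by auto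
  have c: "u' \<in> carrier R" "b \<in> carrier R" "a \<in> carrier R"
    using u Suc(2) poly_values_carrier subringE(1)[OF B] by auto
  have "a \<otimes> u = (a \<otimes> u') \<otimes> z \<oplus> (a \<otimes> b)" using c z unfolding u by algebra
  then show ?case using Suc(1)[OF Suc(2) u(2)] subringE(6)[OF B Suc(2) u(3)] by auto
qed

lemma poly_values_pow: "z [^] n \<in> poly_values B z n"
proof (induction n)
  case 0
  then show ?case using subringE(3)[OF B] by simp
next
  case (Suc n)
  have "z [^] Suc n = z [^] n \<otimes> z \<oplus> \<zero>" using z by simp
  then show ?case using Suc subringE(2)[OF B] by auto
qed

lemma simple_extension_poly_values:
  "u \<in> simple_extension B z \<Longrightarrow> \<exists>n. u \<in> poly_values B z n"
proof (induction rule: simple_extension.induct)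
  case zero
  then show ?case using poly_values_zero by blast
next
  case (lin k1 k2)
  then obtain n where "k1 \<in> poly_values B z n" by blast
  then have "k1 \<otimes> z \<oplus> k2 \<in> poly_values B z (Suc n)" using lin by auto
  then show ?case by blast
qed

lemma poly_values_eval:
  "u \<in> poly_values B z n \<Longrightarrow> \<exists>q. set q \<subseteq> B \<and> length q = Suc n \<and> eval q z = u"
proof (induction n arbitrary: u)
  case 0
  then have "set [u] \<subseteq> B \<and> length [u] = Suc 0 \<and> eval [u] z = u" using z subringE(1)[OF B] by auto
  then show ?case by blast
next
  case (Suc n)
  obtain u' b where u: "u = u' \<otimes> z \<oplus> b" "u' \<in> poly_values B z n" "b \<in> B" using Suc(2) by auto
  obtain q where q: "set q \<subseteq> B" "length q = Suc n" "eval q z = u'" using Suc(1)[OF u(2)] by blast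
  have "eval (q @ [b]) z = u"
    using eval_append_aux[of q b z] q u z subringE(1)[OF B] by auto
  then show ?case using q u(3) by (intro exI[of _ "q @ [b]"]) auto
qed

text \<open>
  Horner's rule multiplies by \<open>z\<close> repeatedly; after each multiplication the hypothesis removes the
  term of degree \<open>n + 1\<close> that arises.
\<close>

lemma poly_values_reduce:
  assumes "z [^] Suc n \<in> poly_values B z n"
  shows "u \<in> poly_values B z k \<Longrightarrow> u \<in> poly_values B z n"
proof (induction k arbitrary: u)
  case 0
  then show ?case using poly_values_subring_subset by auto
next
  case (Suc k)
  obtain u' b where u: "u = u' \<otimes> z \<oplus> b" "u' \<in> poly_values B z k" "b \<in> B" using Suc(2) by auto
  have u': "u' \<in> poly_values B z n" using Suc.IH[OF u(2)] .
  have step: "w \<otimes> z \<in> poly_values B z n" if "w \<in> poly_values B z n" for w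
  proof -
    \<comment> \<open>split off the leading term\<close>
    have "\<exists>a\<in>B. \<exists>w'. w' \<in> poly_values B z n \<and> w \<otimes> z = a \<otimes> z [^] Suc n \<oplus> w'"
      using that
    proof (induction n arbitrary: w)
      case 0
      then show ?case using z subringE(1,2)[OF B] by (intro bexI[of _ w] exI[of _ \<zero>]) auto
    next
      case (Suc n)
      obtain w1 b where w: "w = w1 \<otimes> z \<oplus> b" "w1 \<in> poly_values B z n" "b \<in> B" using Suc(2) by auto
      obtain a w' where a: "a \<in> B" "w' \<in> poly_values B z n" "w1 \<otimes> z = a \<otimes> z [^] Suc n \<oplus> w'"
        using Suc(1)[OF w(2)] by blast
      have c: "b \<in> carrier R" "a \<in> carrier R" "w' \<in> carrier R" "z [^] Suc n \<in> carrier R"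
        using w a poly_values_carrier subringE(1)[OF B] z by auto
      have "w \<otimes> z = (a \<otimes> z [^] Suc n \<oplus> w' \<oplus> b) \<otimes> z" using w a by simp
      also have "\<dots> = a \<otimes> (z [^] Suc n \<otimes> z) \<oplus> ((w' \<oplus> b) \<otimes> z)" using c z by algebra
      finally have "w \<otimes> z = a \<otimes> z [^] Suc (Suc n) \<oplus> ((w' \<oplus> b) \<otimes> z \<oplus> \<zero>)" using c z by simp
      moreover have "(w' \<oplus> b) \<otimes> z \<oplus> \<zero> \<in> poly_values B z (Suc n)"
        using poly_values_add[OF a(2), of b] poly_values_subring_subset w(3) subringE(2)[OF B] by auto
      ultimately show ?case using a(1) by blast
    qed
    then obtain a w' where "a \<in> B" "w' \<in> poly_values B z n" "w \<otimes> z = a \<otimes> z [^] Suc n \<oplus> w'" by blast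
    then show ?thesis using poly_values_add poly_values_smult assms by simp
  qed
  show ?case unfolding u(1) using poly_values_add[OF step[OF u']] poly_values_subring_subset u(3) by auto
qed

end

text \<open>
  Division of a polynomial of degree at most \<open>n\<close> by the \<open>n\<close>-th power of the variable reverses the
  coefficients.
\<close>

lemma poly_values_inverse_power:
  assumes B: "subring B R" and z: "z \<in> carrier R" and w: "w \<in> carrier R" "z \<otimes> w = \<one>"
  shows "u \<in> poly_values B z n \<Longrightarrow> w [^] n \<otimes> u \<in> poly_values B w n"
proof (induction n arbitrary: u)
  case 0
  then show ?case using subringE(1)[OF B] by auto
next
  case (Suc n)
  obtain u' b where u: "u = u' \<otimes> z \<oplus> b" "u' \<in> poly_values B z n" "b \<in> B" using Suc(2) by auto
  have c: "b \<in> carrier R" "u' \<in> carrier R" "w [^] n \<in> carrier R"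
    using u poly_values_carrier[OF B z] subringE(1)[OF B] w by auto
  have "w [^] Suc n \<otimes> u = (w [^] n \<otimes> u') \<otimes> (z \<otimes> w) \<oplus> b \<otimes> (w [^] n \<otimes> w)"
    using c z w(1) unfolding u nat_pow_Suc by algebra
  also have "\<dots> = w [^] n \<otimes> u' \<oplus> b \<otimes> w [^] Suc n" using w c by simp
  also have "\<dots> \<in> poly_values B w (Suc n)"
    using poly_values_add[OF B w(1)] Suc(1)[OF u(2)] poly_values_Suc_subset[OF B w(1)]
      poly_values_smult[OF B w(1) u(3) poly_values_pow[OF B w(1)]] by blast
  finally show ?case .
qed

text \<open>
  Zorn's lemma applies because each subring axiom involves at most two elements, which lie in a
  common member of a chain.
\<close>

lemma maximal_subring_avoiding:
  assumes B0: "subring B0 R" and x: "x \<notin> B0"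
  obtains B where "subring B R" "B0 \<subseteq> B" "x \<notin> B"
    "\<And>C. subring C R \<Longrightarrow> B \<subseteq> C \<Longrightarrow> x \<notin> C \<Longrightarrow> C = B"
proof -
  define A where "A = {B. subring B R \<and> B0 \<subseteq> B \<and> x \<notin> B}"
  have "\<exists>M\<in>A. \<forall>T\<in>A. M \<subseteq> T \<longrightarrow> T = M"
  proof (rule subset_Zorn_nonempty)
    show "A \<noteq> {}" using assms A_def by blast
    fix C assume ne: "C \<noteq> {}" and ch: "subset.chain A C"
    have CA: "C \<subseteq> A" using ch by (simp add: subset.chain_def)
    have tot: "T \<subseteq> Y \<or> Y \<subseteq> T" if "T \<in> C" "Y \<in> C" for T Y
      using ch that unfolding subset_chain_def by blast
    have sub: "\<And>T. T \<in> C \<Longrightarrow> subring T R" using CA A_def by blast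
    have two: "\<exists>T\<in>C. a \<in> T \<and> b \<in> T" if "a \<in> \<Union>C" "b \<in> \<Union>C" for a b
      using that tot by blast
    have "subring (\<Union>C) R"
    proof (rule subringI)
      show "\<Union>C \<subseteq> carrier R" using subringE(1)[OF sub] by (rule Union_least)
      obtain T where "T \<in> C" using ne by blast
      then show "\<one> \<in> \<Union>C" using UnionI[OF _ subringE(3)[OF sub]] by blast
      fix a assume a: "a \<in> \<Union>C"
      then obtain T where T: "T \<in> C" "a \<in> T" by (rule UnionE)
      show "\<ominus> a \<in> \<Union>C" using UnionI[OF T(1) subringE(5)[OF sub[OF T(1)] T(2)]] .
      fix b assume b: "b \<in> \<Union>C"
      obtain U where U: "U \<in> C" "a \<in> U" "b \<in> U" using two[OF a b] by (elim bexE conjE)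
      show "a \<otimes> b \<in> \<Union>C" using UnionI[OF U(1) subringE(6)[OF sub[OF U(1)] U(2,3)]] .
      show "a \<oplus> b \<in> \<Union>C" using UnionI[OF U(1) subringE(7)[OF sub[OF U(1)] U(2,3)]] .
    qed
    then show "\<Union>C \<in> A" using CA ne A_def by blast
  qed
  then obtain B where B: "B \<in> A" "\<And>T. T \<in> A \<Longrightarrow> B \<subseteq> T \<Longrightarrow> T = B" by blast
  show ?thesis
  proof (rule that[of B])
    show "subring B R" "B0 \<subseteq> B" "x \<notin> B" using B(1) A_def by auto
    show "C = B" if "subring C R" "B \<subseteq> C" "x \<notin> C" for C
      using B(1) B(2)[of C] that A_def by blast
  qed
qed

text \<open>
  A maximal subring \<open>B\<close> that contains \<open>B0\<close> and avoids \<open>x\<close> is a valuation ring. Let \<open>y\<close> be the inverse of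
  \<open>x\<close>. By maximality, the elements \<open>1 - y b\<close> are units of \<open>B\<close>, and \<open>x \<in> B[z]\<close> for every \<open>z\<close> outside
  \<open>B\<close>. If both \<open>z\<close> and its inverse \<open>w\<close> are outside \<open>B\<close>, then an expression of \<open>x\<close> of degree at most
  \<open>n + 1\<close> in \<open>z\<close>, divided by \<open>x\<close> times the unit \<open>1 - y b\<close> for its constant term \<open>b\<close>, expresses the
  power \<open>n + 1\<close> of \<open>w\<close> by lower powers of \<open>w\<close>. Then \<open>x\<close> has an expression of degree at most \<open>n\<close>
  in \<open>w\<close>. Exchanging the roles of \<open>z\<close> and \<open>w\<close> decreases the degree until \<open>x \<in> B\<close>.
\<close>

theorem exists_valuation_ring_avoiding:
  assumes B0: "subring B0 R" and x: "x \<in> carrier R" "x \<notin> B0" "inv x \<in> B0"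
  obtains W where "valuation_ring_of R W" "B0 \<subseteq> W" "x \<notin> W"
proof -
  obtain B where B: "subring B R" "B0 \<subseteq> B" "x \<notin> B"
    and mx: "\<And>C. subring C R \<Longrightarrow> B \<subseteq> C \<Longrightarrow> x \<notin> C \<Longrightarrow> C = B"
    using maximal_subring_avoiding[OF B0 x(2)] by blast
  note B' = subringE[OF B(1)]
  have x0: "x \<noteq> \<zero>" using B'(2) B(3) by auto
  define y where "y = inv x"
  have y: "y \<in> B" "y \<in> carrier R" "x \<otimes> y = \<one>"
    using x(3) B(2) nonzero_inv[OF x(1) x0] y_def by auto
  have ext: "\<exists>n. x \<in> poly_values B z n" if z: "z \<in> carrier R" "z \<notin> B" for z
  proof -
    have "simple_extension B z \<noteq> B" using simple_extension_mem[OF B(1) z(1)] z by auto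
    then have "x \<in> simple_extension B z"
      using mx[OF simple_extension_is_subring[OF B(1) z(1)] simple_extension_incl[OF B'(1) z(1)]] by blast
    then show ?thesis using simple_extension_poly_values[OF B(1) z(1)] by blast
  qed
  \<comment> \<open>\<open>y\<close> lies in the Jacobson radical of \<open>B\<close>\<close>
  have unit: "\<one> \<ominus> y \<otimes> b \<noteq> \<zero> \<and> inv (\<one> \<ominus> y \<otimes> b) \<in> B" if b: "b \<in> B" for b
  proof -
    define t where "t = \<one> \<ominus> y \<otimes> b"
    have bc: "b \<in> carrier R" using b B'(1) by auto
    have tB: "t \<in> B" unfolding t_def a_minus_def using B'(7)[OF B'(3) B'(5)[OF B'(6)[OF y(1) b]]] .
    have tc: "t \<in> carrier R" using tB B'(1) by auto
    have xt: "x \<otimes> t = x \<ominus> b"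
    proof -
      have "x \<otimes> t = x \<ominus> (x \<otimes> y) \<otimes> b" using x(1) y(2) bc unfolding t_def by algebra
      then show ?thesis using y bc by simp
    qed
    have notx: "x \<ominus> c \<notin> B" if c: "c \<in> B" for c
    proof
      assume a: "x \<ominus> c \<in> B"
      have "x = (x \<ominus> c) \<oplus> c" using x(1) c B'(1) by (simp add: a_minus_def a_assoc subset_iff l_neg)
      then show False using B'(7)[OF a c] B(3) by simp
    qed
    have t0: "t \<noteq> \<zero>"
    proof
      assume "t = \<zero>"
      then have "x \<ominus> b \<in> B" using xt x B'(2) by simp
      then show False using notx[OF b] by simp
    qed
    have pw: "\<exists>c\<in>B. x \<otimes> t [^] n = x \<ominus> c" for n :: nat
    proof (induction n)
      case 0
      show ?case using x B'(2) by (intro bexI[of _ \<zero>]) (auto simp: a_minus_def)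
    next
      case (Suc n)
      then obtain c where c: "c \<in> B" "x \<otimes> t [^] n = x \<ominus> c" by blast
      have cc: "c \<in> carrier R" using c B'(1) by auto
      have "x \<otimes> t [^] Suc n = (x \<ominus> c) \<otimes> t" using x tc c(2) by (simp add: m_assoc[symmetric])
      also have "\<dots> = x \<otimes> t \<ominus> c \<otimes> t" using x(1) cc tc by algebra
      also have "\<dots> = x \<ominus> (b \<oplus> c \<otimes> t)" unfolding xt using x(1) cc tc bc by algebra
      finally show ?case using B'(7)[OF b B'(6)[OF c(1) tB]] by blast
    qed
    define s where "s = inv t"
    have s: "s \<in> carrier R" "t \<otimes> s = \<one>" "s \<otimes> t = \<one>" using nonzero_inv[OF tc t0] s_def by auto
    have "s \<in> B"
    proof (rule ccontr)
      assume "s \<notin> B"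
      then obtain n where "x \<in> poly_values B s n" using ext s by blast
      then have "t [^] n \<otimes> x \<in> poly_values B t n"
        using poly_values_inverse_power[OF B(1) s(1) tc s(3)] by blast
      moreover have "poly_values B t n \<subseteq> B" using tB B'(6,7) by (induction n) auto
      ultimately have "x \<otimes> t [^] n \<in> B" using x tc by (auto simp: m_comm)
      then show False using pw[of n] notx by metis
    qed
    then show ?thesis using t0 s_def t_def by simp
  qed
  have key: "False" if "x \<in> poly_values B z n" "z \<in> carrier R" "w \<in> carrier R" "z \<otimes> w = \<one>" "w \<notin> B" "z \<notin> B"
    for z w n
    using that
  proof (induction n arbitrary: z w)
    case 0
    then show ?case using B(3) by simp
  next
    case (Suc n)
    have wz: "w \<otimes> z = \<one>" using Suc.prems m_comm by simp
    obtain u b where u: "x = u \<otimes> z \<oplus> b" "u \<in> poly_values B z n" "b \<in> B" using Suc(2) by auto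
    have uc: "u \<in> carrier R" and bc: "b \<in> carrier R"
      using u poly_values_carrier[OF B(1) Suc(3)] B'(1) by auto
    define t where "t = \<one> \<ominus> y \<otimes> b"
    have tc: "t \<in> carrier R" using y bc t_def by simp
    obtain s where s: "s \<in> B" "s \<in> carrier R" "s \<otimes> t = \<one>"
      using unit[OF u(3)] nonzero_inv[OF tc] B'(1) unfolding t_def by blast
    have "x \<otimes> t = x \<ominus> (x \<otimes> y) \<otimes> b" using x(1) y(2) bc unfolding t_def by algebra
    also have "\<dots> = (u \<otimes> z \<oplus> b) \<ominus> b" using y bc u(1) by simp
    also have "\<dots> = u \<otimes> z" using uc bc Suc.prems(2) by algebra
    finally have "y \<otimes> (x \<otimes> t) = y \<otimes> (u \<otimes> z)" by simp
    moreover have "y \<otimes> (x \<otimes> t) = (x \<otimes> y) \<otimes> t" using x(1) y(2) tc by algebra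
    ultimately have "t = y \<otimes> (u \<otimes> z)" using y(3) tc by simp
    then have "\<one> = (s \<otimes> y) \<otimes> (u \<otimes> z)" using s y(2) uc Suc.prems(2)
      by (simp add: m_assoc)
    then have "w [^] Suc n = w [^] Suc n \<otimes> ((s \<otimes> y) \<otimes> (u \<otimes> z))"
      using r_one[OF nat_pow_closed[OF Suc.prems(3)], of "Suc n"] by simp
    also have "\<dots> = (s \<otimes> y) \<otimes> (w [^] n \<otimes> u) \<otimes> (w \<otimes> z)"
    proof -
      have "w [^] n \<in> carrier R" using Suc.prems by simp
      then show ?thesis using s(2) y(2) uc Suc.prems(2,3) unfolding nat_pow_Suc by algebra
    qed
    finally have "w [^] Suc n = (s \<otimes> y) \<otimes> (w [^] n \<otimes> u)" using wz s y uc Suc.prems by simp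
    also have "\<dots> \<in> poly_values B w n"
      using poly_values_smult[OF B(1) Suc.prems(3) B'(6)[OF s(1) y(1)]]
        poly_values_inverse_power[OF B(1) Suc.prems(2,3,4) u(2)] by blast
    finally have red: "w [^] Suc n \<in> poly_values B w n" .
    obtain k where "x \<in> poly_values B w k" using ext Suc.prems by blast
    then have "x \<in> poly_values B w n" using poly_values_reduce[OF B(1) Suc.prems(3) red] by blast
    then show False using Suc.IH[OF _ Suc.prems(3,2) wz] Suc.prems by blast
  qed
  have "valuation_ring_of R B"
    unfolding valuation_ring_of_def
  proof (intro conjI ballI B(1))
    fix z assume z: "z \<in> carrier R - {\<zero>}"
    show "z \<in> B \<or> inv z \<in> B"
    proof (rule ccontr)
      assume a: "\<not> ?thesis"
      then obtain n where "x \<in> poly_values B z n" using ext z by blast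
      then show False using key nonzero_inv[of z] z a by blast
    qed
  qed
  then show ?thesis using that B by blast
qed

text \<open>
  Multiplying \<open>x = \<Sum>i\<le>n. a i / x^i\<close> by the \<open>n\<close>-th power of \<open>x\<close> gives a monic equation for \<open>x\<close>.
\<close>

lemma integral_of_inverse_expression:
  assumes A: "subring A R" and x: "x \<in> carrier R" "x \<noteq> \<zero>" "x \<in> simple_extension A (inv x)"
  shows "x \<in> integral_closure R A"
proof -
  define y where "y = inv x"
  have y: "y \<in> carrier R" "y \<otimes> x = \<one>" using nonzero_inv x y_def by auto
  obtain n where "x \<in> poly_values A y n"
    using simple_extension_poly_values[OF A y(1)] x(3) y_def by blast
  then have "x [^] n \<otimes> x \<in> poly_values A x n" using poly_values_inverse_power[OF A y(1) x(1) y(2)] by blast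
  then obtain q where q: "set q \<subseteq> A" "length q = Suc n" "eval q x = x [^] Suc n"
    using poly_values_eval[OF A x(1)] by fastforce
  have neg: "eval (map (\<lambda>a. \<ominus> a) q) x = \<ominus> eval q x" if "set q \<subseteq> carrier R" for q
    using that
  proof (induction q)
    case (Cons a q)
    then show ?case using eval_in_carrier[OF _ x(1)] x(1) by (simp add: l_minus minus_add)
  qed simp
  have "eval (\<one> # map (\<lambda>a. \<ominus> a) q) x = \<zero>"
    using neg[of q] q subringE(1)[OF A] x(1) by (simp add: r_neg)
  moreover have "set (\<one> # map (\<lambda>a. \<ominus> a) q) \<subseteq> A" using q(1) subringE(3,5)[OF A] by auto
  ultimately show ?thesis unfolding integral_closure_def using x(1)
    by (intro CollectI conjI exI[of _ "\<one> # map (\<lambda>a. \<ominus> a) q"]) auto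
qed

text \<open>
  If \<open>x\<close> is not integral over \<open>A\<close>, then it is not in \<open>A[1/x]\<close>, and some valuation ring contains
  \<open>A[1/x]\<close> but not \<open>x\<close>.
\<close>

theorem integral_closure_eq_Inter_valuation_rings:
  assumes A: "subring A R"
  shows "integral_closure R A = {x \<in> carrier R. \<forall>W. valuation_ring_of R W \<and> A \<subseteq> W \<longrightarrow> x \<in> W}"
proof (intro Set.equalityI subsetI)
  fix x assume "x \<in> integral_closure R A"
  then show "x \<in> {x \<in> carrier R. \<forall>W. valuation_ring_of R W \<and> A \<subseteq> W \<longrightarrow> x \<in> W}"
    unfolding integral_closure_def using valuation_ring_integrally_closed by blast
next
  fix x assume x: "x \<in> {x \<in> carrier R. \<forall>W. valuation_ring_of R W \<and> A \<subseteq> W \<longrightarrow> x \<in> W}"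
  show "x \<in> integral_closure R A"
  proof (rule ccontr)
    assume n: "x \<notin> integral_closure R A"
    have "x \<noteq> \<zero>"
    proof
      assume "x = \<zero>"
      then have "x \<in> A" using subringE(2)[OF A] by simp
      then have "set [\<one>, \<ominus> x] \<subseteq> A" "eval [\<one>, \<ominus> x] x = \<zero>"
        using subringE(3,5)[OF A] x by (simp_all add: r_neg)
      then have "x \<in> integral_closure R A"
        unfolding integral_closure_def using x by (intro CollectI conjI exI[of _ "[\<one>, \<ominus> x]"]) simp_all
      then show False using n by contradiction
    qed
    then have nx: "x \<notin> simple_extension A (inv x)" and i: "inv x \<in> carrier R"
      using n integral_of_inverse_expression[OF A] x nonzero_inv by auto
    obtain W where "valuation_ring_of R W" "simple_extension A (inv x) \<subseteq> W" "x \<notin> W"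
      using exists_valuation_ring_avoiding[OF simple_extension_is_subring[OF A i] _ nx
          simple_extension_mem[OF A i]] x by blast
    then show False using x simple_extension_incl[OF subringE(1)[OF A] i] by blast
  qed
qed

end

section \<open>Discrete valuations\<close>

text \<open>The fractional ideal of value \<open>k\<close>. Valuations are total functions to the integers whose value at
  zero carries no information, so zero is put into every fractional ideal explicitly.\<close>

definition val_ge :: "'a ring \<Rightarrow> ('a \<Rightarrow> int) \<Rightarrow> int \<Rightarrow> 'a set" where
  "val_ge R v k = {x \<in> carrier R. x \<noteq> \<zero>\<^bsub>R\<^esub> \<longrightarrow> k \<le> v x}"

locale discrete_valuation = plain_field +
  fixes v :: "'a \<Rightarrow> int"
  assumes val_mult: "\<lbrakk>x \<in> carrier R; y \<in> carrier R; x \<noteq> \<zero>; y \<noteq> \<zero>\<rbrakk> \<Longrightarrow> v (x \<otimes> y) = v x + v y"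
    and val_add: "\<lbrakk>x \<in> carrier R; y \<in> carrier R; x \<noteq> \<zero>; y \<noteq> \<zero>; x \<oplus> y \<noteq> \<zero>\<rbrakk>
      \<Longrightarrow> min (v x) (v y) \<le> v (x \<oplus> y)"
begin

lemma val_one: "v \<one> = 0"
  using val_mult[of \<one> \<one>] by simp

lemma val_inv: "x \<in> carrier R \<Longrightarrow> x \<noteq> \<zero> \<Longrightarrow> v (inv x) = - v x"
  using val_mult[of x "inv x"] nonzero_inv[of x] val_one by simp

lemma val_pow: "x \<in> carrier R \<Longrightarrow> x \<noteq> \<zero> \<Longrightarrow> v (x [^] (n::nat)) = int n * v x"
  by (induction n) (simp_all add: val_one val_mult nonzero_pow algebra_simps)

lemma val_minus: assumes "x \<in> carrier R" "x \<noteq> \<zero>" shows "v (\<ominus> x) = v x"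
proof -
  have m: "\<ominus> \<one> \<noteq> \<zero>" by (metis minus_minus minus_zero one_closed zero_not_one)
  have "v (\<ominus> \<one>) + v (\<ominus> \<one>) = v ((\<ominus> \<one>) \<otimes> (\<ominus> \<one>))" using val_mult[of "\<ominus> \<one>" "\<ominus> \<one>"] m by simp
  also have "\<dots> = 0" by (simp add: l_minus r_minus val_one)
  finally have "v (\<ominus> \<one>) = 0" by simp
  moreover have "\<ominus> x = (\<ominus> \<one>) \<otimes> x" using assms by (simp add: l_minus)
  ultimately show ?thesis using val_mult[of "\<ominus> \<one>" x] m assms by simp
qed

lemma val_geD: "x \<in> val_ge R v k \<Longrightarrow> x \<in> carrier R" "x \<in> val_ge R v k \<Longrightarrow> x \<noteq> \<zero> \<Longrightarrow> k \<le> v x"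
  by (auto simp: val_ge_def)

lemma val_ge_antimono: "k \<le> l \<Longrightarrow> val_ge R v l \<subseteq> val_ge R v k"
  by (auto simp: val_ge_def)

lemma val_ge_zero: "\<zero> \<in> val_ge R v k"
  by (simp add: val_ge_def)

lemma val_ge_one: "\<one> \<in> val_ge R v 0"
  by (simp add: val_ge_def val_one)

lemma val_ge_add:
  assumes "x \<in> val_ge R v k" "y \<in> val_ge R v k"
  shows "x \<oplus> y \<in> val_ge R v k"
proof (cases "x = \<zero> \<or> y = \<zero>")
  case True
  then show ?thesis using assms val_geD(1) by auto
next
  case False
  then show ?thesis using assms val_add[of x y] by (auto simp: val_ge_def)
qed

lemma val_ge_minus: "x \<in> val_ge R v k \<Longrightarrow> \<ominus> x \<in> val_ge R v k"
  using val_minus by (cases "x = \<zero>") (auto simp: val_ge_def)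

lemma val_ge_mult:
  assumes "x \<in> val_ge R v k" "y \<in> val_ge R v l"
  shows "x \<otimes> y \<in> val_ge R v (k + l)"
proof (cases "x = \<zero> \<or> y = \<zero>")
  case True
  then show ?thesis using assms val_geD(1)[of x] val_geD(1)[of y] val_ge_zero by auto
next
  case False
  then show ?thesis using assms val_mult[of x y] by (auto simp: val_ge_def)
qed

lemma val_ge_pow: "x \<in> val_ge R v k \<Longrightarrow> x [^] (n::nat) \<in> val_ge R v (int n * k)"
proof (induction n)
  case 0
  show ?case using val_ge_one by simp
next
  case (Suc n)
  then show ?case using val_ge_mult[of "x [^] n" "int n * k" x k] by (simp add: algebra_simps)
qed

text \<open>
  If the sum had a larger value than \<open>x\<close>, then so would \<open>x = (x + y) - y\<close>.
\<close>

lemma val_add_dominated: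
  assumes x: "x \<in> carrier R" "x \<noteq> \<zero>" and y: "y \<in> val_ge R v (v x + 1)"
  shows "x \<oplus> y \<noteq> \<zero>" "v (x \<oplus> y) = v x"
proof -
  have yc: "y \<in> carrier R" using y val_geD by simp
  show ne: "x \<oplus> y \<noteq> \<zero>"
  proof
    assume a: "x \<oplus> y = \<zero>"
    then have "y = \<ominus> x" using x yc by (metis a_comm minus_equality)
    moreover have "\<ominus> x \<noteq> \<zero>" using x by (metis minus_minus minus_zero)
    ultimately show False using y val_minus[OF x] val_geD(2) by fastforce
  qed
  have "x = (x \<oplus> y) \<oplus> \<ominus> y" using x yc by (simp add: a_assoc r_neg)
  moreover have "x \<oplus> y \<in> val_ge R v (v x)"
    using x y val_ge_antimono[of "v x" "v x + 1"] by (intro val_ge_add) (auto simp: val_ge_def)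
  moreover have "x \<notin> val_ge R v (v x + 1)" using x val_geD(2) by fastforce
  ultimately have "x \<oplus> y \<notin> val_ge R v (v x + 1)" using val_ge_add val_ge_minus[OF y] by metis
  then have "\<not> v x + 1 \<le> v (x \<oplus> y)" using x yc by (simp add: val_ge_def)
  then show "v (x \<oplus> y) = v x"
    using val_geD(2)[OF \<open>x \<oplus> y \<in> val_ge R v (v x)\<close> ne] by linarith
qed

lemma val_finsum_ge:
  assumes "finite A" "\<And>a. a \<in> A \<Longrightarrow> g a \<in> val_ge R v k"
  shows "finsum R g A \<in> val_ge R v k"
  using assms
proof (induction A)
  case empty
  then show ?case using val_ge_zero by simp
next
  case (insert a A)
  then have "finsum R g (insert a A) = g a \<oplus> finsum R g A"
    using val_geD(1) by (intro finsum_insert) auto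
  then show ?case using insert val_ge_add by simp
qed

lemma val_finsum_dominated:
  assumes "finite A" "a \<in> A" "g a \<in> carrier R" "g a \<noteq> \<zero>"
    and "\<And>b. b \<in> A \<Longrightarrow> b \<noteq> a \<Longrightarrow> g b \<in> val_ge R v (v (g a) + 1)"
  shows "finsum R g A \<noteq> \<zero>" "v (finsum R g A) = v (g a)"
proof -
  have "finsum R g (insert a (A - {a})) = g a \<oplus> finsum R g (A - {a})"
    using assms val_geD(1) by (intro finsum_insert) auto
  moreover have "insert a (A - {a}) = A" using assms by auto
  moreover have "finsum R g (A - {a}) \<in> val_ge R v (v (g a) + 1)"
    using assms by (intro val_finsum_ge) auto
  ultimately show "finsum R g A \<noteq> \<zero>" "v (finsum R g A) = v (g a)"
    using val_add_dominated[of "g a"] assms by auto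
qed

end

context plain_field
begin

text \<open>
  By the archimedean property every nonzero element is a unit of \<open>W\<close> times a quotient of powers of
  \<open>\<omega>\<close>, and the difference of the exponents is unique because \<open>\<omega>\<close> is not a unit.
\<close>

theorem valuation_ring_discrete_valuation:
  assumes W: "valuation_ring_of R W"
    and \<omega>: "\<omega> \<in> W" "\<omega> \<noteq> \<zero>" "max_ideal_of R W = (\<lambda>w. \<omega> \<otimes> w) ` W"
    and arch: "\<And>x. x \<in> carrier R \<Longrightarrow> \<exists>n::nat. \<omega> [^] n \<otimes> x \<in> W"
  obtains v where "discrete_valuation R v" "W = val_ge R v 0" "v \<omega> = 1"
proof -
  note W' = subringE[OF valuation_ring_ofE(1)[OF W]]
  have \<omega>c: "\<omega> \<in> carrier R" using \<omega>(1) W'(1) by auto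
  define U where "U = {u \<in> W. u \<noteq> \<zero> \<and> inv u \<in> W}"
  have max: "max_ideal_of R W = W - U"
    using max_ideal_of_subring[OF valuation_ring_ofE(1)[OF W]] U_def by auto
  have U1: "\<one> \<in> U" using W'(3) inv_one by (simp add: U_def)
  have Uc: "u \<in> carrier R" "u \<noteq> \<zero>" if "u \<in> U" for u using that U_def W'(1) by auto
  have Um: "a \<otimes> b \<in> U" if "a \<in> U" "b \<in> U" for a b
  proof -
    have "inv (a \<otimes> b) = inv a \<otimes> inv b"
      using Uc[OF that(1)] Uc[OF that(2)] by (simp add: inv_mult)
    moreover have "a \<otimes> b \<noteq> \<zero>" using Uc[OF that(1)] Uc[OF that(2)] by (simp add: nonzero_mult)
    ultimately show ?thesis using that W'(6)[of a b] W'(6)[of "inv a" "inv b"] by (simp add: U_def)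
  qed
  have \<omega>U: "\<omega> \<otimes> w \<notin> U" if "w \<in> W" for w using that \<omega>(3) max by auto
  have powc: "\<omega> [^] (n::nat) \<in> carrier R" "\<omega> [^] n \<noteq> \<zero>" "\<omega> [^] n \<in> W" for n
    using \<omega>c nonzero_pow[OF \<omega>c \<omega>(2)] subring_pow_closed[OF valuation_ring_ofE(1)[OF W] \<omega>(1)] by auto
  \<comment> \<open>the exponent is the least \<open>n\<close> for which \<open>w\<close> divides the \<open>n\<close>-th power of \<open>\<omega>\<close> in \<open>W\<close>\<close>
  have dW: "\<exists>n. \<exists>u\<in>U. w = \<omega> [^] (n::nat) \<otimes> u" if w: "w \<in> W" "w \<noteq> \<zero>" for w
  proof -
    have wc: "w \<in> carrier R" using w W'(1) by auto
    note iw = nonzero_inv[OF wc w(2)]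
    define n where "n = (LEAST n::nat. \<omega> [^] n \<otimes> inv w \<in> W)"
    have n: "\<omega> [^] n \<otimes> inv w \<in> W" unfolding n_def using LeastI_ex[OF arch[OF iw(1)]] .
    define u where "u = \<omega> [^] n \<otimes> inv w"
    have u: "u \<in> W" "u \<in> carrier R" "u \<noteq> \<zero>" unfolding u_def using n powc iw by (simp_all add: nonzero_mult)
    have uU: "u \<in> U"
    proof (rule ccontr)
      assume "u \<notin> U"
      then obtain w' where w': "w' \<in> W" "u = \<omega> \<otimes> w'" using max u \<omega>(3) by blast
      show False
      proof (cases n)
        case 0
        then have "inv w \<in> W" using n iw by simp
        have w'c: "w' \<in> carrier R" using w'(1) W'(1) by (rule subsetD[rotated])
        have "inv w = \<omega> \<otimes> w'" using w'(2) 0 iw(1) by (simp add: u_def)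
        then have "\<one> = \<omega> \<otimes> w' \<otimes> w" using iw by simp
        then have "\<one> = \<omega> \<otimes> (w' \<otimes> w)" using \<omega>c w'c wc by (simp add: m_assoc)
        then show False using \<omega>U[OF W'(6)[OF w'(1) w(1)]] U1 by simp
      next
        case (Suc k)
        have "\<omega> \<otimes> (\<omega> [^] k \<otimes> inv w) = \<omega> \<otimes> w'"
          using w'(2) m_comm[OF powc(1)[of k] \<omega>c] m_assoc[OF \<omega>c powc(1)[of k] iw(1)]
          by (simp add: u_def Suc)
        then have "\<omega> [^] k \<otimes> inv w = w'" using m_lcancel[OF \<omega>(2) \<omega>c] powc iw w'(1) W'(1) by (simp add: subset_iff)
        then have "\<omega> [^] k \<otimes> inv w \<in> W" using w' by simp
        then have "n \<le> k" unfolding n_def by (rule Least_le)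
        then show False using Suc by simp
      qed
    qed
    have iu: "inv u \<in> U" using uU nonzero_inv[OF u(2,3)] inv_inv[OF u(2,3)] unfolding U_def by simp
    have "w = \<omega> [^] n \<otimes> inv u"
    proof -
      have "u \<otimes> w = \<omega> [^] n \<otimes> (inv w \<otimes> w)" unfolding u_def using iw wc powc by (simp add: m_assoc)
      then have "u \<otimes> w = \<omega> [^] n" using iw powc by simp
      then have "inv u \<otimes> (u \<otimes> w) = inv u \<otimes> \<omega> [^] n" by simp
      then have "(inv u \<otimes> u) \<otimes> w = inv u \<otimes> \<omega> [^] n" using nonzero_inv(1)[OF u(2,3)] u(2) wc by (simp add: m_assoc)
      then show ?thesis using nonzero_inv[OF u(2,3)] wc m_comm[OF powc(1)[of n]] by simp
    qed
    then show ?thesis using iu by blast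
  qed
  \<comment> \<open>\<open>rep x k\<close>: \<open>x\<close> is \<open>\<omega>\<close> to the integer power \<open>k\<close> times a unit\<close>
  define rep where "rep x k \<longleftrightarrow> (\<exists>n m::nat. \<exists>u\<in>U. k = int n - int m \<and> x \<otimes> \<omega> [^] m = \<omega> [^] n \<otimes> u)" for x k
  have powadd: "\<omega> [^] a \<otimes> \<omega> [^] b = \<omega> [^] (a + b)" for a b :: nat using nat_pow_mult[OF \<omega>c] by simp
  have pow_unique: "n = m" if "u \<in> U" "u' \<in> U" "\<omega> [^] n \<otimes> u = \<omega> [^] m \<otimes> u'" for u u' and n m :: nat
  proof -
    have aux: False if a: "n < m" "u \<in> U" "u' \<in> U" "\<omega> [^] n \<otimes> u = \<omega> [^] m \<otimes> u'" for u u' and n m :: nat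
    proof -
      obtain d where d: "m = n + Suc d" using a(1) less_imp_Suc_add by auto
      have "\<omega> [^] n \<otimes> u = \<omega> [^] n \<otimes> (\<omega> \<otimes> (\<omega> [^] d \<otimes> u'))"
        using a(4) \<omega>c powc(1) Uc(1)[OF a(3)] unfolding d powadd[symmetric] nat_pow_Suc
        by (simp add: m_assoc m_comm[of "\<omega> [^] d" \<omega>])
      then have "u = \<omega> \<otimes> (\<omega> [^] d \<otimes> u')" 
        using m_lcancel[OF powc(2,1)] Uc(1)[OF a(2)] Uc(1)[OF a(3)] \<omega>c powc(1) by simp
      moreover have "\<omega> [^] d \<otimes> u' \<in> W" using W'(6)[OF powc(3)[of d], of u'] a(3) by (simp add: U_def)
      ultimately show False using \<omega>U a(2) by blast
    qed
    show ?thesis using aux[of n m u u'] aux[of m n u' u] that by (metis linorder_neqE_nat)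
  qed
  have rep_ex: "\<exists>k. rep x k" if x: "x \<in> carrier R" "x \<noteq> \<zero>" for x
  proof -
    obtain m :: nat where m: "\<omega> [^] m \<otimes> x \<in> W" using arch[OF x(1)] by blast
    moreover have "\<omega> [^] m \<otimes> x \<noteq> \<zero>" using nonzero_mult powc x by simp
    ultimately obtain n u where "u \<in> U" "\<omega> [^] m \<otimes> x = \<omega> [^] (n::nat) \<otimes> u" using dW by blast
    then have "x \<otimes> \<omega> [^] m = \<omega> [^] n \<otimes> u" "u \<in> U" using m_comm[OF powc(1)[of m] x(1)] by simp_all
    then show ?thesis unfolding rep_def by blast
  qed
  have rep_mult: "rep (x \<otimes> y) (k + l)" if xy: "x \<in> carrier R" "y \<in> carrier R" "rep x k" "rep y l" for x y k l
  proof -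
    obtain n m u where a: "u \<in> U" "k = int n - int m" "x \<otimes> \<omega> [^] m = \<omega> [^] n \<otimes> u"
      using xy(3) rep_def by blast
    obtain n' m' u' where b: "u' \<in> U" "l = int n' - int m'" "y \<otimes> \<omega> [^] m' = \<omega> [^] n' \<otimes> u'"
      using xy(4) rep_def by blast
    note c = xy(1,2) powc(1)[of n] powc(1)[of m] powc(1)[of n'] powc(1)[of m'] Uc(1)[OF a(1)] Uc(1)[OF b(1)]
    have "(x \<otimes> y) \<otimes> \<omega> [^] (m + m') = (x \<otimes> \<omega> [^] m) \<otimes> (y \<otimes> \<omega> [^] m')"
      unfolding powadd[symmetric] using c by algebra
    also have "\<dots> = \<omega> [^] (n + n') \<otimes> (u \<otimes> u')"
      unfolding a(3) b(3) powadd[symmetric] using c by algebra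
    finally show ?thesis unfolding rep_def
      using a(2) b(2) Um[OF a(1) b(1)] by (intro exI[of _ "n + n'"] exI[of _ "m + m'"] bexI[of _ "u \<otimes> u'"]) auto
  qed
  have rep_unique: "k = l" if x: "x \<in> carrier R" "rep x k" "rep x l" for x k l
  proof -
    obtain n m u where a: "u \<in> U" "k = int n - int m" "x \<otimes> \<omega> [^] m = \<omega> [^] n \<otimes> u"
      using x(2) rep_def by blast
    obtain n' m' u' where b: "u' \<in> U" "l = int n' - int m'" "x \<otimes> \<omega> [^] m' = \<omega> [^] n' \<otimes> u'"
      using x(3) rep_def by blast
    note c = x(1) powc(1)[of n] powc(1)[of m] powc(1)[of n'] powc(1)[of m'] Uc(1)[OF a(1)] Uc(1)[OF b(1)]
    have "\<omega> [^] (n + m') \<otimes> u = (\<omega> [^] n \<otimes> u) \<otimes> \<omega> [^] m'" unfolding powadd[symmetric] using c by algebra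
    also have "\<dots> = (x \<otimes> \<omega> [^] m') \<otimes> \<omega> [^] m" unfolding a(3)[symmetric] using c by algebra
    also have "\<dots> = \<omega> [^] (n' + m) \<otimes> u'" unfolding b(3) powadd[symmetric] using c by algebra
    finally have "n + m' = n' + m" using pow_unique[OF a(1) b(1)] by blast
    then show ?thesis using a(2) b(2) by simp
  qed
  define v where "v x = (THE k. rep x k)" for x
  have v: "v x = k" if "x \<in> carrier R" "rep x k" for x k
    unfolding v_def using that rep_unique by (intro the_equality) auto
  have vrep: "rep x (v x)" if "x \<in> carrier R" "x \<noteq> \<zero>" for x
    using rep_ex[OF that] v that by metis
  have vm: "v (x \<otimes> y) = v x + v y" if "x \<in> carrier R" "y \<in> carrier R" "x \<noteq> \<zero>" "y \<noteq> \<zero>" for x y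
    using v[OF _ rep_mult[OF that(1,2) vrep vrep]] that by simp
  have vpow: "v (\<omega> [^] n \<otimes> u) = int n" if "u \<in> U" for n u
  proof (rule v)
    show "\<omega> [^] n \<otimes> u \<in> carrier R" using powc Uc that by simp
    show "rep (\<omega> [^] n \<otimes> u) (int n)"
      unfolding rep_def using that powc Uc[OF that] by (intro exI[of _ n] exI[of _ 0] bexI[of _ u]) auto
  qed
  have v\<omega>: "v \<omega> = 1" using vpow[OF U1, of 1] \<omega>c by (simp add: nat_pow_eone)
  have vW: "x \<in> W \<longleftrightarrow> 0 \<le> v x" if x: "x \<in> carrier R" "x \<noteq> \<zero>" for x
  proof
    assume "x \<in> W"
    then show "0 \<le> v x" using dW[OF _ x(2)] vpow by fastforce
  next
    assume v0: "0 \<le> v x"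
    show "x \<in> W"
    proof (rule ccontr)
      assume nW: "x \<notin> W"
      then have i: "inv x \<in> W" "inv x \<noteq> \<zero>" "inv x \<in> carrier R"
        using valuation_ring_ofE(2)[OF W x] nonzero_inv[OF x] by auto
      then obtain n u where nu: "u \<in> U" "inv x = \<omega> [^] (n::nat) \<otimes> u" using dW by blast
      have "v (x \<otimes> inv x) = v x + int n" using vm[OF x(1) i(3) x(2) i(2)] vpow[OF nu(1)] nu(2) by simp
      moreover have "v \<one> = 0" using vpow[OF U1, of 0] by simp
      ultimately have "n = 0" using v0 nonzero_inv[OF x] by simp
      then have "inv x \<in> U" using nu Uc by simp
      then show False using nW inv_inv[OF x] unfolding U_def by simp
    qed
  qed
  have "discrete_valuation R v"
  proof (unfold_locales)
    show "v (x \<otimes> y) = v x + v y" if "x \<in> carrier R" "y \<in> carrier R" "x \<noteq> \<zero>" "y \<noteq> \<zero>" for x y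
      using vm that .
    fix x y assume xy: "x \<in> carrier R" "y \<in> carrier R" "x \<noteq> \<zero>" "y \<noteq> \<zero>" "x \<oplus> y \<noteq> \<zero>"
    \<comment> \<open>if \<open>v x \<le> v y\<close>, then \<open>1 + y / x\<close> lies in \<open>W\<close>\<close>
    have aux: "v x \<le> v (x \<oplus> y)" if xy: "x \<in> carrier R" "y \<in> carrier R" "x \<noteq> \<zero>" "y \<noteq> \<zero>" "x \<oplus> y \<noteq> \<zero>" "v x \<le> v y" for x y
    proof -
      note i = nonzero_inv[OF xy(1,3)]
      have "v x + v (y \<otimes> inv x) = v (x \<otimes> (y \<otimes> inv x))"
        using vm[of x "y \<otimes> inv x"] xy i nonzero_mult by simp
      also have "x \<otimes> (y \<otimes> inv x) = y \<otimes> (x \<otimes> inv x)" using xy(1,2) i(1) by algebra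
      finally have "0 \<le> v (y \<otimes> inv x)" using i xy by simp
      then have "y \<otimes> inv x \<in> W" using vW[of "y \<otimes> inv x"] xy i nonzero_mult by simp
      then have s: "\<one> \<oplus> y \<otimes> inv x \<in> W" using W'(7)[OF W'(3)] by simp
      have eq: "x \<oplus> y = x \<otimes> (\<one> \<oplus> y \<otimes> inv x)"
      proof -
        have "x \<otimes> (\<one> \<oplus> y \<otimes> inv x) = x \<oplus> y \<otimes> (x \<otimes> inv x)" using xy(1,2) i(1) by algebra
        then show ?thesis using i xy by simp
      qed
      have n0: "\<one> \<oplus> y \<otimes> inv x \<noteq> \<zero>" using eq xy by auto
      have "v (x \<oplus> y) = v x + v (\<one> \<oplus> y \<otimes> inv x)" 
        unfolding eq using vm[OF xy(1) _ xy(3) n0] s W'(1) by (simp add: subset_iff)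
      then show ?thesis using vW[OF _ n0] s W'(1) by (simp add: subset_iff)
    qed
    show "min (v x) (v y) \<le> v (x \<oplus> y)"
      using aux[of x y] aux[of y x] xy a_comm[of x y] by (cases "v x \<le> v y") auto
  qed
  moreover have "W = val_ge R v 0" using vW W'(1,2) by (auto simp: val_ge_def)
  ultimately show ?thesis using v\<omega> that by blast
qed

end

section \<open>Weak approximation\<close>

lemma exists_multiplier_dominating:
  fixes g h :: "'k \<Rightarrow> int"
  assumes "finite A" "\<And>a. a \<in> A \<Longrightarrow> 0 < g a"
  obtains n :: nat where "0 < n" "\<And>a. a \<in> A \<Longrightarrow> h a < int n * g a"
proof -
  define n where "n = Suc (\<Sum>a\<in>A. nat \<bar>h a\<bar>)"
  have "h a < int n * g a" if a: "a \<in> A" for a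
  proof -
    have "nat \<bar>h a\<bar> \<le> (\<Sum>a\<in>A. nat \<bar>h a\<bar>)" using a assms(1) by (intro member_le_sum) auto
    then have "h a < int n" unfolding n_def by linarith
    also have "int n \<le> int n * g a" using assms(2)[OF a] mult_left_mono[of 1 "g a" "int n"] by simp
    finally show ?thesis .
  qed
  then show ?thesis using that[of n] n_def by simp
qed

context discrete_valuation
begin

lemma val_one_add_pos:
  assumes "x \<in> carrier R" "x \<noteq> \<zero>" "0 < v x"
  shows "\<one> \<oplus> x \<noteq> \<zero>" "v (\<one> \<oplus> x) = 0"
  using val_add_dominated[of \<one> x] assms by (simp_all add: val_one val_ge_def)

lemma val_one_add_neg:
  assumes "x \<in> carrier R" "x \<noteq> \<zero>" "v x < 0"
  shows "\<one> \<oplus> x \<noteq> \<zero>" "v (\<one> \<oplus> x) = v x"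
  using val_add_dominated[of x \<one>] assms by (simp_all add: val_one val_ge_def a_comm)

end

context plain_field
begin

context
  fixes K :: "'k set" and v :: "'k \<Rightarrow> 'a \<Rightarrow> int"
  assumes val: "\<And>k. k \<in> K \<Longrightarrow> discrete_valuation R (v k)"
    and uniformizer: "\<And>k. k \<in> K \<Longrightarrow> \<exists>w\<in>carrier R - {\<zero>}. v k w = 1"
    and incomparable: "\<And>k l. k \<in> K \<Longrightarrow> l \<in> K \<Longrightarrow> k \<noteq> l \<Longrightarrow>
      \<exists>a\<in>carrier R - {\<zero>}. 0 \<le> v k a \<and> v l a < 0"
begin

text \<open>
  The quotient of an element of the second ring outside the first by an element of the first
  outside the second.
\<close>

lemma separating_pair:
  assumes k: "k \<in> K" "l \<in> K" "k \<noteq> l"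
  obtains w where "w \<in> carrier R" "w \<noteq> \<zero>" "v k w < 0" "0 < v l w"
proof -
  interpret k: discrete_valuation R "v k" by (rule val[OF k(1)])
  interpret l: discrete_valuation R "v l" by (rule val[OF k(2)])
  obtain a where a: "a \<in> carrier R" "a \<noteq> \<zero>" "0 \<le> v k a" "v l a < 0"
    using incomparable[OF k] by blast
  obtain b where b: "b \<in> carrier R" "b \<noteq> \<zero>" "0 \<le> v l b" "v k b < 0"
    using incomparable[OF k(2,1)] k(3) by blast
  note i = nonzero_inv[OF a(1,2)]
  show ?thesis
    using that[of "b \<otimes> inv a"] a b i k.val_mult[of b "inv a"] l.val_mult[of b "inv a"]
      k.val_inv[of a] l.val_inv[of a] nonzero_mult[of b "inv a"]
    by simp
qed

text \<open>
  Induction on \<open>L\<close>. A new index \<open>m\<close> is handled by an element \<open>w\<close> that separates \<open>k\<close> from \<open>m\<close>: with a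
  high power \<open>t\<close> of the element found so far, take \<open>t w\<close> if \<open>t\<close> is integral at \<open>m\<close>, and otherwise
  \<open>t w / (1 + t)\<close>. The exponent is chosen such that \<open>t\<close> outweighs \<open>w\<close> at the indices in \<open>L\<close>.
\<close>

lemma separating_element:
  assumes k: "k \<in> K" and L: "finite L" "L \<subseteq> K - {k}"
  shows "\<exists>z\<in>carrier R - {\<zero>}. v k z < 0 \<and> (\<forall>l\<in>L. 0 < v l z)"
  using L
proof (induction L)
  case empty
  interpret k: discrete_valuation R "v k" by (rule val[OF k])
  obtain w where "w \<in> carrier R" "w \<noteq> \<zero>" "v k w = 1" using uniformizer[OF k] by blast
  then show ?case using nonzero_inv[of w] k.val_inv[of w] by (intro bexI[of _ "inv w"]) simp_all
next
  case (insert m L)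
  interpret k: discrete_valuation R "v k" by (rule val[OF k])
  have m: "m \<in> K" "k \<noteq> m" using insert by auto
  interpret m: discrete_valuation R "v m" by (rule val[OF m(1)])
  obtain z where z: "z \<in> carrier R" "z \<noteq> \<zero>" "v k z < 0" "\<And>l. l \<in> L \<Longrightarrow> 0 < v l z"
    using insert by blast
  obtain w where w: "w \<in> carrier R" "w \<noteq> \<zero>" "v k w < 0" "0 < v m w"
    using separating_pair[OF k m] .
  obtain n :: nat where n: "0 < n" "\<And>l. l \<in> L \<Longrightarrow> - v l w < int n * v l z"
    using exists_multiplier_dominating[OF insert.hyps(1), of "\<lambda>l. v l z" "\<lambda>l. - v l w"] z(4) by blast
  define t where "t = z [^] n"
  have t: "t \<in> carrier R" "t \<noteq> \<zero>" using z nonzero_pow t_def by auto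
  have vt: "v l t = int n * v l z" if "l \<in> K" for l
    unfolding t_def by (rule discrete_valuation.val_pow[OF val[OF that] z(1,2)])
  have tk: "v k t < 0" using vt[OF k] z(3) n(1) by (simp add: mult_pos_neg)
  have tL: "0 < v l t" "0 < v l t + v l w" if l: "l \<in> L" for l
    using vt[of l] l insert.prems n(2)[OF l] n(1) z(4)[OF l] by auto
  show ?case
  proof (cases "0 \<le> v m z")
    case True
    have mult: "v l (t \<otimes> w) = v l t + v l w" if "l \<in> K" for l
      using discrete_valuation.val_mult[OF val[OF that]] t w by simp
    have "0 \<le> v m t" using True vt[OF m(1)] by simp
    moreover have "L \<subseteq> K" using insert.prems by auto
    ultimately show ?thesis
      using t w tk tL mult[OF k] mult[OF m(1)] mult nonzero_mult
      by (intro bexI[of _ "t \<otimes> w"]) (auto simp: subset_iff)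
  next
    case False
    \<comment> \<open>here \<open>z\<close> is also large at \<open>m\<close>, so \<open>t / (1 + t)\<close> is a unit at both \<open>k\<close> and \<open>m\<close>\<close>
    define s where "s = \<one> \<oplus> t"
    have tm: "v m t < 0" using False vt[OF m(1)] n(1) by (simp add: mult_pos_neg)
    have s: "s \<in> carrier R" "s \<noteq> \<zero>" "v k s = v k t" "v m s = v m t"
      using k.val_one_add_neg[OF t tk] m.val_one_add_neg[OF t tm] t s_def by auto
    have sL: "v l s = 0" if "l \<in> L" for l
      using discrete_valuation.val_one_add_pos[OF val t tL(1)[OF that]] that insert.prems s_def by auto
    note i = nonzero_inv[OF s(1,2)]
    define u where "u = t \<otimes> inv s \<otimes> w"
    have u: "u \<in> carrier R" "u \<noteq> \<zero>" unfolding u_def using t i w nonzero_mult by simp_all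
    have vu: "v l u = v l t - v l s + v l w" if "l \<in> K" for l
    proof -
      interpret l: discrete_valuation R "v l" by (rule val[OF that])
      show ?thesis unfolding u_def
        using l.val_mult[of "t \<otimes> inv s" w] l.val_mult[of t "inv s"] l.val_inv[OF s(1,2)] t i w nonzero_mult[of t "inv s"]
        by simp
    qed
    have "0 < v l u" if "l \<in> L" for l using vu[of l] tL(2)[OF that] sL[OF that] that insert.prems by auto
    then show ?thesis
      using u vu[OF k] vu[OF m(1)] s w by (intro bexI[of _ u]) auto
  qed
qed

text \<open>
  For \<open>z\<close> that separates \<open>k\<close> from all other indices, \<open>u = z / (1 + z)\<close> has value 0 at \<open>k\<close> and positive
  values elsewhere. A uniformizer at \<open>k\<close> times a high power of \<open>u\<close> thus has value 1 at \<open>k\<close> and at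
  least 2 elsewhere, and the sum of these elements over all \<open>k\<close> has value 1 everywhere.
\<close>

theorem simultaneous_uniformizer:
  assumes fin: "finite K"
  obtains y where "y \<in> carrier R" "y \<noteq> \<zero>" "\<And>k. k \<in> K \<Longrightarrow> v k y = 1"
proof -
  have "\<exists>x. x \<in> carrier R \<and> x \<noteq> \<zero> \<and> v k x = 1 \<and> (\<forall>l\<in>K - {k}. 2 \<le> v l x)" if k: "k \<in> K" for k
  proof -
    interpret k: discrete_valuation R "v k" by (rule val[OF k])
    obtain z where z: "z \<in> carrier R" "z \<noteq> \<zero>" "v k z < 0" "\<And>l. l \<in> K - {k} \<Longrightarrow> 0 < v l z"
      using separating_element[OF k, of "K - {k}"] fin by blast
    obtain w where w: "w \<in> carrier R" "w \<noteq> \<zero>" "v k w = 1" using uniformizer[OF k] by blast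
    define s where "s = \<one> \<oplus> z"
    have s: "s \<in> carrier R" "s \<noteq> \<zero>" "v k s = v k z"
      using k.val_one_add_neg[OF z(1-3)] z s_def by auto
    have sL: "v l s = 0" if "l \<in> K - {k}" for l
      using discrete_valuation.val_one_add_pos[OF val z(1,2) z(4)[OF that]] that s_def by auto
    note i = nonzero_inv[OF s(1,2)]
    define u where "u = z \<otimes> inv s"
    have u: "u \<in> carrier R" "u \<noteq> \<zero>" unfolding u_def using z i nonzero_mult by simp_all
    have vu: "v l u = v l z - v l s" if "l \<in> K" for l
    proof -
      interpret l: discrete_valuation R "v l" by (rule val[OF that])
      show ?thesis unfolding u_def using l.val_mult[of z "inv s"] l.val_inv[OF s(1,2)] z i by simp
    qed
    obtain n :: nat where n: "0 < n" "\<And>l. l \<in> K - {k} \<Longrightarrow> 1 - v l w < int n * v l z"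
      using exists_multiplier_dominating[of "K - {k}" "\<lambda>l. v l z" "\<lambda>l. 1 - v l w"] fin z(4) by blast
    define x where "x = w \<otimes> u [^] n"
    have x: "x \<in> carrier R" "x \<noteq> \<zero>" unfolding x_def using w u nonzero_mult nonzero_pow by simp_all
    have vx: "v l x = v l w + int n * v l u" if "l \<in> K" for l
    proof -
      interpret l: discrete_valuation R "v l" by (rule val[OF that])
      show ?thesis unfolding x_def
        using l.val_mult[of w "u [^] n"] l.val_pow[OF u] w u nonzero_pow[OF u] by simp
    qed
    have "v k x = 1" using vx[OF k] vu[OF k] s w by simp
    moreover have "2 \<le> v l x" if "l \<in> K - {k}" for l
      using vx[of l] vu[of l] sL[OF that] n(2)[OF that] that by auto
    ultimately show ?thesis using x by blast
  qed
  then obtain x where x: "\<And>k. k \<in> K \<Longrightarrow> x k \<in> carrier R \<and> x k \<noteq> \<zero> \<and> v k (x k) = 1 \<and> (\<forall>l\<in>K - {k}. 2 \<le> v l (x k))"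
    by metis
  show ?thesis
  proof (cases "K = {}")
    case True
    then show ?thesis using that[of \<one>] by simp
  next
    case False
    have sum: "finsum R x K \<noteq> \<zero> \<and> v k (finsum R x K) = 1" if k: "k \<in> K" for k
    proof -
      interpret k: discrete_valuation R "v k" by (rule val[OF k])
      have "x l \<in> val_ge R (v k) (v k (x k) + 1)" if "l \<in> K" "l \<noteq> k" for l
        using x[OF k] x[OF that(1)] that k by (auto simp: val_ge_def)
      then show ?thesis using k.val_finsum_dominated[OF fin k, of x] x[OF k] by auto
    qed
    have "finsum R x K \<in> carrier R" using x by (intro finsum_closed) auto
    then show ?thesis using that[of "finsum R x K"] sum False by blast
  qed
qed

end

end

section \<open>Powers and products of ideals\<close>

locale plain_cring = cring R for R :: "'a ring" (structure)

lemma (in plain_cring) idealI_commutative: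
  assumes J: "J \<subseteq> carrier R" "\<zero> \<in> J" "\<And>a b. a \<in> J \<Longrightarrow> b \<in> J \<Longrightarrow> a \<oplus> b \<in> J"
    "\<And>a x. a \<in> J \<Longrightarrow> x \<in> carrier R \<Longrightarrow> x \<otimes> a \<in> J"
  shows "ideal J R"
proof (rule idealI)
  show "ring R" by (rule ring_axioms)
  have neg: "\<ominus> a \<in> J" if "a \<in> J" for a
  proof -
    have "(\<ominus> \<one>) \<otimes> a = \<ominus> a" using J(1) that by (simp add: l_minus subset_iff)
    then show ?thesis using J(4)[OF that, of "\<ominus> \<one>"] by simp
  qed
  show "subgroup J (add_monoid R)"
    using J(1) by (intro add.subgroupI) (use J(2,3) neg in auto)
  show "x \<otimes> a \<in> J" if "a \<in> J" "x \<in> carrier R" for a x by (rule J(4)[OF that])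
  show "a \<otimes> x \<in> J" if "a \<in> J" "x \<in> carrier R" for a x
    using J(1) J(4)[OF that] that m_comm[of a x] by (simp add: subset_iff)
qed

lemma ideal_memD:
  assumes "ideal J R"
  shows "J \<subseteq> carrier R" "\<zero>\<^bsub>R\<^esub> \<in> J"
    "\<And>a b. a \<in> J \<Longrightarrow> b \<in> J \<Longrightarrow> a \<oplus>\<^bsub>R\<^esub> b \<in> J"
    "\<And>a x. a \<in> J \<Longrightarrow> x \<in> carrier R \<Longrightarrow> x \<otimes>\<^bsub>R\<^esub> a \<in> J"
  using additive_subgroup.a_subset[OF ideal.axioms(1)[OF assms]]
    additive_subgroup.zero_closed[OF ideal.axioms(1)[OF assms]]
    additive_subgroup.a_closed[OF ideal.axioms(1)[OF assms]] ideal.I_l_closed[OF assms]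
  by simp_all

lemma ideal_power_0: "ideal_power R J 0 = carrier R"
  by (simp add: ideal_power_def nat_pow_def ideals_set_def)

lemma ideal_power_Suc: "ideal_power R J (Suc n) = ideal_prod R (ideal_power R J n) J"
  by (simp add: ideal_power_def nat_pow_def ideals_set_def)

lemma (in plain_cring) ideal_power_ideal: "ideal J R \<Longrightarrow> ideal (ideal_power R J n) R"
  by (induction n) (simp_all add: ideal_power_0 ideal_power_Suc oneideal ideal_prod_is_ideal)

lemma (in plain_cring) pow_mem_ideal_power: "x \<in> J \<Longrightarrow> x [^] n \<in> ideal_power R J n"
  by (induction n) (simp_all add: ideal_power_0 ideal_power_Suc ideal_prod.prod)

text \<open>
  The sets \<open>G n\<close> bound the powers of \<open>J\<close> from above. They will be the sets of elements of value at least
  \<open>n * k\<close> or, in \<open>valuation_ring_ideal_power\<close>, the multiples of \<open>n\<close>-th powers of elements of \<open>J\<close>.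
\<close>

lemma ideal_power_filtration:
  fixes G :: "nat \<Rightarrow> 'a set"
  assumes "carrier R \<subseteq> G 0"
    and "\<And>n a b. a \<in> G n \<Longrightarrow> b \<in> G n \<Longrightarrow> a \<oplus>\<^bsub>R\<^esub> b \<in> G n"
    and "\<And>n a b. a \<in> G n \<Longrightarrow> b \<in> J \<Longrightarrow> a \<otimes>\<^bsub>R\<^esub> b \<in> G (Suc n)"
  shows "ideal_power R J n \<subseteq> G n"
proof (induction n)
  case 0
  show ?case using assms(1) by (simp add: ideal_power_0)
next
  case (Suc n)
  show ?case
  proof
    fix a assume "a \<in> ideal_power R J (Suc n)"
    then have "a \<in> ideal_prod R (ideal_power R J n) J" by (simp add: ideal_power_Suc)
    then show "a \<in> G (Suc n)"
    proof (induction rule: ideal_prod.induct)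
      case (prod i j)
      then show ?case using Suc assms(3) by blast
    next
      case (sum s1 s2)
      then show ?case using assms(2) by blast
    qed
  qed
qed

lemma (in plain_cring) ideal_power_subset:
  assumes J: "ideal J R" and n: "0 < n"
  shows "ideal_power R J n \<subseteq> J"
proof -
  obtain k where k: "n = Suc k" using n gr0_implies_Suc by blast
  show ?thesis unfolding k ideal_power_Suc
    using ideal_prod_inter[OF ideal_power_ideal[OF J] J] by blast
qed

text \<open>
  The three properties are proved by one induction, since the product of ideals is well behaved for
  ideals only.
\<close>

lemma (in plain_cring) finprod_ideals:
  assumes "finite A" "\<And>i. i \<in> A \<Longrightarrow> ideal (J i) R"
  shows "ideal (\<Otimes>\<^bsub>ideals_set R\<^esub>i\<in>A. J i) R"
    and "\<And>i. i \<in> A \<Longrightarrow> (\<Otimes>\<^bsub>ideals_set R\<^esub>i\<in>A. J i) \<subseteq> J i"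
    and "\<And>x. (\<And>i. i \<in> A \<Longrightarrow> x i \<in> J i) \<Longrightarrow> (\<Otimes>i\<in>A. x i) \<in> (\<Otimes>\<^bsub>ideals_set R\<^esub>i\<in>A. J i)"
proof -
  interpret ids: comm_monoid "ideals_set R" by (rule ideals_set_is_comm_monoid)
  have "ideal (\<Otimes>\<^bsub>ideals_set R\<^esub>i\<in>A. J i) R \<and> (\<forall>i\<in>A. (\<Otimes>\<^bsub>ideals_set R\<^esub>i\<in>A. J i) \<subseteq> J i) \<and>
    (\<forall>x. (\<forall>i\<in>A. x i \<in> J i) \<longrightarrow> (\<Otimes>i\<in>A. x i) \<in> (\<Otimes>\<^bsub>ideals_set R\<^esub>i\<in>A. J i))"
    using assms
  proof (induction A)
    case empty
    have "(\<Otimes>\<^bsub>ideals_set R\<^esub>i\<in>{}. J i) = carrier R"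
      using ids.finprod_empty[of J] by (simp add: ideals_set_def)
    then show ?case using oneideal by simp
  next
    case (insert k A)
    have J: "\<And>i. i \<in> insert k A \<Longrightarrow> ideal (J i) R" using insert.prems by blast
    define P where "P = (\<Otimes>\<^bsub>ideals_set R\<^esub>i\<in>A. J i)"
    have IH: "ideal P R" "\<And>i. i \<in> A \<Longrightarrow> P \<subseteq> J i"
      "\<And>x. (\<And>i. i \<in> A \<Longrightarrow> x i \<in> J i) \<Longrightarrow> (\<Otimes>i\<in>A. x i) \<in> P"
      using insert.IH J unfolding P_def by blast+
    have "(\<Otimes>\<^bsub>ideals_set R\<^esub>i\<in>insert k A. J i) = J k \<otimes>\<^bsub>ideals_set R\<^esub> P"
      unfolding P_def using insert.hyps J by (intro ids.finprod_insert) (auto simp: ideals_set_def)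
    then have eq: "(\<Otimes>\<^bsub>ideals_set R\<^esub>i\<in>insert k A. J i) = ideal_prod R (J k) P"
      by (simp add: ideals_set_def)
    have Jk: "ideal (J k) R" using J by blast
    have mem: "(\<Otimes>i\<in>insert k A. x i) \<in> ideal_prod R (J k) P" if x: "\<forall>i\<in>insert k A. x i \<in> J i" for x
    proof -
      have "x i \<in> carrier R" if "i \<in> insert k A" for i
        using x that J[OF that] ideal_memD(1) by blast
      then have "(\<Otimes>i\<in>insert k A. x i) = x k \<otimes> (\<Otimes>i\<in>A. x i)"
        using insert.hyps by (intro finprod_insert) auto
      moreover have "x k \<in> J k" using x by blast
      moreover have "(\<Otimes>i\<in>A. x i) \<in> P" using IH(3)[of x] x by blast
      ultimately show ?thesis using ideal_prod.prod[of "x k" "J k"] by simp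
    qed
    have "ideal_prod R (J k) P \<subseteq> J k \<inter> P" by (rule ideal_prod_inter[OF Jk IH(1)])
    then show ?case unfolding eq using ideal_prod_is_ideal[OF Jk IH(1)] mem IH(2) by blast
  qed
  then show "ideal (\<Otimes>\<^bsub>ideals_set R\<^esub>i\<in>A. J i) R"
    and "\<And>i. i \<in> A \<Longrightarrow> (\<Otimes>\<^bsub>ideals_set R\<^esub>i\<in>A. J i) \<subseteq> J i"
    and "\<And>x. (\<And>i. i \<in> A \<Longrightarrow> x i \<in> J i) \<Longrightarrow> (\<Otimes>i\<in>A. x i) \<in> (\<Otimes>\<^bsub>ideals_set R\<^esub>i\<in>A. J i)"
    by blast+
qed

text \<open>
  Congruence of \<open>a\<close> to \<open>\<one>\<close> modulo \<open>Q\<close> is expressed by \<open>a \<oplus> p = \<one>\<close> with \<open>p \<in> Q\<close>, because subtraction in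
  a subring, unlike addition, is not literally that of the ambient ring.
\<close>

lemma (in plain_cring) congruent_one_mult:
  assumes Q: "ideal Q R" and a: "a \<in> carrier R" "p \<in> Q" "a \<oplus> p = \<one>" and b: "b \<in> carrier R" "q \<in> Q" "b \<oplus> q = \<one>"
  shows "\<exists>r\<in>Q. (a \<otimes> b) \<oplus> r = \<one>"
proof -
  note Q' = ideal_memD[OF Q]
  have c: "p \<in> carrier R" "q \<in> carrier R" using a(2) b(2) Q'(1) by auto
  have "(a \<otimes> b) \<oplus> (a \<otimes> q \<oplus> (b \<oplus> q) \<otimes> p) = (a \<oplus> p) \<otimes> (b \<oplus> q)" using a(1) b(1) c by algebra
  also have "\<dots> = \<one>" using a b by simp
  finally have "(a \<otimes> b) \<oplus> (a \<otimes> q \<oplus> (b \<oplus> q) \<otimes> p) = \<one>" .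
  moreover have "a \<otimes> q \<oplus> (b \<oplus> q) \<otimes> p \<in> Q"
    using Q'(3)[OF Q'(4)[OF b(2) a(1)] Q'(4)[OF a(2), of "b \<oplus> q"]] b(1) c by simp
  ultimately show ?thesis by blast
qed

lemma (in plain_cring) congruent_one_pow:
  assumes Q: "ideal Q R" and a: "a \<in> carrier R" "p \<in> Q" "a \<oplus> p = \<one>"
  shows "\<exists>r\<in>Q. a [^] (n::nat) \<oplus> r = \<one>"
proof (induction n)
  case 0
  show ?case using ideal_memD(2)[OF Q] by (intro bexI[of _ \<zero>]) auto
next
  case (Suc n)
  then obtain r where "r \<in> Q" "a [^] n \<oplus> r = \<one>" by blast
  then show ?case using congruent_one_mult[OF Q nat_pow_closed[OF a(1)] _ _ a] by simp
qed

lemma (in plain_cring) congruent_one_finprod: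
  assumes Q: "ideal Q R" and "finite A"
    and "\<And>i. i \<in> A \<Longrightarrow> g i \<in> carrier R \<and> (\<exists>r\<in>Q. g i \<oplus> r = \<one>)"
  shows "\<exists>r\<in>Q. finprod R g A \<oplus> r = \<one>"
  using assms(2,3)
proof (induction A)
  case empty
  show ?case using ideal_memD(2)[OF Q] by (intro bexI[of _ \<zero>]) auto
next
  case (insert k A)
  have c: "g \<in> A \<rightarrow> carrier R" "g k \<in> carrier R" using insert.prems by auto
  obtain r where r: "r \<in> Q" "finprod R g A \<oplus> r = \<one>" using insert by blast
  obtain s where s: "s \<in> Q" "g k \<oplus> s = \<one>" using insert.prems by blast
  show ?case
    using congruent_one_mult[OF Q c(2) s finprod_closed[OF c(1)] r]
      finprod_insert[OF insert.hyps c] by simp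
qed

lemma (in plain_cring) maximalideal_comaximal:
  assumes M: "maximalideal M R" and Q: "ideal Q R" "\<not> Q \<subseteq> M"
  obtains a q where "a \<in> M" "q \<in> Q" "a \<oplus> q = \<one>"
proof -
  interpret M: maximalideal M R by (rule M)
  have Mi: "ideal M R" by (rule M.is_ideal)
  have i: "ideal (M <+> Q) R" by (rule add_ideals[OF Mi Q(1)])
  note M' = ideal_memD[OF Mi] and Q' = ideal_memD[OF Q(1)]
  have "M \<subseteq> M <+> Q"
  proof
    fix a assume "a \<in> M"
    then have "a \<oplus> \<zero> \<in> M <+> Q" using Q'(2) unfolding set_add_def' by blast
    then show "a \<in> M <+> Q" using \<open>a \<in> M\<close> M'(1) by (simp add: subset_iff)
  qed
  moreover have "M <+> Q \<noteq> M"
  proof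
    assume e: "M <+> Q = M"
    have "q \<in> M" if "q \<in> Q" for q
    proof -
      have "\<zero> \<oplus> q \<in> M <+> Q" using M'(2) that unfolding set_add_def' by blast
      then show ?thesis using e that Q'(1) by (simp add: subset_iff)
    qed
    then show False using Q(2) by blast
  qed
  ultimately have "M <+> Q = carrier R" using M.I_maximal[OF i _ ideal_memD(1)[OF i]] by simp
  then have "\<one> \<in> M <+> Q" by simp
  then obtain a q where aq: "a \<in> M" "q \<in> Q" "\<one> = a \<oplus> q" unfolding set_add_def' by blast
  show ?thesis by (rule that[OF aq(1,2) aq(3)[symmetric]])
qed

text \<open>
  Each \<open>M i\<close> contains an element congruent to \<open>\<one>\<close> modulo \<open>Q\<close>; the product of their powers has the same
  property.
\<close>

lemma (in plain_cring) comaximal_prod_powers: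
  assumes fin: "finite A" and M: "\<And>i. i \<in> A \<Longrightarrow> maximalideal (M i) R"
    and Q: "ideal Q R" "\<And>i. i \<in> A \<Longrightarrow> \<not> Q \<subseteq> M i"
  obtains z q where "z \<in> (\<Otimes>\<^bsub>ideals_set R\<^esub>i\<in>A. ideal_power R (M i) (e i))" "q \<in> Q" "z \<oplus> q = \<one>"
proof -
  have Mi: "ideal (M i) R" if "i \<in> A" for i using M[OF that] maximalideal.axioms(1) by blast
  have "\<exists>a. a \<in> M i \<and> (\<exists>q\<in>Q. a \<oplus> q = \<one>)" if "i \<in> A" for i
    by (rule maximalideal_comaximal[OF M[OF that] Q(1) Q(2)[OF that]]) (intro exI conjI bexI)
  then have "\<forall>i\<in>A. \<exists>a. a \<in> M i \<and> (\<exists>q\<in>Q. a \<oplus> q = \<one>)" by (rule ballI)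
  from bchoice[OF this] obtain a where a: "\<And>i. i \<in> A \<Longrightarrow> a i \<in> M i" "\<And>i. i \<in> A \<Longrightarrow> \<exists>q\<in>Q. a i \<oplus> q = \<one>"
    by blast
  have ac: "a i \<in> carrier R" if "i \<in> A" for i using a(1)[OF that] ideal_memD(1)[OF Mi[OF that]] by blast
  have "\<exists>r\<in>Q. (\<Otimes>i\<in>A. a i [^] e i) \<oplus> r = \<one>"
  proof (rule congruent_one_finprod[OF Q(1) fin])
    fix i assume i: "i \<in> A"
    then obtain q where "q \<in> Q" "a i \<oplus> q = \<one>" using a(2) by blast
    then show "a i [^] e i \<in> carrier R \<and> (\<exists>r\<in>Q. a i [^] e i \<oplus> r = \<one>)"
      using congruent_one_pow[OF Q(1) ac[OF i]] ac[OF i] by simp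
  qed
  moreover have "(\<Otimes>i\<in>A. a i [^] e i) \<in> (\<Otimes>\<^bsub>ideals_set R\<^esub>i\<in>A. ideal_power R (M i) (e i))"
    by (rule finprod_ideals(3)[OF fin ideal_power_ideal[OF Mi] pow_mem_ideal_power[OF a(1)]])
  ultimately show ?thesis using that by blast
qed

section \<open>Algebraic extensions of a Dedekind domain\<close>

locale dedekind_extension = plain_field L for L :: "'l ring" (structure) +
  fixes F :: "'a ring" and D :: "'a set" and \<phi> :: "'a \<Rightarrow> 'l"
  assumes dedekind: "dedekind_domain_with_quotient_field D F"
    and hom: "\<phi> \<in> ring_hom F L"
    and algebraic_over: "\<And>x. x \<in> carrier L \<Longrightarrow> algebraic (\<phi> ` carrier F) x"

sublocale dedekind_extension \<subseteq> F: plain_field F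
  using dedekind
  by (simp add: plain_field_def dedekind_domain_with_quotient_field_def is_quotient_field_def)

context dedekind_extension
begin

abbreviation "DR \<equiv> F\<lparr>carrier := D\<rparr>"

lemma D_subring: "subring D F"
  and D_noetherian: "noetherian_domain DR"
  and D_fraction: "x \<in> carrier F \<Longrightarrow> \<exists>a\<in>D. \<exists>b\<in>D - {\<zero>\<^bsub>F\<^esub>}. x = a \<otimes>\<^bsub>F\<^esub> inv\<^bsub>F\<^esub> b"
  and D_prime_maximal: "primeideal P DR \<Longrightarrow> P \<noteq> {\<zero>\<^bsub>F\<^esub>}
    \<Longrightarrow> maximalideal P DR"
  using dedekind
  by (simp_all add: dedekind_domain_with_quotient_field_def is_quotient_field_def)

end

sublocale dedekind_extension \<subseteq> D: plain_cring DR
  using F.subcringI'[OF D_subring] F.subcring_iff[OF subringE(1)[OF D_subring]]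
  by (simp add: plain_cring_def)

context dedekind_extension
begin

lemmas D_closed = subringE[OF D_subring]

lemma D_carrier: "a \<in> D \<Longrightarrow> a \<in> carrier F"
  using D_closed(1) by (rule subsetD)

lemma D_pow: "a [^]\<^bsub>DR\<^esub> (n::nat) = a [^]\<^bsub>F\<^esub> n"
  by (simp add: nat_pow_def)

lemma
  shows phi_closed: "a \<in> carrier F \<Longrightarrow> \<phi> a \<in> carrier L"
    and phi_mult: "a \<in> carrier F \<Longrightarrow> b \<in> carrier F \<Longrightarrow> \<phi> (a \<otimes>\<^bsub>F\<^esub> b) = \<phi> a \<otimes> \<phi> b"
    and phi_add: "a \<in> carrier F \<Longrightarrow> b \<in> carrier F \<Longrightarrow> \<phi> (a \<oplus>\<^bsub>F\<^esub> b) = \<phi> a \<oplus> \<phi> b"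
    and phi_one: "\<phi> \<one>\<^bsub>F\<^esub> = \<one>"
  using ring_hom_memE[OF hom] by simp_all

lemma phi_zero: "\<phi> \<zero>\<^bsub>F\<^esub> = \<zero>"
  using ring_hom_zero[OF hom F.ring_axioms ring_axioms] .

lemma phi_nonzero:
  assumes "a \<in> carrier F" "a \<noteq> \<zero>\<^bsub>F\<^esub>"
  shows "\<phi> a \<noteq> \<zero>"
proof
  note i = F.nonzero_inv[OF assms]
  assume "\<phi> a = \<zero>"
  then have "\<phi> (a \<otimes>\<^bsub>F\<^esub> inv\<^bsub>F\<^esub> a) = \<zero>" using phi_mult[OF assms(1) i(1)] phi_closed[OF i(1)] by simp
  then show False using i(3) phi_one by simp
qed

lemma phi_inv:
  assumes "a \<in> carrier F" "a \<noteq> \<zero>\<^bsub>F\<^esub>"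
  shows "\<phi> (inv\<^bsub>F\<^esub> a) = inv (\<phi> a)"
  using inv_eqI[OF phi_closed phi_closed, of a "inv\<^bsub>F\<^esub> a"] F.nonzero_inv[OF assms] assms(1)
    phi_mult[of a "inv\<^bsub>F\<^esub> a"] phi_one by simp

lemma phi_minus: "a \<in> carrier F \<Longrightarrow> \<phi> (\<ominus>\<^bsub>F\<^esub> a) = \<ominus> \<phi> a"
proof -
  assume a: "a \<in> carrier F"
  have "\<phi> (\<ominus>\<^bsub>F\<^esub> a) \<oplus> \<phi> a = \<zero>"
    using phi_add[of "\<ominus>\<^bsub>F\<^esub> a" a] a F.l_neg[OF a] phi_zero by simp
  then show ?thesis using minus_equality[of "\<phi> (\<ominus>\<^bsub>F\<^esub> a)" "\<phi> a"] a phi_closed by simp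
qed

lemma phi_pow: "a \<in> carrier F \<Longrightarrow> \<phi> (a [^]\<^bsub>F\<^esub> (n::nat)) = \<phi> a [^] n"
  by (induction n) (simp_all add: phi_one phi_mult)

lemma phi_eq_iff:
  assumes "a \<in> carrier F" "b \<in> carrier F"
  shows "\<phi> a = \<phi> b \<longleftrightarrow> a = b"
proof
  assume e: "\<phi> a = \<phi> b"
  have "\<phi> (a \<ominus>\<^bsub>F\<^esub> b) = \<zero>"
    using assms e by (simp add: a_minus_def phi_add phi_minus r_neg phi_closed)
  then have "a \<ominus>\<^bsub>F\<^esub> b = \<zero>\<^bsub>F\<^esub>" using phi_nonzero[of "a \<ominus>\<^bsub>F\<^esub> b"] assms by auto
  then show "a = b" using assms by simp
qed simp

lemma phi_D_subring: "subring (\<phi> ` D) L"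
proof (rule subringI)
  show "\<phi> ` D \<subseteq> carrier L" using phi_closed D_carrier by blast
  show "\<one> \<in> \<phi> ` D" using D_closed(3) phi_one by (metis imageI)
  fix x assume "x \<in> \<phi> ` D"
  then obtain a where a: "a \<in> D" "x = \<phi> a" by blast
  then show "\<ominus> x \<in> \<phi> ` D" using D_closed(5)[OF a(1)] phi_minus[OF D_carrier[OF a(1)]] by (metis imageI)
  fix y assume "y \<in> \<phi> ` D"
  then obtain b where b: "b \<in> D" "y = \<phi> b" by blast
  show "x \<otimes> y \<in> \<phi> ` D"
    using D_closed(6)[OF a(1) b(1)] phi_mult[OF D_carrier[OF a(1)] D_carrier[OF b(1)]] a b by (metis imageI)
  show "x \<oplus> y \<in> \<phi> ` D"
    using D_closed(7)[OF a(1) b(1)] phi_add[OF D_carrier[OF a(1)] D_carrier[OF b(1)]] a b by (metis imageI)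
qed

lemma phi_F_subfield: "subfield (\<phi> ` carrier F) L"
proof -
  have "ring_hom_ring F L \<phi>" using ring_hom_ringI2[OF F.ring_axioms ring_axioms hom] .
  then show ?thesis
    using ring_hom_ring.img_is_subfield(2)[of F L \<phi> "carrier F"] F.carrier_is_subfield one_not_zero by blast
qed

text \<open>
  Elements of \<open>L\<close> are roots of monic polynomials over \<open>F\<close>, and valuation rings are integrally closed.
\<close>

lemma valuation_ring_containing_F:
  assumes G: "valuation_ring_of L G" and F: "\<phi> ` carrier F \<subseteq> G"
  shows "G = carrier L"
proof (intro Set.equalityI subsetI)
  fix x assume x: "x \<in> carrier L"
  note irr = IrrE[OF phi_F_subfield x]
  have "(algebraic over (\<phi> ` carrier F)) x" using algebraic_over[OF x] by (simp add: over_def)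
  note irr = irr[OF this]
  have p: "set (Irr (\<phi> ` carrier F) x) \<subseteq> \<phi> ` carrier F"
    using irr(1) by (simp add: univ_poly_def polynomial_def) auto
  have "Irr (\<phi> ` carrier F) x \<noteq> []"
  proof
    assume "Irr (\<phi> ` carrier F) x = []"
    then show False using irr(2) univ_poly_zero
      by (simp add: ring_irreducible_def univ_poly_zero)
  qed
  then show "x \<in> G"
    using valuation_ring_integrally_closed[OF G x _ subset_trans[OF p F] irr(3,4)] by blast
next
  fix x assume "x \<in> G"
  then show "x \<in> carrier L" using subringE(1)[OF valuation_ring_ofE(1)[OF G]] by (rule subsetD[rotated])
qed

end

section \<open>A valuation ring above one localization\<close>

locale localized_extension = dedekind_extension L F D \<phi>
  for L :: "'l ring" (structure) and F :: "'a ring" and D \<phi> +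
  fixes M :: "'a set" and V :: "'a set" and W :: "'l set"
  assumes maximal: "maximalideal M DR"
    and nonzero: "M \<noteq> {\<zero>\<^bsub>F\<^esub>}"
    and V_def: "V = localization_at F D M"
    and W: "W \<in> valuation_extensions F L \<phi> V"
begin

lemma M_ideal: "ideal M DR"
  using maximal by (rule maximalideal.axioms(1))

lemmas M_closed = ideal_memD[OF M_ideal, simplified]

lemma one_notin_M: "\<one>\<^bsub>F\<^esub> \<notin> M"
proof
  assume "\<one>\<^bsub>F\<^esub> \<in> M"
  then have "D \<subseteq> M" using M_closed(4)[of "\<one>\<^bsub>F\<^esub>"] D_carrier by fastforce
  then show False using maximalideal.I_notcarr[OF maximal] M_closed(1) by simp
qed

lemma notin_M_nonzero: "a \<notin> M \<Longrightarrow> a \<noteq> \<zero>\<^bsub>F\<^esub>"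
  using M_closed(2) by auto

lemma W_valuation: "valuation_ring_of L W"
  and W_trace: "W \<inter> \<phi> ` carrier F = \<phi> ` V"
  using W by (simp_all add: valuation_extensions_def)

lemmas W_subring = valuation_ring_ofE(1)[OF W_valuation]
lemmas W_closed = subringE[OF W_subring]

lemma V_cases:
  assumes "c \<in> V"
  obtains a b where "a \<in> D" "b \<in> D" "b \<notin> M" "c = a \<otimes>\<^bsub>F\<^esub> inv\<^bsub>F\<^esub> b"
  using assms unfolding V_def localization_at_def by blast

lemma V_carrier: "c \<in> V \<Longrightarrow> c \<in> carrier F"
proof -
  assume "c \<in> V"
  then obtain a b where ab: "a \<in> D" "b \<in> D" "b \<notin> M" "c = a \<otimes>\<^bsub>F\<^esub> inv\<^bsub>F\<^esub> b" by (rule V_cases)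
  then show ?thesis
    using D_carrier[OF ab(1)] F.nonzero_inv(1)[OF D_carrier[OF ab(2)] notin_M_nonzero[OF ab(3)]] by simp
qed

lemma V_iff:
  assumes "c \<in> carrier F"
  shows "\<phi> c \<in> W \<longleftrightarrow> c \<in> V"
proof
  assume "\<phi> c \<in> W"
  then have "\<phi> c \<in> \<phi> ` V" using W_trace assms by blast
  then obtain d where "d \<in> V" "\<phi> c = \<phi> d" by blast
  then show "c \<in> V" using phi_eq_iff[OF assms V_carrier] by simp
next
  assume "c \<in> V"
  then show "\<phi> c \<in> W" using W_trace by blast
qed

lemma phi_V: "c \<in> V \<Longrightarrow> \<phi> c \<in> W"
  using V_iff V_carrier by blast

lemma D_subset_V: "D \<subseteq> V"
proof
  fix a assume a: "a \<in> D"
  have "a = a \<otimes>\<^bsub>F\<^esub> inv\<^bsub>F\<^esub> \<one>\<^bsub>F\<^esub>" using D_carrier[OF a] by simp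
  then show "a \<in> V" unfolding V_def localization_at_def using a D_closed(3) one_notin_M by blast
qed

lemma inv_in_V: "b \<in> D \<Longrightarrow> b \<notin> M \<Longrightarrow> inv\<^bsub>F\<^esub> b \<in> V"
proof -
  assume b: "b \<in> D" "b \<notin> M"
  have "inv\<^bsub>F\<^esub> b = \<one>\<^bsub>F\<^esub> \<otimes>\<^bsub>F\<^esub> inv\<^bsub>F\<^esub> b"
    using F.nonzero_inv(1)[OF D_carrier[OF b(1)] notin_M_nonzero[OF b(2)]] by simp
  then show ?thesis unfolding V_def localization_at_def using b D_closed(3) by blast
qed

lemma V_subring: "subring V F"
proof (rule F.subringI)
  show "V \<subseteq> carrier F" using V_carrier by blast
  show "\<one>\<^bsub>F\<^esub> \<in> V" using D_subset_V D_closed(3) by blast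
  fix a assume a: "a \<in> V"
  note ac = V_carrier[OF a]
  show "\<ominus>\<^bsub>F\<^esub> a \<in> V"
    using V_iff[of "\<ominus>\<^bsub>F\<^esub> a"] ac phi_minus[OF ac] W_closed(5)[OF phi_V[OF a]] by simp
  fix b assume b: "b \<in> V"
  note bc = V_carrier[OF b]
  show "a \<otimes>\<^bsub>F\<^esub> b \<in> V"
    using V_iff[of "a \<otimes>\<^bsub>F\<^esub> b"] ac bc phi_mult[OF ac bc] W_closed(6)[OF phi_V[OF a] phi_V[OF b]] by simp
  show "a \<oplus>\<^bsub>F\<^esub> b \<in> V"
    using V_iff[of "a \<oplus>\<^bsub>F\<^esub> b"] ac bc phi_add[OF ac bc] W_closed(7)[OF phi_V[OF a] phi_V[OF b]] by simp
qed

lemmas V_closed = subringE[OF V_subring]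

lemma V_or_inv:
  assumes c: "c \<in> carrier F" "c \<noteq> \<zero>\<^bsub>F\<^esub>"
  shows "c \<in> V \<or> inv\<^bsub>F\<^esub> c \<in> V"
  using valuation_ring_ofE(2)[OF W_valuation phi_closed[OF c(1)] phi_nonzero[OF c]]
    V_iff[OF c(1)] V_iff[OF F.nonzero_inv(1)[OF c]] phi_inv[OF c] by auto

lemma M_mult_V_not_one:
  assumes a: "a \<in> M" and c: "c \<in> V"
  shows "a \<otimes>\<^bsub>F\<^esub> c \<noteq> \<one>\<^bsub>F\<^esub>"
proof
  assume e: "a \<otimes>\<^bsub>F\<^esub> c = \<one>\<^bsub>F\<^esub>"
  obtain x b where xb: "x \<in> D" "b \<in> D" "b \<notin> M" "c = x \<otimes>\<^bsub>F\<^esub> inv\<^bsub>F\<^esub> b" using c by (rule V_cases)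
  have aD: "a \<in> D" using a M_closed(1) by blast
  note cc = D_carrier[OF aD] D_carrier[OF xb(1)] D_carrier[OF xb(2)]
  note i = F.nonzero_inv[OF cc(3) notin_M_nonzero[OF xb(3)]]
  have "b = (a \<otimes>\<^bsub>F\<^esub> c) \<otimes>\<^bsub>F\<^esub> b" using e cc by simp
  also have "\<dots> = (a \<otimes>\<^bsub>F\<^esub> x) \<otimes>\<^bsub>F\<^esub> (inv\<^bsub>F\<^esub> b \<otimes>\<^bsub>F\<^esub> b)" unfolding xb(4) using cc i(1) F.m_assoc by simp
  also have "\<dots> = x \<otimes>\<^bsub>F\<^esub> a" using cc i F.m_comm by simp
  also have "\<dots> \<in> M" using M_closed(4)[OF a xb(1)] .
  finally show False using xb(3) by simp
qed

text \<open>
  Of two elements of a valuation ring one divides the other.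
\<close>

lemma finite_common_divisor:
  assumes "finite A" "A \<subseteq> M"
  shows "\<exists>p\<in>M. \<forall>a\<in>A. \<exists>c\<in>V. a = p \<otimes>\<^bsub>F\<^esub> c"
  using assms
proof (induction A)
  case empty
  show ?case using M_closed(2) by blast
next
  case (insert x A)
  then obtain p where p: "p \<in> M" "\<And>a. a \<in> A \<Longrightarrow> \<exists>c\<in>V. a = p \<otimes>\<^bsub>F\<^esub> c" by blast
  have x: "x \<in> M" using insert.prems by simp
  have pc: "p \<in> carrier F" "x \<in> carrier F" using p(1) x M_closed(1) D_carrier by blast+
  consider (px) "\<exists>c\<in>V. x = p \<otimes>\<^bsub>F\<^esub> c" | (xp) "\<exists>c\<in>V. p = x \<otimes>\<^bsub>F\<^esub> c"
  proof (cases "p = \<zero>\<^bsub>F\<^esub> \<or> x = \<zero>\<^bsub>F\<^esub>")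
    case True
    then have "p = x \<otimes>\<^bsub>F\<^esub> \<zero>\<^bsub>F\<^esub> \<or> x = p \<otimes>\<^bsub>F\<^esub> \<zero>\<^bsub>F\<^esub>" using pc by auto
    then show ?thesis using that V_closed(2) by blast
  next
    case False
    note ip = F.nonzero_inv[OF pc(1)] and ix = F.nonzero_inv[OF pc(2)]
    have c: "x \<otimes>\<^bsub>F\<^esub> inv\<^bsub>F\<^esub> p \<in> carrier F" "x \<otimes>\<^bsub>F\<^esub> inv\<^bsub>F\<^esub> p \<noteq> \<zero>\<^bsub>F\<^esub>"
      using False ip pc F.nonzero_mult[of x "inv\<^bsub>F\<^esub> p"] by auto
    have i: "inv\<^bsub>F\<^esub> (x \<otimes>\<^bsub>F\<^esub> inv\<^bsub>F\<^esub> p) = inv\<^bsub>F\<^esub> x \<otimes>\<^bsub>F\<^esub> p"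
      using F.inv_mult[of x "inv\<^bsub>F\<^esub> p"] False ip pc F.inv_inv[OF pc(1)] by simp
    have "p \<otimes>\<^bsub>F\<^esub> (x \<otimes>\<^bsub>F\<^esub> inv\<^bsub>F\<^esub> p) = x \<otimes>\<^bsub>F\<^esub> (p \<otimes>\<^bsub>F\<^esub> inv\<^bsub>F\<^esub> p)"
      using pc ip(1) False F.m_lcomm[of p x "inv\<^bsub>F\<^esub> p"] by blast
    then have e1: "x = p \<otimes>\<^bsub>F\<^esub> (x \<otimes>\<^bsub>F\<^esub> inv\<^bsub>F\<^esub> p)" using ip False pc by simp
    have "x \<otimes>\<^bsub>F\<^esub> (inv\<^bsub>F\<^esub> x \<otimes>\<^bsub>F\<^esub> p) = (x \<otimes>\<^bsub>F\<^esub> inv\<^bsub>F\<^esub> x) \<otimes>\<^bsub>F\<^esub> p"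
      using pc ix(1) False F.m_assoc[of x "inv\<^bsub>F\<^esub> x" p] by (metis (no_types))
    then have e2: "p = x \<otimes>\<^bsub>F\<^esub> (inv\<^bsub>F\<^esub> x \<otimes>\<^bsub>F\<^esub> p)" using ix False pc by simp
    show ?thesis using V_or_inv[OF c] e1 e2 that unfolding i by blast
  qed
  then show ?case
  proof cases
    case px
    then show ?thesis using p by blast
  next
    case xp
    then obtain d where d: "d \<in> V" "p = x \<otimes>\<^bsub>F\<^esub> d" by blast
    have "\<exists>c\<in>V. a = x \<otimes>\<^bsub>F\<^esub> c" if a: "a \<in> insert x A" for a
    proof (cases "a = x")
      case True
      then have "a = x \<otimes>\<^bsub>F\<^esub> \<one>\<^bsub>F\<^esub>" using pc by simp
      then show ?thesis using V_closed(3) by blast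
    next
      case False
      then obtain c where c: "c \<in> V" "a = p \<otimes>\<^bsub>F\<^esub> c" using a p(2) by blast
      have "a = x \<otimes>\<^bsub>F\<^esub> (d \<otimes>\<^bsub>F\<^esub> c)"
        unfolding c(2) d(2) using pc V_carrier[OF c(1)] V_carrier[OF d(1)] F.m_assoc by simp
      then show ?thesis using V_closed(6)[OF d(1) c(1)] by blast
    qed
    then show ?thesis using x by blast
  qed
qed

text \<open>
  As \<open>D\<close> is noetherian, \<open>M\<close> has finitely many generators, and a common divisor of the generators in \<open>V\<close>
  divides all of \<open>M\<close>.
\<close>

lemma exists_local_generator: "\<exists>p\<in>M. \<forall>a\<in>M. \<exists>c\<in>V. a = p \<otimes>\<^bsub>F\<^esub> c"
proof -
  have "\<exists>A\<subseteq>carrier DR. finite A \<and> M = Idl\<^bsub>DR\<^esub> A"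
    using noetherian_ring.finetely_gen[OF noetherian_domain.axioms(1)[OF D_noetherian] M_ideal] .
  then obtain A where A: "A \<subseteq> D" "finite A" "M = Idl\<^bsub>DR\<^esub> A" by auto
  have "A \<subseteq> M" using D.genideal_self[of A] A by simp
  then obtain p where p: "p \<in> M" "\<forall>a\<in>A. \<exists>c\<in>V. a = p \<otimes>\<^bsub>F\<^esub> c"
    using finite_common_divisor[OF A(2)] by blast
  have pD: "p \<in> D" using p(1) M_closed(1) by blast
  note pc = D_carrier[OF pD]
  define J where "J = {a \<in> D. \<exists>c\<in>V. a = p \<otimes>\<^bsub>F\<^esub> c}"
  have "ideal J DR"
  proof (rule D.idealI_commutative, simp_all)
    show "J \<subseteq> D" unfolding J_def by blast
    have "\<zero>\<^bsub>F\<^esub> = p \<otimes>\<^bsub>F\<^esub> \<zero>\<^bsub>F\<^esub>" using pc by simp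
    then show "\<zero>\<^bsub>F\<^esub> \<in> J" unfolding J_def using D_closed(2) V_closed(2) by blast
    fix a assume "a \<in> J"
    then obtain c where a: "a \<in> D" "c \<in> V" "a = p \<otimes>\<^bsub>F\<^esub> c" unfolding J_def by blast
    note cc = V_carrier[OF a(2)]
    show "a \<oplus>\<^bsub>F\<^esub> b \<in> J" if bJ: "b \<in> J" for b
    proof -
      obtain d where b: "b \<in> D" "d \<in> V" "b = p \<otimes>\<^bsub>F\<^esub> d" using bJ unfolding J_def by blast
      have "a \<oplus>\<^bsub>F\<^esub> b = p \<otimes>\<^bsub>F\<^esub> (c \<oplus>\<^bsub>F\<^esub> d)" unfolding a(3) b(3) using pc cc V_carrier[OF b(2)] F.r_distr by simp
      then show ?thesis unfolding J_def using D_closed(7)[OF a(1) b(1)] V_closed(7)[OF a(2) b(2)] by blast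
    qed
    show "x \<otimes>\<^bsub>F\<^esub> a \<in> J" if x: "x \<in> D" for x
    proof -
      have "x \<otimes>\<^bsub>F\<^esub> a = p \<otimes>\<^bsub>F\<^esub> (x \<otimes>\<^bsub>F\<^esub> c)" unfolding a(3) using pc cc D_carrier[OF x] F.m_lcomm[of x p c] by blast
      moreover have "x \<otimes>\<^bsub>F\<^esub> c \<in> V" using V_closed(6)[OF subsetD[OF D_subset_V x] a(2)] .
      ultimately show ?thesis unfolding J_def using D_closed(6)[OF x a(1)] by blast
    qed
  qed
  moreover have "A \<subseteq> J" using A(1) p(2) unfolding J_def by blast
  ultimately have "M \<subseteq> J" using D.genideal_minimal A(3) by blast
  then show ?thesis using p(1) unfolding J_def by blast
qed

end

context localized_extension
begin

context
  fixes p
  assumes gen: "p \<in> M \<and> (\<forall>a\<in>M. \<exists>c\<in>V. a = p \<otimes>\<^bsub>F\<^esub> c)"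
begin

private lemma p: "p \<in> M" "\<And>a. a \<in> M \<Longrightarrow> \<exists>c\<in>V. a = p \<otimes>\<^bsub>F\<^esub> c"
  using gen by blast+

lemma generator_carrier: "p \<in> D" "p \<in> carrier F"
proof -
  show "p \<in> D" using p(1) M_closed(1) by blast
  then show "p \<in> carrier F" by (rule D_carrier)
qed

lemma generator_nonzero: "p \<noteq> \<zero>\<^bsub>F\<^esub>"
proof
  assume z: "p = \<zero>\<^bsub>F\<^esub>"
  have "a = \<zero>\<^bsub>F\<^esub>" if "a \<in> M" for a
  proof -
    obtain c where "c \<in> V" "a = p \<otimes>\<^bsub>F\<^esub> c" using p(2)[OF \<open>a \<in> M\<close>] by blast
    then show ?thesis using z V_carrier[of c] by simp
  qed
  then show False using nonzero M_closed(2) by blast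
qed

lemma generator_pow: "p [^]\<^bsub>F\<^esub> (n::nat) \<in> D" "p [^]\<^bsub>F\<^esub> n \<in> carrier F" "p [^]\<^bsub>F\<^esub> n \<noteq> \<zero>\<^bsub>F\<^esub>"
proof -
  show "p [^]\<^bsub>F\<^esub> n \<in> D" by (rule F.subring_pow_closed[OF D_subring generator_carrier(1)])
  then show "p [^]\<^bsub>F\<^esub> n \<in> carrier F" by (rule D_carrier)
  show "p [^]\<^bsub>F\<^esub> n \<noteq> \<zero>\<^bsub>F\<^esub>" by (rule F.nonzero_pow[OF generator_carrier(2) generator_nonzero])
qed

lemma not_multiple:
  assumes a: "a \<in> D" and n: "\<And>c. c \<in> V \<Longrightarrow> a \<noteq> p [^]\<^bsub>F\<^esub> (n::nat) \<otimes>\<^bsub>F\<^esub> c"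
  obtains d where "d \<in> V" "p [^]\<^bsub>F\<^esub> n = a \<otimes>\<^bsub>F\<^esub> d"
proof -
  define q where "q = p [^]\<^bsub>F\<^esub> n"
  have q: "q \<in> carrier F" "q \<noteq> \<zero>\<^bsub>F\<^esub>" unfolding q_def by (rule generator_pow)+
  note ac = D_carrier[OF a]
  have a0: "a \<noteq> \<zero>\<^bsub>F\<^esub>"
  proof
    assume "a = \<zero>\<^bsub>F\<^esub>"
    then have "a = p [^]\<^bsub>F\<^esub> n \<otimes>\<^bsub>F\<^esub> \<zero>\<^bsub>F\<^esub>" using generator_carrier by simp
    then show False using n V_closed(2) by blast
  qed
  note iq = F.nonzero_inv[OF q] and ia = F.nonzero_inv[OF ac a0]
  define c where "c = a \<otimes>\<^bsub>F\<^esub> inv\<^bsub>F\<^esub> q"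
  have c: "c \<in> carrier F" "c \<noteq> \<zero>\<^bsub>F\<^esub>" unfolding c_def using ac iq a0 F.nonzero_mult by simp_all
  have ic: "inv\<^bsub>F\<^esub> c = inv\<^bsub>F\<^esub> a \<otimes>\<^bsub>F\<^esub> q"
    unfolding c_def using F.inv_mult[OF ac iq(1) a0 iq(2)] F.inv_inv[OF q] by simp
  have "q \<otimes>\<^bsub>F\<^esub> c = a \<otimes>\<^bsub>F\<^esub> (q \<otimes>\<^bsub>F\<^esub> inv\<^bsub>F\<^esub> q)"
    unfolding c_def using q(1) ac iq(1) F.m_lcomm[of q a "inv\<^bsub>F\<^esub> q"] by blast
  then have "a = q \<otimes>\<^bsub>F\<^esub> c" using iq(3) ac by simp
  then have "c \<notin> V" using n unfolding q_def by blast
  then have "inv\<^bsub>F\<^esub> c \<in> V" using V_or_inv[OF c] by blast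
  moreover have "q = a \<otimes>\<^bsub>F\<^esub> inv\<^bsub>F\<^esub> c"
    unfolding ic using F.m_assoc[OF ac ia(1) q(1)] ia(3) q(1) by simp
  ultimately show ?thesis using that unfolding q_def by blast
qed

text \<open>
  The elements of \<open>D\<close> that are divisible in \<open>V\<close> by all powers of \<open>p\<close> form a prime ideal properly
  contained in \<open>M\<close>. It is zero because nonzero primes of \<open>D\<close> are maximal. Hence some power of \<open>p\<close> does
  not divide \<open>b\<close>, and so \<open>b\<close> divides this power.
\<close>

lemma nonzero_divides_generator_power:
  assumes b: "b \<in> D" "b \<noteq> \<zero>\<^bsub>F\<^esub>"
  obtains d and n :: nat where "d \<in> V" "p [^]\<^bsub>F\<^esub> n = b \<otimes>\<^bsub>F\<^esub> d"
proof -
  \<comment> \<open>the trace on \<open>D\<close> of the intersection of the powers of the maximal ideal of \<open>V\<close>\<close>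
  define P where "P = {x \<in> D. \<forall>n::nat. \<exists>c\<in>V. x = p [^]\<^bsub>F\<^esub> n \<otimes>\<^bsub>F\<^esub> c}"
  note pc = generator_carrier
  have ideal: "ideal P DR"
  proof (rule D.idealI_commutative, simp_all)
    show "P \<subseteq> D" unfolding P_def by blast
    have "\<zero>\<^bsub>F\<^esub> = p [^]\<^bsub>F\<^esub> n \<otimes>\<^bsub>F\<^esub> \<zero>\<^bsub>F\<^esub>" for n :: nat using generator_pow(2) by simp
    then show "\<zero>\<^bsub>F\<^esub> \<in> P" unfolding P_def using D_closed(2) V_closed(2) by blast
    fix a assume a: "a \<in> P"
    then have aD: "a \<in> D" unfolding P_def by blast
    show "a \<oplus>\<^bsub>F\<^esub> b \<in> P" if bP: "b \<in> P" for b
    proof -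
      have bD: "b \<in> D" using bP unfolding P_def by blast
      have "\<exists>c\<in>V. a \<oplus>\<^bsub>F\<^esub> b = p [^]\<^bsub>F\<^esub> n \<otimes>\<^bsub>F\<^esub> c" for n :: nat
      proof -
        obtain c where c: "c \<in> V" "a = p [^]\<^bsub>F\<^esub> n \<otimes>\<^bsub>F\<^esub> c" using a unfolding P_def by blast
        obtain d where d: "d \<in> V" "b = p [^]\<^bsub>F\<^esub> n \<otimes>\<^bsub>F\<^esub> d" using bP unfolding P_def by blast
        have "a \<oplus>\<^bsub>F\<^esub> b = p [^]\<^bsub>F\<^esub> n \<otimes>\<^bsub>F\<^esub> (c \<oplus>\<^bsub>F\<^esub> d)"
          unfolding c(2) d(2) using generator_pow(2) V_carrier[OF c(1)] V_carrier[OF d(1)] F.r_distr by simp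
        then show ?thesis using V_closed(7)[OF c(1) d(1)] by blast
      qed
      then show ?thesis unfolding P_def using D_closed(7)[OF aD bD] by blast
    qed
    show "x \<otimes>\<^bsub>F\<^esub> a \<in> P" if x: "x \<in> D" for x
    proof -
      have "\<exists>c\<in>V. x \<otimes>\<^bsub>F\<^esub> a = p [^]\<^bsub>F\<^esub> n \<otimes>\<^bsub>F\<^esub> c" for n :: nat
      proof -
        obtain c where c: "c \<in> V" "a = p [^]\<^bsub>F\<^esub> n \<otimes>\<^bsub>F\<^esub> c" using a unfolding P_def by blast
        have "x \<otimes>\<^bsub>F\<^esub> a = p [^]\<^bsub>F\<^esub> n \<otimes>\<^bsub>F\<^esub> (x \<otimes>\<^bsub>F\<^esub> c)"
          unfolding c(2) using F.m_lcomm[OF D_carrier[OF x] generator_pow(2) V_carrier[OF c(1)]] .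
        then show ?thesis using V_closed(6)[OF subsetD[OF D_subset_V x] c(1)] by blast
      qed
      then show ?thesis unfolding P_def using D_closed(6)[OF x aD] by blast
    qed
  qed
  have pP: "p \<notin> P"
  proof
    assume "p \<in> P"
    then obtain c where c: "c \<in> V" "p = p [^]\<^bsub>F\<^esub> (2::nat) \<otimes>\<^bsub>F\<^esub> c" unfolding P_def by blast
    have "p [^]\<^bsub>F\<^esub> (2::nat) = p \<otimes>\<^bsub>F\<^esub> p" using pc by (simp add: numeral_2_eq_2)
    then have "p \<otimes>\<^bsub>F\<^esub> \<one>\<^bsub>F\<^esub> = p \<otimes>\<^bsub>F\<^esub> (p \<otimes>\<^bsub>F\<^esub> c)"
      using c(2) pc(2) F.m_assoc[OF pc(2) pc(2) V_carrier[OF c(1)]] by simp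
    then have "\<one>\<^bsub>F\<^esub> = p \<otimes>\<^bsub>F\<^esub> c"
      by (rule iffD1[OF F.m_lcancel[OF generator_nonzero pc(2) F.one_closed F.m_closed[OF pc(2) V_carrier[OF c(1)]]]])
    then show False using M_mult_V_not_one[OF p(1) c(1)] by simp
  qed
  have PM: "P \<subseteq> M"
  proof
    fix x assume x: "x \<in> P"
    then obtain c where c: "c \<in> V" "x = p [^]\<^bsub>F\<^esub> (1::nat) \<otimes>\<^bsub>F\<^esub> c" unfolding P_def by blast
    then have xp: "x = p \<otimes>\<^bsub>F\<^esub> c" using pc(2) by simp
    have xD: "x \<in> D" using x unfolding P_def by blast
    show "x \<in> M"
    proof (rule ccontr)
      assume nx: "x \<notin> M"
      note ix = F.nonzero_inv[OF D_carrier[OF xD] notin_M_nonzero[OF nx]]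
      have "p \<otimes>\<^bsub>F\<^esub> (c \<otimes>\<^bsub>F\<^esub> inv\<^bsub>F\<^esub> x) = x \<otimes>\<^bsub>F\<^esub> inv\<^bsub>F\<^esub> x"
        using F.m_assoc[OF pc(2) V_carrier[OF c(1)] ix(1)] xp by simp
      then show False
        using M_mult_V_not_one[OF p(1) V_closed(6)[OF c(1) inv_in_V[OF xD nx]]] ix(3) by simp
    qed
  qed
  have "primeideal P DR"
  proof (rule primeidealI[OF ideal])
    show "cring DR" by (rule D.is_cring)
    show "carrier DR \<noteq> P" using pP pc(1) by auto
    fix a b assume ab: "a \<in> carrier DR" "b \<in> carrier DR"
      "a \<otimes>\<^bsub>DR\<^esub> b \<in> P"
    then have D: "a \<in> D" "b \<in> D" "a \<otimes>\<^bsub>F\<^esub> b \<in> P" by simp_all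
    show "a \<in> P \<or> b \<in> P"
    proof (rule ccontr)
      assume "\<not> ?thesis"
      then obtain n m :: nat where n: "\<And>c. c \<in> V \<Longrightarrow> a \<noteq> p [^]\<^bsub>F\<^esub> n \<otimes>\<^bsub>F\<^esub> c"
        and m: "\<And>c. c \<in> V \<Longrightarrow> b \<noteq> p [^]\<^bsub>F\<^esub> m \<otimes>\<^bsub>F\<^esub> c" using D(1,2) unfolding P_def by blast
      obtain d where d: "d \<in> V" "p [^]\<^bsub>F\<^esub> n = a \<otimes>\<^bsub>F\<^esub> d" by (rule not_multiple[OF D(1) n])
      obtain e where e: "e \<in> V" "p [^]\<^bsub>F\<^esub> m = b \<otimes>\<^bsub>F\<^esub> e" by (rule not_multiple[OF D(2) m])
      obtain c where c: "c \<in> V" "a \<otimes>\<^bsub>F\<^esub> b = p [^]\<^bsub>F\<^esub> (n + m + 1) \<otimes>\<^bsub>F\<^esub> c"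
        using D(3) unfolding P_def by blast
      define q where "q = p [^]\<^bsub>F\<^esub> (n + m)"
      have q: "q \<in> carrier F" "q \<noteq> \<zero>\<^bsub>F\<^esub>" unfolding q_def by (rule generator_pow)+
      note k = D_carrier[OF D(1)] D_carrier[OF D(2)] V_carrier[OF c(1)] V_carrier[OF d(1)] V_carrier[OF e(1)]
      have "q = (a \<otimes>\<^bsub>F\<^esub> d) \<otimes>\<^bsub>F\<^esub> (b \<otimes>\<^bsub>F\<^esub> e)"
        unfolding q_def d(2)[symmetric] e(2)[symmetric] using F.nat_pow_mult[OF pc(2)] by simp
      also have "\<dots> = (a \<otimes>\<^bsub>F\<^esub> b) \<otimes>\<^bsub>F\<^esub> (d \<otimes>\<^bsub>F\<^esub> e)" using k by algebra
      also have "\<dots> = (q \<otimes>\<^bsub>F\<^esub> p) \<otimes>\<^bsub>F\<^esub> c \<otimes>\<^bsub>F\<^esub> (d \<otimes>\<^bsub>F\<^esub> e)" unfolding c(2) q_def by simp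
      also have "\<dots> = q \<otimes>\<^bsub>F\<^esub> (p \<otimes>\<^bsub>F\<^esub> (c \<otimes>\<^bsub>F\<^esub> (d \<otimes>\<^bsub>F\<^esub> e)))" using k q(1) pc(2) by algebra
      finally have "q \<otimes>\<^bsub>F\<^esub> \<one>\<^bsub>F\<^esub> = q \<otimes>\<^bsub>F\<^esub> (p \<otimes>\<^bsub>F\<^esub> (c \<otimes>\<^bsub>F\<^esub> (d \<otimes>\<^bsub>F\<^esub> e)))" using q(1) by simp
      moreover have "p \<otimes>\<^bsub>F\<^esub> (c \<otimes>\<^bsub>F\<^esub> (d \<otimes>\<^bsub>F\<^esub> e)) \<in> carrier F" using pc(2) k by simp
      ultimately have "\<one>\<^bsub>F\<^esub> = p \<otimes>\<^bsub>F\<^esub> (c \<otimes>\<^bsub>F\<^esub> (d \<otimes>\<^bsub>F\<^esub> e))"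
        using iffD1[OF F.m_lcancel[OF q(2,1) F.one_closed]] by blast
      then show False
        using M_mult_V_not_one[OF p(1) V_closed(6)[OF c(1) V_closed(6)[OF d(1) e(1)]]] by simp
    qed
  qed
  have "P = {\<zero>\<^bsub>F\<^esub>}"
  proof (rule ccontr)
    assume "P \<noteq> {\<zero>\<^bsub>F\<^esub>}"
    then have "maximalideal P DR"
      using D_prime_maximal \<open>primeideal P DR\<close> by blast
    then have "M = P \<or> M = carrier DR"
      using maximalideal.I_maximal[OF _ M_ideal PM] M_closed(1) by simp
    then show False using pP p(1) maximalideal.I_notcarr[OF maximal] by blast
  qed
  then have "b \<notin> P" using b(2) by blast
  then obtain n :: nat where n: "\<And>c. c \<in> V \<Longrightarrow> b \<noteq> p [^]\<^bsub>F\<^esub> n \<otimes>\<^bsub>F\<^esub> c"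
    using b(1) unfolding P_def by blast
  obtain d where "d \<in> V" "p [^]\<^bsub>F\<^esub> n = b \<otimes>\<^bsub>F\<^esub> d" by (rule not_multiple[OF b(1) n])
  then show ?thesis by (rule that)
qed

text \<open>
  Inverting \<open>p\<close> in \<open>W\<close> gives a valuation ring \<open>G\<close>. It contains \<open>F\<close>, since every nonzero element of \<open>D\<close>
  divides a power of \<open>p\<close> in \<open>V\<close>, and therefore it is all of \<open>L\<close>.
\<close>

lemma W_archimedean:
  assumes x: "x \<in> carrier L"
  obtains n :: nat where "\<phi> p [^] n \<otimes> x \<in> W"
proof -
  define G where "G = {x \<in> carrier L. \<exists>n::nat. \<phi> p [^] n \<otimes> x \<in> W}"
  define q where "q = \<phi> p"
  have qW: "q \<in> W" unfolding q_def using phi_V subsetD[OF D_subset_V generator_carrier(1)] by blast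
  have q: "q \<in> carrier L" using qW W_closed(1) by blast
  have qpow: "q [^] (n::nat) \<in> W" for n by (rule subring_pow_closed[OF W_subring qW])
  have WG: "W \<subseteq> G"
  proof
    fix w assume w: "w \<in> W"
    then have "w \<in> carrier L" using W_closed(1) by blast
    moreover from this have "\<phi> p [^] (0::nat) \<otimes> w \<in> W" using w by simp
    ultimately show "w \<in> G" unfolding G_def by blast
  qed
  have "subring G L"
  proof (rule subringI)
    show "G \<subseteq> carrier L" unfolding G_def by blast
    show "\<one> \<in> G" using WG W_closed(3) by blast
    fix a assume "a \<in> G"
    then obtain n :: nat where a: "a \<in> carrier L" "q [^] n \<otimes> a \<in> W" unfolding G_def q_def by blast
    have "q [^] n \<otimes> (\<ominus> a) = \<ominus> (q [^] n \<otimes> a)" using a(1) q by (simp add: r_minus)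
    then have "q [^] n \<otimes> (\<ominus> a) \<in> W" using W_closed(5)[OF a(2)] by simp
    then show "\<ominus> a \<in> G" unfolding G_def q_def[symmetric] using a_inv_closed[OF a(1)] by blast
    fix b assume "b \<in> G"
    then obtain m :: nat where b: "b \<in> carrier L" "q [^] m \<otimes> b \<in> W" unfolding G_def q_def by blast
    have k: "q [^] n \<in> carrier L" "q [^] m \<in> carrier L" using q by simp_all
    have "q [^] (n + m) \<otimes> (a \<otimes> b) = (q [^] n \<otimes> a) \<otimes> (q [^] m \<otimes> b)"
      unfolding nat_pow_mult[OF q, symmetric] using k a(1) b(1) by algebra
    then have "q [^] (n + m) \<otimes> (a \<otimes> b) \<in> W" using W_closed(6)[OF a(2) b(2)] by simp
    then show "a \<otimes> b \<in> G" unfolding G_def q_def[symmetric] using m_closed[OF a(1) b(1)] by blast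
    have "q [^] (n + m) \<otimes> (a \<oplus> b) = q [^] m \<otimes> (q [^] n \<otimes> a) \<oplus> q [^] n \<otimes> (q [^] m \<otimes> b)"
      unfolding nat_pow_mult[OF q, symmetric] using k a(1) b(1) by algebra
    then have "q [^] (n + m) \<otimes> (a \<oplus> b) \<in> W"
      using W_closed(7)[OF W_closed(6)[OF qpow a(2)] W_closed(6)[OF qpow b(2)]] by simp
    then show "a \<oplus> b \<in> G" unfolding G_def q_def[symmetric] using a_closed[OF a(1) b(1)] by blast
  qed
  then have "valuation_ring_of L G"
    unfolding valuation_ring_of_def using valuation_ring_ofE(2)[OF W_valuation] WG by blast
  moreover have "\<phi> ` carrier F \<subseteq> G"
  proof
    fix y assume "y \<in> \<phi> ` carrier F"
    then obtain c where c: "c \<in> carrier F" "y = \<phi> c" by blast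
    obtain a b where ab: "a \<in> D" "b \<in> D - {\<zero>\<^bsub>F\<^esub>}" "c = a \<otimes>\<^bsub>F\<^esub> inv\<^bsub>F\<^esub> b" using D_fraction[OF c(1)] by blast
    have b: "b \<in> D" "b \<noteq> \<zero>\<^bsub>F\<^esub>" using ab(2) by simp_all
    obtain d and n :: nat where d: "d \<in> V" "p [^]\<^bsub>F\<^esub> n = b \<otimes>\<^bsub>F\<^esub> d"
      by (rule nonzero_divides_generator_power[OF b])
    note k = D_carrier[OF ab(1)] D_carrier[OF b(1)] V_carrier[OF d(1)]
    note i = F.nonzero_inv[OF k(2) b(2)]
    have "p [^]\<^bsub>F\<^esub> n \<otimes>\<^bsub>F\<^esub> c = (a \<otimes>\<^bsub>F\<^esub> d) \<otimes>\<^bsub>F\<^esub> (b \<otimes>\<^bsub>F\<^esub> inv\<^bsub>F\<^esub> b)"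
      unfolding d(2) ab(3) using k i(1) by algebra
    then have "p [^]\<^bsub>F\<^esub> n \<otimes>\<^bsub>F\<^esub> c = a \<otimes>\<^bsub>F\<^esub> d" using i(3) k by simp
    then have "p [^]\<^bsub>F\<^esub> n \<otimes>\<^bsub>F\<^esub> c \<in> V" using V_closed(6)[OF subsetD[OF D_subset_V ab(1)] d(1)] by simp
    then have "\<phi> p [^] n \<otimes> \<phi> c \<in> W"
      using phi_V phi_mult[OF generator_pow(2) c(1)] phi_pow[OF generator_carrier(2)] by metis
    then show "y \<in> G" unfolding G_def using c phi_closed by blast
  qed
  ultimately have "G = carrier L" by (rule valuation_ring_containing_F)
  then show ?thesis using x that unfolding G_def by blast
qed

lemma generator_in_max_ideal: "p \<in> max_ideal_of F V"
proof -
  have pV: "p \<in> V" using D_subset_V generator_carrier(1) by blast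
  have "inv\<^bsub>F\<^esub> p \<notin> V"
    using M_mult_V_not_one[OF p(1), of "inv\<^bsub>F\<^esub> p"] F.nonzero_inv(3)[OF generator_carrier(2) generator_nonzero]
    by blast
  then show ?thesis unfolding F.max_ideal_of_subring[OF V_subring] using pV by blast
qed

lemma max_ideal_multiple:
  assumes c: "c \<in> max_ideal_of F V"
  obtains d where "d \<in> V" "c = p \<otimes>\<^bsub>F\<^esub> d"
proof -
  have c': "c \<in> V" "c = \<zero>\<^bsub>F\<^esub> \<or> inv\<^bsub>F\<^esub> c \<notin> V"
    using c unfolding F.max_ideal_of_subring[OF V_subring] by blast+
  obtain a b where ab: "a \<in> D" "b \<in> D" "b \<notin> M" "c = a \<otimes>\<^bsub>F\<^esub> inv\<^bsub>F\<^esub> b" using c'(1) by (rule V_cases)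
  note k = D_carrier[OF ab(1)] D_carrier[OF ab(2)]
  note i = F.nonzero_inv[OF k(2) notin_M_nonzero[OF ab(3)]]
  have "a \<in> M"
  proof (rule ccontr)
    assume a: "a \<notin> M"
    note ia = F.nonzero_inv[OF k(1) notin_M_nonzero[OF a]]
    have "inv\<^bsub>F\<^esub> c = inv\<^bsub>F\<^esub> a \<otimes>\<^bsub>F\<^esub> b"
      unfolding ab(4) using F.inv_mult[OF k(1) i(1) notin_M_nonzero[OF a] i(2)]
        F.inv_inv[OF k(2) notin_M_nonzero[OF ab(3)]] by simp
    moreover have "inv\<^bsub>F\<^esub> a \<otimes>\<^bsub>F\<^esub> b \<in> V"
      using V_closed(6)[OF inv_in_V[OF ab(1) a] subsetD[OF D_subset_V ab(2)]] .
    moreover have "c \<noteq> \<zero>\<^bsub>F\<^esub>" unfolding ab(4) using F.nonzero_mult[OF k(1) i(1) notin_M_nonzero[OF a] i(2)] .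
    ultimately show False using c'(2) by simp
  qed
  then obtain d where d: "d \<in> V" "a = p \<otimes>\<^bsub>F\<^esub> d" using p(2) by blast
  have "c = p \<otimes>\<^bsub>F\<^esub> (d \<otimes>\<^bsub>F\<^esub> inv\<^bsub>F\<^esub> b)"
    unfolding ab(4) d(2) using F.m_assoc[OF generator_carrier(2) V_carrier[OF d(1)] i(1)] .
  then show ?thesis using that V_closed(6)[OF d(1) inv_in_V[OF ab(2,3)]] by blast
qed

end

end

context plain_field
begin

text \<open>
  The divisor \<open>t\<close> is one of \<open>x\<close> and \<open>y\<close>, so it stays in \<open>N\<close>.
\<close>

lemma valuation_ring_common_divisor:
  assumes W: "valuation_ring_of R W" and N: "N \<subseteq> carrier R" "x \<in> N" "y \<in> N"
  obtains t s s' where "t \<in> N" "s \<in> W" "s' \<in> W" "x = t \<otimes> s" "y = t \<otimes> s'"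
proof -
  note W' = subringE[OF valuation_ring_ofE(1)[OF W]]
  have c: "x \<in> carrier R" "y \<in> carrier R" using N by blast+
  show ?thesis
  proof (cases "x = \<zero> \<or> y = \<zero>")
    case True
    then show ?thesis
    proof
      assume "x = \<zero>"
      then show ?thesis using that[of y \<zero> \<one>] N(3) W'(2,3) c by simp
    next
      assume "y = \<zero>"
      then show ?thesis using that[of x \<one> \<zero>] N(2) W'(2,3) c by simp
    qed
  next
    case False
    then have n: "x \<noteq> \<zero>" "y \<noteq> \<zero>" by simp_all
    note ix = nonzero_inv[OF c(1) n(1)] and iy = nonzero_inv[OF c(2) n(2)]
    have z: "y \<otimes> inv x \<in> carrier R" "y \<otimes> inv x \<noteq> \<zero>" using c ix n nonzero_mult by simp_all
    have inv: "inv (y \<otimes> inv x) = inv y \<otimes> x" using inv_mult[OF c(2) ix(1) n(2) ix(2)] inv_inv[OF c(1) n(1)] by simp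
    have e1: "y = x \<otimes> (y \<otimes> inv x)" using m_lcomm[OF c(1) c(2) ix(1)] ix(3) c(2) by simp
    have e2: "x = y \<otimes> (inv y \<otimes> x)" using m_assoc[OF c(2) iy(1) c(1)] iy(3) c(1) by simp
    have o: "x = x \<otimes> \<one>" "y = y \<otimes> \<one>" using c by simp_all
    show ?thesis
    proof (cases "y \<otimes> inv x \<in> W")
      case True
      show ?thesis by (rule that[OF N(2) W'(3) True o(1) e1])
    next
      case False
      then have "inv y \<otimes> x \<in> W" using valuation_ring_ofE(2)[OF W z] unfolding inv by simp
      then show ?thesis by (rule that[OF N(3) _ W'(3) e2 o(2)])
    qed
  qed
qed

lemma valuation_ring_nonunit_mult:
  assumes W: "subring W R" and x: "x \<in> max_ideal_of R W" and u: "u \<in> W"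
  shows "x \<otimes> u \<in> max_ideal_of R W"
proof (rule ccontr)
  note W' = subringE[OF W]
  have x': "x \<in> W" "x = \<zero> \<or> inv x \<notin> W" using x unfolding max_ideal_of_subring[OF W] by blast+
  have c: "x \<in> carrier R" "u \<in> carrier R" using x'(1) u W'(1) by blast+
  define y where "y = x \<otimes> u"
  have yW: "y \<in> W" unfolding y_def by (rule W'(6)[OF x'(1) u])
  assume "x \<otimes> u \<notin> max_ideal_of R W"
  then have y: "y \<noteq> \<zero>" "inv y \<in> W"
    using yW unfolding max_ideal_of_subring[OF W] y_def by blast+
  have yc: "y \<in> carrier R" using yW W'(1) by blast
  note iy = nonzero_inv[OF yc y(1)]
  have "x \<otimes> (u \<otimes> inv y) = \<one>" using m_assoc[OF c iy(1)] y_def iy(3) by simp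
  then have "inv x = u \<otimes> inv y" using inv_eqI[OF c(1)] c(2) iy(1) by simp
  then have "inv x \<in> W" using W'(6)[OF u y(2)] by simp
  moreover have "x \<noteq> \<zero>" using y(1) c(2) unfolding y_def by auto
  ultimately show False using x'(2) by blast
qed

lemma valuation_ring_nonunit_add:
  assumes W: "valuation_ring_of R W" and x: "x \<in> max_ideal_of R W" and y: "y \<in> max_ideal_of R W"
  shows "x \<oplus> y \<in> max_ideal_of R W"
proof -
  note sub = valuation_ring_ofE(1)[OF W]
  note W' = subringE[OF sub]
  have N: "max_ideal_of R W \<subseteq> carrier R" using W'(1) unfolding max_ideal_of_subring[OF sub] by blast
  obtain t s s' where t: "t \<in> max_ideal_of R W" "s \<in> W" "s' \<in> W" "x = t \<otimes> s" "y = t \<otimes> s'"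
    by (rule valuation_ring_common_divisor[OF W N x y])
  have c: "t \<in> carrier R" "s \<in> carrier R" "s' \<in> carrier R" using t N W'(1) by blast+
  have "x \<oplus> y = t \<otimes> (s \<oplus> s')" unfolding t(4,5) using r_distr[OF c(2,3,1)] by simp
  then show ?thesis using valuation_ring_nonunit_mult[OF sub t(1) W'(7)[OF t(2,3)]] by simp
qed

text \<open>
  In a sum of products of \<open>n\<close> elements of \<open>N\<close>, all these elements are multiples of one of them.
\<close>

lemma valuation_ring_ideal_power:
  assumes W: "valuation_ring_of R W" and N: "N \<subseteq> W" "\<zero> \<in> N"
    and z: "z \<in> ideal_power (R\<lparr>carrier := W\<rparr>) N n"
  shows "\<exists>x\<in>N. \<exists>w\<in>W. z = x [^] n \<otimes> w"
proof -
  note W' = subringE[OF valuation_ring_ofE(1)[OF W]]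
  have Nc: "N \<subseteq> carrier R" using N(1) W'(1) by (rule subset_trans)
  have Wpow: "w [^] (k::nat) \<in> W" if "w \<in> W" for w k
    by (rule subring_pow_closed[OF valuation_ring_ofE(1)[OF W] that])
  define G where "G k = {z. \<exists>x\<in>N. \<exists>w\<in>W. z = x [^] (k::nat) \<otimes> w}" for k
  have "ideal_power (R\<lparr>carrier := W\<rparr>) N n \<subseteq> G n"
  proof (rule ideal_power_filtration, simp_all)
    show "W \<subseteq> G 0"
    proof
      fix w assume w: "w \<in> W"
      have "w \<in> carrier R" using w W'(1) by blast
      then have "w = \<zero> [^] (0::nat) \<otimes> w" by simp
      then show "w \<in> G 0" unfolding G_def using N(2) w by blast
    qed
    fix k a b assume a: "a \<in> G k"
    then obtain x w where x: "x \<in> N" "w \<in> W" "a = x [^] k \<otimes> w" unfolding G_def by blast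
    show "a \<oplus> b \<in> G k" if b: "b \<in> G k"
    proof -
      obtain y w' where y: "y \<in> N" "w' \<in> W" "b = y [^] k \<otimes> w'" using b unfolding G_def by blast
      obtain t s s' where t: "t \<in> N" "s \<in> W" "s' \<in> W" "x = t \<otimes> s" "y = t \<otimes> s'"
        by (rule valuation_ring_common_divisor[OF W Nc x(1) y(1)])
      have c: "t \<in> carrier R" "s \<in> carrier R" "s' \<in> carrier R" "w \<in> carrier R" "w' \<in> carrier R"
        using t x y Nc W'(1) by blast+
      have cp: "t [^] k \<in> carrier R" "s [^] k \<in> carrier R" "s' [^] k \<in> carrier R" using c by simp_all
      have "a \<oplus> b = t [^] k \<otimes> (s [^] k \<otimes> w \<oplus> s' [^] k \<otimes> w')"
        unfolding x(3) y(3) t(4,5) nat_pow_distrib[OF c(1,2)] nat_pow_distrib[OF c(1,3)]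
        using cp c(4,5) by algebra
      moreover have "s [^] k \<otimes> w \<oplus> s' [^] k \<otimes> w' \<in> W"
        using W'(7)[OF W'(6)[OF Wpow[OF t(2)] x(2)] W'(6)[OF Wpow[OF t(3)] y(2)]] .
      ultimately show ?thesis unfolding G_def using t(1) by blast
    qed
    show "a \<otimes> b \<in> G (Suc k)" if b: "b \<in> N"
    proof -
      obtain t s s' where t: "t \<in> N" "s \<in> W" "s' \<in> W" "x = t \<otimes> s" "b = t \<otimes> s'"
        by (rule valuation_ring_common_divisor[OF W Nc x(1) b])
      have c: "t \<in> carrier R" "s \<in> carrier R" "s' \<in> carrier R" "w \<in> carrier R"
        using t x Nc W'(1) by blast+
      have cp: "t [^] k \<in> carrier R" "s [^] k \<in> carrier R" using c by simp_all
      have "a \<otimes> b = t [^] Suc k \<otimes> (s [^] k \<otimes> w \<otimes> s')"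
        unfolding x(3) t(5) unfolding t(4) nat_pow_distrib[OF c(1,2)] nat_pow_Suc
        using cp c by algebra
      moreover have "s [^] k \<otimes> w \<otimes> s' \<in> W"
        using W'(6)[OF W'(6)[OF Wpow[OF t(2)] x(2)] t(3)] .
      ultimately show ?thesis unfolding G_def using t(1) by blast
    qed
  qed
  then show ?thesis using z unfolding G_def by blast
qed

end

text \<open>
  The ramification hypothesis says that a power of the maximal ideal \<open>N\<close> of \<open>W\<close> is generated by the
  image \<open>q\<close> of \<open>p\<close>. By \<open>valuation_ring_ideal_power\<close>, \<open>q\<close> is a multiple of the \<open>r\<close>-th power of some \<open>x \<in> N\<close>; then
  this power also generates the \<open>r\<close>-th power of \<open>N\<close>, which is only possible if \<open>x\<close> generates \<open>N\<close>.
\<close>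

lemma (in localized_extension) exists_extension_valuation:
  assumes gen: "p \<in> M \<and> (\<forall>a\<in>M. \<exists>c\<in>V. a = p \<otimes>\<^bsub>F\<^esub> c)"
    and r: "0 < r"
    and ram: "Idl\<^bsub>L\<lparr>carrier := W\<rparr>\<^esub> (\<phi> ` max_ideal_of F V) =
      ideal_power (L\<lparr>carrier := W\<rparr>) (max_ideal_of L W) r"
  obtains v where "discrete_valuation L v" "W = val_ge L v 0" "\<exists>w\<in>carrier L - {\<zero>}. v w = 1"
    "v (\<phi> p) = int r" "\<And>a. a \<in> D \<Longrightarrow> a \<notin> M \<Longrightarrow> v (\<phi> a) = 0"
    "\<And>a. a \<in> M \<Longrightarrow> \<phi> a \<in> val_ge L v (int r)"
proof -
  interpret RW: plain_cring "L\<lparr>carrier := W\<rparr>"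
    using subcringI'[OF W_subring] subcring_iff[OF W_closed(1)] by (simp add: plain_cring_def)
  define N where "N = max_ideal_of L W"
  have N_iff: "x \<in> N \<longleftrightarrow> x \<in> W \<and> (x = \<zero> \<or> inv x \<notin> W)" for x
    unfolding N_def max_ideal_of_subring[OF W_subring] by blast
  have NW: "N \<subseteq> W" "\<zero> \<in> N" using N_iff W_closed(2) by blast+
  have Wpow: "w [^] (k::nat) \<in> W" if "w \<in> W" for w k by (rule subring_pow_closed[OF W_subring that])
  define q where "q = \<phi> p"
  note pc = generator_carrier[OF gen] and p0 = generator_nonzero[OF gen]
  have qW: "q \<in> W" unfolding q_def using phi_V subsetD[OF D_subset_V pc(1)] by blast
  have q: "q \<in> carrier L" "q \<noteq> \<zero>" unfolding q_def using phi_closed[OF pc(2)] phi_nonzero[OF pc(2) p0] .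
  have qN: "q \<in> ideal_power (L\<lparr>carrier := W\<rparr>) N r"
    unfolding N_def ram[symmetric] q_def genideal_def using generator_in_max_ideal[OF gen] by blast
  have Nq: "\<exists>w\<in>W. z = q \<otimes> w" if z: "z \<in> ideal_power (L\<lparr>carrier := W\<rparr>) N r" for z
  proof -
    define J where "J = (\<lambda>w. q \<otimes> w) ` W"
    have "ideal J (L\<lparr>carrier := W\<rparr>)"
    proof (rule RW.idealI_commutative, simp_all)
      show "J \<subseteq> W" unfolding J_def using W_closed(6)[OF qW] by blast
      have "\<zero> = q \<otimes> \<zero>" using q by simp
      then show "\<zero> \<in> J" unfolding J_def using W_closed(2) by blast
      fix a assume "a \<in> J"
      then obtain w where w: "w \<in> W" "a = q \<otimes> w" unfolding J_def by blast
      have wc: "w \<in> carrier L" using w W_closed(1) by blast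
      show "a \<oplus> b \<in> J" if bJ: "b \<in> J" for b
      proof -
        obtain w' where w': "w' \<in> W" "b = q \<otimes> w'" using bJ unfolding J_def by blast
        have "a \<oplus> b = q \<otimes> (w \<oplus> w')" unfolding w(2) w'(2) using r_distr[OF wc _ q(1)] w'(1) W_closed(1) by auto
        then show ?thesis unfolding J_def using W_closed(7)[OF w(1) w'(1)] by blast
      qed
      show "x \<otimes> a \<in> J" if x: "x \<in> W" for x
      proof -
        have "x \<otimes> a = q \<otimes> (x \<otimes> w)" unfolding w(2) using m_lcomm[OF _ q(1) wc] x W_closed(1) by blast
        then show ?thesis unfolding J_def using W_closed(6)[OF x w(1)] by blast
      qed
    qed
    moreover have "\<phi> ` max_ideal_of F V \<subseteq> J"
    proof
      fix y assume "y \<in> \<phi> ` max_ideal_of F V"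
      then obtain c where c: "c \<in> max_ideal_of F V" "y = \<phi> c" by blast
      obtain d where d: "d \<in> V" "c = p \<otimes>\<^bsub>F\<^esub> d" by (rule max_ideal_multiple[OF gen c(1)])
      have "y = q \<otimes> \<phi> d" unfolding c(2) d(2) q_def by (rule phi_mult[OF pc(2) V_carrier[OF d(1)]])
      then show "y \<in> J" unfolding J_def using phi_V[OF d(1)] by blast
    qed
    ultimately have "Idl\<^bsub>L\<lparr>carrier := W\<rparr>\<^esub> (\<phi> ` max_ideal_of F V) \<subseteq> J" by (rule RW.genideal_minimal)
    then show ?thesis using z ram unfolding N_def J_def by blast
  qed
  obtain x w where x: "x \<in> N" "w \<in> W" "q = x [^] r \<otimes> w"
    using valuation_ring_ideal_power[OF W_valuation NW qN] by blast
  have xW: "x \<in> W" and wc: "w \<in> carrier L" using x NW W_closed(1) by blast+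
  have xc: "x \<in> carrier L" using xW W_closed(1) by blast
  have x0: "x \<noteq> \<zero>"
  proof
    assume x0: "x = \<zero>"
    obtain k where "r = Suc k" using r gr0_implies_Suc by blast
    then have "q = \<zero>" using x(3) x0 wc by simp
    then show False using q by simp
  qed
  have powN: "y [^] r \<in> ideal_power (L\<lparr>carrier := W\<rparr>) N r" if "y \<in> N" for y
  proof -
    have "y [^]\<^bsub>L\<lparr>carrier := W\<rparr>\<^esub> r \<in> ideal_power (L\<lparr>carrier := W\<rparr>) N r" by (rule RW.pow_mem_ideal_power[OF that])
    then show ?thesis by (simp add: nat_pow_def)
  qed
  obtain w' where w': "w' \<in> W" "x [^] r = q \<otimes> w'" using Nq[OF powN[OF x(1)]] by blast
  have w'c: "w' \<in> carrier L" using w' W_closed(1) by blast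
  have xr: "x [^] r \<in> carrier L" "x [^] r \<noteq> \<zero>" using xc nonzero_pow[OF xc x0] by simp_all
  have N_eq: "N = (\<lambda>w. x \<otimes> w) ` W"
  proof (intro Set.equalityI subsetI)
    fix y assume "y \<in> (\<lambda>w. x \<otimes> w) ` W"
    then obtain u where u: "u \<in> W" "y = x \<otimes> u" by blast
    show "y \<in> N" unfolding u(2) N_def
      by (rule valuation_ring_nonunit_mult[OF W_subring _ u(1)]) (use x(1) N_def in simp)
  next
    fix y assume y: "y \<in> N"
    have yc: "y \<in> carrier L" using y NW W_closed(1) by blast
    show "y \<in> (\<lambda>w. x \<otimes> w) ` W"
    proof (cases "y = \<zero>")
      case True
      then have "y = x \<otimes> \<zero>" using xc by simp
      then show ?thesis using W_closed(2) by blast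
    next
      case False
      note ix = nonzero_inv[OF xc x0] and iy = nonzero_inv[OF yc False]
      define z where "z = y \<otimes> inv x"
      have z: "z \<in> carrier L" "z \<noteq> \<zero>" unfolding z_def using yc ix nonzero_mult[OF yc ix(1) False ix(2)] by simp_all
      note iz = nonzero_inv[OF z]
      have yz: "y = x \<otimes> z" unfolding z_def using m_lcomm[OF xc yc ix(1)] ix(3) yc by simp
      \<comment> \<open>comparing \<open>y^r\<close> with \<open>x^r\<close> gives \<open>z^r \<in> W\<close>; if \<open>W\<close> also contained the inverse of \<open>z\<close>, it would contain \<open>z\<close>\<close>
      have "z \<in> W"
      proof (rule ccontr)
        assume nz: "z \<notin> W"
        then have izW: "inv z \<in> W" using valuation_ring_ofE(2)[OF W_valuation z] by simp
        obtain u where u: "u \<in> W" "y [^] r = q \<otimes> u" using Nq[OF powN[OF y]] by blast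
        have uc: "u \<in> carrier L" using u W_closed(1) by blast
        have zr: "z [^] r \<in> carrier L" using z by simp
        have "x [^] r \<otimes> z [^] r = x [^] r \<otimes> (w \<otimes> u)"
          using u(2) nat_pow_distrib[OF xc z(1)] m_assoc[OF xr(1) wc uc] unfolding yz x(3) by simp
        then have "z [^] r = w \<otimes> u" using iffD1[OF m_lcancel[OF xr(2,1) zr m_closed[OF wc uc]]] by blast
        then have zrW: "z [^] r \<in> W" using W_closed(6)[OF x(2) u(1)] by simp
        obtain k where k: "r = Suc k" using r gr0_implies_Suc by blast
        have zk: "z [^] k \<in> carrier L" "inv z [^] k \<in> carrier L" using z iz by simp_all
        have "inv z [^] k \<otimes> z [^] r = (inv z [^] k \<otimes> z [^] k) \<otimes> z"
          unfolding k nat_pow_Suc using m_assoc[OF zk(2) zk(1) z(1)] by simp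
        also have "inv z [^] k \<otimes> z [^] k = \<one>" using nat_pow_distrib[OF iz(1) z(1), of k] iz(4) by simp
        finally have "inv z [^] k \<otimes> z [^] r = z" using z by simp
        then show False using nz W_closed(6)[OF Wpow[OF izW, of k] zrW] by simp
      qed
      then show ?thesis using yz by blast
    qed
  qed
  have arch: "\<exists>n::nat. x [^] n \<otimes> y \<in> W" if y: "y \<in> carrier L" for y
  proof -
    obtain n :: nat where n: "q [^] n \<otimes> y \<in> W" using W_archimedean[OF gen y] unfolding q_def by blast
    have c: "q [^] n \<in> carrier L" "w' [^] n \<in> carrier L" using q w'c by simp_all
    have "x [^] (r * n) \<otimes> y = (q \<otimes> w') [^] n \<otimes> y" using nat_pow_pow[OF xc, of r n] w'(2) by simp
    also have "\<dots> = w' [^] n \<otimes> (q [^] n \<otimes> y)"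
      unfolding nat_pow_distrib[OF q(1) w'c] using c y by algebra
    also have "\<dots> \<in> W" by (rule W_closed(6)[OF Wpow[OF w'(1)] n])
    finally show ?thesis by blast
  qed
  obtain v where v: "discrete_valuation L v" "W = val_ge L v 0" "v x = 1"
    using valuation_ring_discrete_valuation[OF W_valuation xW x0 _ arch] N_eq N_def by blast
  interpret v: discrete_valuation L v by (rule v(1))
  have vW: "0 \<le> v y" if "y \<in> W" "y \<noteq> \<zero>" for y using that v(2) v.val_geD(2) by blast
  have w0: "w \<noteq> \<zero>"
  proof
    assume "w = \<zero>"
    then have "q = \<zero>" using x(3) xr by simp
    then show False using q by simp
  qed
  have w'0: "w' \<noteq> \<zero>"
  proof
    assume "w' = \<zero>"
    then have "x [^] r = \<zero>" using w'(2) q by simp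
    then show False using xr by simp
  qed
  have "v q = int r + v w" using x(3) v.val_mult[OF xr(1) wc xr(2) w0] v.val_pow[OF xc x0, of r] v(3) by simp
  moreover have "int r = v q + v w'"
    using w'(2) v.val_mult[OF q(1) w'c q(2) w'0] v.val_pow[OF xc x0, of r] v(3) by simp
  ultimately have vq: "v q = int r" using vW[OF x(2) w0] vW[OF w'(1) w'0] by linarith
  have unit: "v (\<phi> a) = 0" if a: "a \<in> D" "a \<notin> M" for a
  proof -
    note ac = D_carrier[OF a(1)] and a0 = notin_M_nonzero[OF a(2)]
    have "\<phi> a \<in> W" by (rule phi_V[OF subsetD[OF D_subset_V a(1)]])
    then have "0 \<le> v (\<phi> a)" using vW phi_nonzero[OF ac a0] by blast
    moreover have "inv (\<phi> a) \<in> W" using phi_V[OF inv_in_V[OF a]] phi_inv[OF ac a0] by simp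
    then have "0 \<le> v (inv (\<phi> a))" using vW nonzero_inv(2)[OF phi_closed[OF ac] phi_nonzero[OF ac a0]] by blast
    ultimately show ?thesis using v.val_inv[OF phi_closed[OF ac] phi_nonzero[OF ac a0]] by simp
  qed
  have M_ge: "\<phi> a \<in> val_ge L v (int r)" if "a \<in> M" for a
  proof -
    obtain c where c: "c \<in> V" "a = p \<otimes>\<^bsub>F\<^esub> c" using gen[THEN conjunct2, rule_format, OF \<open>a \<in> M\<close>] by blast
    have "\<phi> a = q \<otimes> \<phi> c" unfolding c(2) q_def by (rule phi_mult[OF pc(2) V_carrier[OF c(1)]])
    moreover have "q \<in> val_ge L v (int r)" using q vq by (simp add: val_ge_def)
    moreover have "\<phi> c \<in> val_ge L v 0" using phi_V[OF c(1)] v(2) by simp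
    ultimately show ?thesis using v.val_ge_mult[of q "int r" "\<phi> c" 0] by simp
  qed
  have "\<exists>w\<in>carrier L - {\<zero>}. v w = 1" using xc x0 v(3) by blast
  then show ?thesis using that[OF v(1,2)] vq unit M_ge unfolding q_def by blast
qed

section \<open>The valuations above finitely many maximal ideals\<close>

text \<open>The valuations \<open>v i j\<close>, \<open>1 \<le> j \<le> s i\<close>, represent all extensions of the localization at \<open>M i\<close>; the
  numbers \<open>r i j\<close> are the ramification indices, in the form of values of elements of \<open>M i\<close>.\<close>

locale valuation_family = dedekind_extension L F D \<phi>
  for L :: "'l ring" (structure) and F :: "'a ring" and D \<phi> +
  fixes A :: "nat set" and M :: "nat \<Rightarrow> 'a set" and s :: "nat \<Rightarrow> nat"
    and r :: "nat \<Rightarrow> nat \<Rightarrow> nat" and v :: "nat \<Rightarrow> nat \<Rightarrow> 'l \<Rightarrow> int"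
  assumes finite: "finite A" and nonempty: "A \<noteq> {}"
    and maximal: "\<And>i. i \<in> A \<Longrightarrow> maximalideal (M i) DR"
    and nonzero: "\<And>i. i \<in> A \<Longrightarrow> M i \<noteq> {\<zero>\<^bsub>F\<^esub>}"
    and distinct: "inj_on M A"
    and s_pos: "\<And>i. i \<in> A \<Longrightarrow> 0 < s i"
    and r_pos: "\<And>i j. i \<in> A \<Longrightarrow> j \<in> {1..s i} \<Longrightarrow> 0 < r i j"
    and extensions: "\<And>i. i \<in> A \<Longrightarrow>
      bij_betw (\<lambda>j. val_ge L (v i j) 0) {1..s i} (valuation_extensions F L \<phi> (localization_at F D (M i)))"
    and val: "\<And>i j. i \<in> A \<Longrightarrow> j \<in> {1..s i} \<Longrightarrow> discrete_valuation L (v i j)"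
    and uniformizer: "\<And>i j. i \<in> A \<Longrightarrow> j \<in> {1..s i} \<Longrightarrow> \<exists>w\<in>carrier L - {\<zero>}. v i j w = 1"
    and val_unit: "\<And>i j a. i \<in> A \<Longrightarrow> j \<in> {1..s i} \<Longrightarrow> a \<in> D \<Longrightarrow> a \<notin> M i \<Longrightarrow> v i j (\<phi> a) = 0"
    and val_M: "\<And>i j a. i \<in> A \<Longrightarrow> j \<in> {1..s i} \<Longrightarrow> a \<in> M i \<Longrightarrow> \<phi> a \<in> val_ge L (v i j) (int (r i j))"
    and generator: "\<And>i. i \<in> A \<Longrightarrow> \<exists>p\<in>M i. p \<noteq> \<zero>\<^bsub>F\<^esub> \<and> (\<forall>j\<in>{1..s i}. v i j (\<phi> p) = int (r i j))"
begin

lemma M_ideal: "i \<in> A \<Longrightarrow> ideal (M i) DR"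
  using maximal maximalideal.axioms(1) by blast

lemma M_subset: "i \<in> A \<Longrightarrow> M i \<subseteq> D"
  using ideal_memD(1)[OF M_ideal] by simp

lemma one_notin_M: "i \<in> A \<Longrightarrow> \<one>\<^bsub>F\<^esub> \<notin> M i"
proof
  assume i: "i \<in> A" and "\<one>\<^bsub>F\<^esub> \<in> M i"
  then have "x \<in> M i" if "x \<in> D" for x
    using ideal_memD(4)[OF M_ideal[OF i], of "\<one>\<^bsub>F\<^esub>" x] that D_carrier[OF that] by simp
  then show False using maximalideal.I_notcarr[OF maximal[OF i]] M_subset[OF i] by auto
qed

lemma M_not_subset:
  assumes "i \<in> A" "k \<in> A" "i \<noteq> k"
  shows "\<not> M k \<subseteq> M i"
proof
  assume sub: "M k \<subseteq> M i"
  have "M i = M k \<or> M i = D"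
    using maximalideal.I_maximal[OF maximal[OF assms(2)] M_ideal[OF assms(1)] sub] M_subset[OF assms(1)] by simp
  moreover have "M i \<noteq> D" using maximalideal.I_notcarr[OF maximal[OF assms(1)]] by auto
  ultimately show False using distinct assms inj_onD by metis
qed

lemma phi_D_val_ge:
  assumes ij: "i \<in> A" "j \<in> {1..s i}" and a: "a \<in> D"
  shows "\<phi> a \<in> val_ge L (v i j) 0"
proof -
  interpret v: discrete_valuation L "v i j" by (rule val[OF ij])
  show ?thesis
  proof (cases "a \<in> M i")
    case True
    then show ?thesis using val_M[OF ij] v.val_ge_antimono[of 0 "int (r i j)"] by auto
  next
    case False
    then show ?thesis using val_unit[OF ij a] phi_closed[OF D_carrier[OF a]] by (simp add: val_ge_def)
  qed
qed

text \<open>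
  For \<open>i \<noteq> k\<close> take the inverse of an element of \<open>M k\<close> outside \<open>M i\<close>. For two different extensions of one
  localization, the only case that is not immediate is that some \<open>y\<close> is integral at \<open>(k, l)\<close> but not
  at \<open>(i, j)\<close>. Then \<open>p y^n\<close>, where \<open>p\<close> generates \<open>M i\<close> locally and \<open>n\<close> is its value at \<open>(i, j)\<close>,
  has a value of at most 0 at \<open>(i, j)\<close> and a positive value at \<open>(k, l)\<close>, and its inverse is the
  required element.
\<close>

lemma incomparable:
  assumes ij: "i \<in> A" "j \<in> {1..s i}" and kl: "k \<in> A" "l \<in> {1..s k}" and ne: "(i, j) \<noteq> (k, l)"
  shows "\<exists>a\<in>carrier L - {\<zero>}. 0 \<le> v i j a \<and> v k l a < 0"
proof -
  interpret v: discrete_valuation L "v i j" by (rule val[OF ij])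
  interpret w: discrete_valuation L "v k l" by (rule val[OF kl])
  show ?thesis
  proof (cases "i = k")
    case False
    then obtain a where a: "a \<in> M k" "a \<notin> M i" using M_not_subset[OF ij(1) kl(1)] by blast
    have aD: "a \<in> D" using a(1) M_subset[OF kl(1)] by blast
    have "a \<noteq> \<zero>\<^bsub>F\<^esub>" using a(2) ideal_memD(2)[OF M_ideal[OF ij(1)]] by auto
    then have p: "\<phi> a \<in> carrier L" "\<phi> a \<noteq> \<zero>"
      using phi_closed phi_nonzero D_carrier[OF aD] by blast+
    have "int (r k l) \<le> v k l (\<phi> a)" by (rule w.val_geD(2)[OF val_M[OF kl a(1)] p(2)])
    then have "0 < v k l (\<phi> a)" using r_pos[OF kl] by simp
    then show ?thesis
      using nonzero_inv[OF p] v.val_inv[OF p] w.val_inv[OF p] val_unit[OF ij aD a(2)]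
      by (intro bexI[of _ "inv (\<phi> a)"]) simp_all
  next
    case True
    have "val_ge L (v i j) 0 \<noteq> val_ge L (v k l) 0"
      using bij_betw_imp_inj_on[OF extensions[OF ij(1)]] ij kl ne True inj_onD by fastforce
    then consider (a) a where "a \<in> val_ge L (v i j) 0" "a \<notin> val_ge L (v k l) 0"
      | (y) y where "y \<notin> val_ge L (v i j) 0" "y \<in> val_ge L (v k l) 0" by blast
    then show ?thesis
    proof cases
      case a
      then have "a \<in> carrier L - {\<zero>}" "0 \<le> v i j a" "v k l a < 0"
        by (auto simp: val_ge_def)
      then show ?thesis by blast
    next
      case y
      then have y': "y \<in> carrier L" "y \<noteq> \<zero>" "v i j y < 0" "0 \<le> v k l y"
        by (auto simp: val_ge_def)
      obtain p where p: "p \<in> M i" "p \<noteq> \<zero>\<^bsub>F\<^esub>" "\<forall>j\<in>{1..s i}. v i j (\<phi> p) = int (r i j)"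
        using generator[OF ij(1)] by blast
      have pD: "p \<in> D" using p(1) M_subset[OF ij(1)] by blast
      have q: "\<phi> p \<in> carrier L" "\<phi> p \<noteq> \<zero>"
        using phi_closed phi_nonzero D_carrier[OF pD] p(2) by blast+
      define n where "n = r i j"
      define z where "z = \<phi> p \<otimes> y [^] n"
      have yn: "y [^] n \<in> carrier L" "y [^] n \<noteq> \<zero>" using y' nonzero_pow by auto
      have z: "z \<in> carrier L" "z \<noteq> \<zero>" unfolding z_def using q yn nonzero_mult by simp_all
      have vz: "v i j z = int n + int n * v i j y"
        unfolding z_def using v.val_mult[OF q(1) yn(1) q(2) yn(2)] v.val_pow[OF y'(1,2)] p(3) ij(2) n_def by simp
      have wz: "v k l z = int (r k l) + int n * v k l y"
        unfolding z_def using w.val_mult[OF q(1) yn(1) q(2) yn(2)] w.val_pow[OF y'(1,2)] p(3) kl(2) True by simp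
      have "int n * (1 + v i j y) \<le> 0" using y'(3) by (intro mult_nonneg_nonpos) auto
      then have "v i j z \<le> 0" unfolding vz by (simp add: algebra_simps)
      moreover have "0 < v k l z" unfolding wz using r_pos[OF kl] y'(4) by (simp add: add_pos_nonneg)
      ultimately show ?thesis
        using nonzero_inv[OF z] v.val_inv[OF z] w.val_inv[OF z] by (intro bexI[of _ "inv z"]) simp_all
    qed
  qed
qed

lemma exists_simultaneous_uniformizer:
  obtains y where "y \<in> carrier L" "y \<noteq> \<zero>" "\<And>i j. i \<in> A \<Longrightarrow> j \<in> {1..s i} \<Longrightarrow> v i j y = 1"
proof -
  define K where "K = Sigma A (\<lambda>i. {1..s i})"
  define u where "u k = v (fst k) (snd k)" for k
  obtain y where y: "y \<in> carrier L" "y \<noteq> \<zero>" "\<And>k. k \<in> K \<Longrightarrow> u k y = 1"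
  proof (rule simultaneous_uniformizer[of K u])
    show "discrete_valuation L (u k)" if "k \<in> K" for k
      using val that unfolding u_def K_def by auto
    show "\<exists>w\<in>carrier L - {\<zero>}. u k w = 1" if "k \<in> K" for k
      using uniformizer that unfolding u_def K_def by auto
    show "\<exists>a\<in>carrier L - {\<zero>}. 0 \<le> u k a \<and> u l a < 0" if "k \<in> K" "l \<in> K" "k \<noteq> l" for k l
      using incomparable[of "fst k" "snd k" "fst l" "snd l"] that unfolding u_def K_def by auto
    show "finite K" unfolding K_def using finite by simp
  qed (use that in blast)
  show ?thesis
  proof (rule that[OF y(1,2)])
    show "v i j y = 1" if "i \<in> A" "j \<in> {1..s i}" for i j
      using y(3)[of "(i, j)"] that unfolding u_def K_def by simp
  qed
qed

abbreviation "E \<equiv> integral_closure L (\<phi> ` D)"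

lemma E_iff: "x \<in> E \<longleftrightarrow> x \<in> carrier L \<and> (\<forall>W. valuation_ring_of L W \<and> \<phi> ` D \<subseteq> W \<longrightarrow> x \<in> W)"
  using integral_closure_eq_Inter_valuation_rings[OF phi_D_subring] by blast

lemma E_subring: "subring E L"
proof -
  have "E = \<Inter>(insert (carrier L) {W. valuation_ring_of L W \<and> \<phi> ` D \<subseteq> W})"
    using E_iff by blast
  moreover have "subring (\<Inter>(insert (carrier L) {W. valuation_ring_of L W \<and> \<phi> ` D \<subseteq> W})) L"
    by (rule subring_Inter) (use carrier_is_subring valuation_ring_ofE(1) in blast)+
  ultimately show ?thesis by simp
qed

lemmas E_closed = subringE[OF E_subring]

lemma phi_D_E: "a \<in> D \<Longrightarrow> \<phi> a \<in> E"
  unfolding E_iff using phi_closed[OF D_carrier] by blast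

lemma E_val_ge:
  assumes ij: "i \<in> A" "j \<in> {1..s i}" and x: "x \<in> E"
  shows "x \<in> val_ge L (v i j) 0"
proof -
  have "val_ge L (v i j) 0 \<in> valuation_extensions F L \<phi> (localization_at F D (M i))"
    using bij_betwE[OF extensions[OF ij(1)]] ij(2) by blast
  then have "valuation_ring_of L (val_ge L (v i j) 0)" by (simp add: valuation_extensions_def)
  moreover have "\<phi> ` D \<subseteq> val_ge L (v i j) 0" using phi_D_val_ge[OF ij] by blast
  ultimately show ?thesis using x unfolding E_iff by blast
qed

section \<open>Localization of the integral closure\<close>

definition denominators :: "'a set" where
  "denominators = {d \<in> D. \<forall>i\<in>A. d \<notin> M i}"

lemma denominators_one: "\<one>\<^bsub>F\<^esub> \<in> denominators"
  unfolding denominators_def using D_closed(3) one_notin_M by blast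

lemma denominators_mult: "c \<in> denominators \<Longrightarrow> d \<in> denominators \<Longrightarrow> c \<otimes>\<^bsub>F\<^esub> d \<in> denominators"
  unfolding denominators_def
  using D_closed(6) primeideal.I_prime[OF D.maximalideal_prime[OF maximal]] by fastforce

lemma denominators_nonzero: "d \<in> denominators \<Longrightarrow> d \<noteq> \<zero>\<^bsub>F\<^esub>"
  unfolding denominators_def using nonempty ideal_memD(2)[OF M_ideal] by fastforce

lemma denominators_D: "d \<in> denominators \<Longrightarrow> d \<in> D"
  unfolding denominators_def by blast

text \<open>
  By comaximality some \<open>z\<close> in all \<open>M i\<close> is congruent to \<open>\<one>\<close> modulo \<open>Q\<close>; the difference of \<open>\<one>\<close> and \<open>z\<close>
  lies in \<open>Q\<close> and in no \<open>M i\<close>.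
\<close>

lemma ideal_meets_denominators:
  assumes Q: "ideal Q DR" "\<And>i. i \<in> A \<Longrightarrow> \<not> Q \<subseteq> M i"
  shows "\<exists>q\<in>Q. q \<in> denominators"
proof -
  obtain z q where z: "z \<in> (\<Otimes>\<^bsub>ideals_set DR\<^esub>i\<in>A. ideal_power DR (M i) 1)"
    and q: "q \<in> Q" "z \<oplus>\<^bsub>DR\<^esub> q = \<one>\<^bsub>DR\<^esub>"
    by (rule D.comaximal_prod_powers[OF finite maximal Q])
  have zM: "z \<in> M i" if i: "i \<in> A" for i
  proof -
    have "(\<Otimes>\<^bsub>ideals_set DR\<^esub>i\<in>A. ideal_power DR (M i) 1)
      \<subseteq> ideal_power DR (M i) 1"
      by (rule D.finprod_ideals(2)[OF finite D.ideal_power_ideal[OF M_ideal] i])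
    then show ?thesis using D.ideal_power_subset[OF M_ideal[OF i], of 1] z by auto
  qed
  have "q \<notin> M i" if i: "i \<in> A" for i
  proof
    assume "q \<in> M i"
    then have "z \<oplus>\<^bsub>DR\<^esub> q \<in> M i" using ideal_memD(3)[OF M_ideal[OF i] zM[OF i]] by simp
    then show False using q(2) one_notin_M[OF i] by simp
  qed
  moreover have "q \<in> D" using q(1) ideal_memD(1)[OF Q(1)] by auto
  ultimately show ?thesis using q(1) unfolding denominators_def by blast
qed

end

context valuation_family
begin

text \<open>
  The nonunits of \<open>W\<close> in \<open>D\<close> form a prime ideal \<open>P\<close> without denominators. It is nonzero, as otherwise
  \<open>F\<close> and hence \<open>L\<close> would be contained in \<open>W\<close>. So \<open>P\<close> is maximal, and as it contains no denominators
  it is one of the \<open>M i\<close>. The trace of \<open>W\<close> on \<open>F\<close> contains the localization at \<open>M i\<close>, and it is not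
  larger, because the localization is a valuation ring whose nonunits are nonunits of \<open>W\<close>.
\<close>

lemma valuation_ring_in_family:
  assumes W: "valuation_ring_of L W" "W \<noteq> carrier L" and DW: "\<phi> ` D \<subseteq> W"
    and inv: "\<And>d. d \<in> denominators \<Longrightarrow> inv (\<phi> d) \<in> W"
  shows "\<exists>i\<in>A. \<exists>j\<in>{1..s i}. W = val_ge L (v i j) 0"
proof -
  note sub = valuation_ring_ofE(1)[OF W(1)]
  note W' = subringE[OF sub]
  have N_iff: "x \<in> max_ideal_of L W \<longleftrightarrow> x \<in> W \<and> (x = \<zero> \<or> inv x \<notin> W)" for x
    unfolding max_ideal_of_subring[OF sub] by blast
  define P where "P = {a \<in> D. \<phi> a \<in> max_ideal_of L W}"
  have PD: "P \<subseteq> D" unfolding P_def by blast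
  have phiW: "\<phi> a \<in> W" if "a \<in> D" for a using DW that by blast
  have not_P: "inv (\<phi> a) \<in> W" "a \<noteq> \<zero>\<^bsub>F\<^esub>" if "a \<in> D" "a \<notin> P" for a
    using that N_iff[of "\<phi> a"] phiW phi_zero unfolding P_def by auto
  have P_ideal: "ideal P DR"
  proof (rule D.idealI_commutative, simp_all)
    show "P \<subseteq> D" by (rule PD)
    show "\<zero>\<^bsub>F\<^esub> \<in> P" unfolding P_def N_iff using D_closed(2) phi_zero W'(2) by simp
    fix a assume a: "a \<in> P"
    then have a': "a \<in> D" "\<phi> a \<in> max_ideal_of L W" unfolding P_def by blast+
    show "a \<oplus>\<^bsub>F\<^esub> b \<in> P" if b: "b \<in> P" for b
    proof -
      have b': "b \<in> D" "\<phi> b \<in> max_ideal_of L W" using b unfolding P_def by blast+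
      show ?thesis unfolding P_def
        using valuation_ring_nonunit_add[OF W(1) a'(2) b'(2)] D_closed(7)[OF a'(1) b'(1)]
          phi_add[OF D_carrier[OF a'(1)] D_carrier[OF b'(1)]] by simp
    qed
    show "x \<otimes>\<^bsub>F\<^esub> a \<in> P" if x: "x \<in> D" for x
    proof -
      have "\<phi> (x \<otimes>\<^bsub>F\<^esub> a) = \<phi> a \<otimes> \<phi> x"
        using phi_mult[OF D_carrier[OF x] D_carrier[OF a'(1)]]
          m_comm[OF phi_closed[OF D_carrier[OF x]] phi_closed[OF D_carrier[OF a'(1)]]] by simp
      then show ?thesis unfolding P_def
        using valuation_ring_nonunit_mult[OF sub a'(2) phiW[OF x]] D_closed(6)[OF x a'(1)] by simp
    qed
  qed
  have one: "\<one>\<^bsub>F\<^esub> \<notin> P"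
  proof
    assume "\<one>\<^bsub>F\<^esub> \<in> P"
    then have "\<one> \<in> max_ideal_of L W" unfolding P_def using phi_one by simp
    then show False using N_iff[of \<one>] W'(3) inv_one one_not_zero by simp
  qed
  have P_prime: "primeideal P DR"
  proof (rule primeidealI[OF P_ideal D.is_cring])
    show "carrier DR \<noteq> P" using one D_closed(3) by auto
    fix a b assume ab: "a \<in> carrier DR" "b \<in> carrier DR"
      "a \<otimes>\<^bsub>DR\<^esub> b \<in> P"
    show "a \<in> P \<or> b \<in> P"
    proof (rule ccontr)
      assume "\<not> ?thesis"
      then have n: "a \<in> D" "b \<in> D" "a \<notin> P" "b \<notin> P" using ab by simp_all
      note k = D_carrier[OF n(1)] D_carrier[OF n(2)]
      note na = not_P[OF n(1,3)] and nb = not_P[OF n(2,4)]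
      note pa = phi_closed[OF k(1)] phi_nonzero[OF k(1) na(2)]
        and pb = phi_closed[OF k(2)] phi_nonzero[OF k(2) nb(2)]
      have "inv (\<phi> (a \<otimes>\<^bsub>F\<^esub> b)) \<in> W"
        unfolding phi_mult[OF k] inv_mult[OF pa(1) pb(1) pa(2) pb(2)] by (rule W'(6)[OF na(1) nb(1)])
      moreover have "\<phi> (a \<otimes>\<^bsub>F\<^esub> b) \<noteq> \<zero>"
        unfolding phi_mult[OF k] by (rule nonzero_mult[OF pa(1) pb(1) pa(2) pb(2)])
      moreover have "\<phi> (a \<otimes>\<^bsub>F\<^esub> b) \<in> max_ideal_of L W" using ab(3) unfolding P_def by simp
      ultimately show False using N_iff by blast
    qed
  qed
  have "P \<noteq> {\<zero>\<^bsub>F\<^esub>}"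
  proof
    assume P0: "P = {\<zero>\<^bsub>F\<^esub>}"
    have "\<phi> ` carrier F \<subseteq> W"
    proof
      fix y assume "y \<in> \<phi> ` carrier F"
      then obtain c where c: "c \<in> carrier F" "y = \<phi> c" by blast
      obtain a b where ab: "a \<in> D" "b \<in> D - {\<zero>\<^bsub>F\<^esub>}" "c = a \<otimes>\<^bsub>F\<^esub> inv\<^bsub>F\<^esub> b" using D_fraction[OF c(1)] by blast
      have b: "b \<in> D" "b \<noteq> \<zero>\<^bsub>F\<^esub>" "b \<notin> P" using ab(2) P0 by simp_all
      note i = F.nonzero_inv[OF D_carrier[OF b(1)] b(2)]
      have "y = \<phi> a \<otimes> inv (\<phi> b)"
        unfolding c(2) ab(3) phi_mult[OF D_carrier[OF ab(1)] i(1)] phi_inv[OF D_carrier[OF b(1)] b(2)] ..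
      then show "y \<in> W" using W'(6)[OF phiW[OF ab(1)] not_P(1)[OF b(1,3)]] by simp
    qed
    then show False using valuation_ring_containing_F[OF W(1)] W(2) by blast
  qed
  then have P_max: "maximalideal P DR" by (rule D_prime_maximal[OF P_prime])
  have "\<exists>i\<in>A. P \<subseteq> M i"
  proof (rule ccontr)
    assume "\<not> ?thesis"
    then obtain q where q: "q \<in> P" "q \<in> denominators" using ideal_meets_denominators[OF P_ideal] by blast
    have "\<phi> q \<noteq> \<zero>" using phi_nonzero denominators_nonzero[OF q(2)] D_carrier[OF denominators_D[OF q(2)]] by blast
    then show False using q(1) inv[OF q(2)] N_iff unfolding P_def by blast
  qed
  then obtain i where i: "i \<in> A" "P \<subseteq> M i" by blast
  have "M i = P \<or> M i = D"
    using maximalideal.I_maximal[OF P_max M_ideal[OF i(1)] i(2)] M_subset[OF i(1)] by simp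
  then have Mi: "P = M i" using one_notin_M[OF i(1)] D_closed(3) by auto
  define V where "V = localization_at F D (M i)"
  have ext: "val_ge L (v i j) 0 \<in> valuation_extensions F L \<phi> V" if "j \<in> {1..s i}" for j
    using bij_betwE[OF extensions[OF i(1)]] that unfolding V_def by blast
  have "1 \<in> {1..s i}" using s_pos[OF i(1)] by simp
  then interpret loc: localized_extension L F D \<phi> "M i" V "val_ge L (v i 1) 0"
    by (intro localized_extension.intro localized_extension_axioms.intro dedekind_extension_axioms
        maximal[OF i(1)] nonzero[OF i(1)] V_def ext)
  have VW: "\<phi> c \<in> W" if "c \<in> V" for c
  proof -
    obtain a b where ab: "a \<in> D" "b \<in> D" "b \<notin> M i" "c = a \<otimes>\<^bsub>F\<^esub> inv\<^bsub>F\<^esub> b" using \<open>c \<in> V\<close> by (rule loc.V_cases)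
    have b: "b \<notin> P" using ab(3) Mi by simp
    note i = F.nonzero_inv[OF D_carrier[OF ab(2)] not_P(2)[OF ab(2) b]]
    have "\<phi> c = \<phi> a \<otimes> inv (\<phi> b)"
      unfolding ab(4) phi_mult[OF D_carrier[OF ab(1)] i(1)] phi_inv[OF D_carrier[OF ab(2)] not_P(2)[OF ab(2) b]] ..
    then show ?thesis using W'(6)[OF phiW[OF ab(1)] not_P(1)[OF ab(2) b]] by simp
  qed
  have WV: "c \<in> V" if c: "c \<in> carrier F" "\<phi> c \<in> W" for c
  proof (rule ccontr)
    assume nV: "c \<notin> V"
    have c0: "c \<noteq> \<zero>\<^bsub>F\<^esub>" using nV loc.V_closed(2) by blast
    have "inv\<^bsub>F\<^esub> c \<in> V" using loc.V_or_inv[OF c(1) c0] nV by blast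
    then obtain a b where ab: "a \<in> D" "b \<in> D" "b \<notin> M i" "inv\<^bsub>F\<^esub> c = a \<otimes>\<^bsub>F\<^esub> inv\<^bsub>F\<^esub> b" by (rule loc.V_cases)
    note ic = F.nonzero_inv[OF c(1) c0]
    have b: "b \<notin> P" "b \<noteq> \<zero>\<^bsub>F\<^esub>" using ab(3) Mi not_P(2)[OF ab(2)] by auto
    note k = D_carrier[OF ab(1)] D_carrier[OF ab(2)]
    note ib = F.nonzero_inv[OF k(2) b(2)]
    have a0: "a \<noteq> \<zero>\<^bsub>F\<^esub>"
    proof
      assume "a = \<zero>\<^bsub>F\<^esub>"
      then show False using ab(4) ib(1) ic(2) by simp
    qed
    note ia = F.nonzero_inv[OF k(1) a0]
    have ceq: "c = inv\<^bsub>F\<^esub> a \<otimes>\<^bsub>F\<^esub> b"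
      using F.inv_inv[OF c(1) c0] F.inv_mult[OF k(1) ib(1) a0 ib(2)] F.inv_inv[OF k(2) b(2)] unfolding ab(4) by simp
    have aP: "a \<in> P"
    proof (rule ccontr)
      assume "a \<notin> P"
      then have "inv\<^bsub>F\<^esub> a \<in> V" using loc.inv_in_V[OF ab(1)] Mi by simp
      then have "c \<in> V" unfolding ceq using loc.V_closed(6) subsetD[OF loc.D_subset_V ab(2)] by blast
      then show False using nV by blast
    qed
    have "inv\<^bsub>F\<^esub> a = c \<otimes>\<^bsub>F\<^esub> inv\<^bsub>F\<^esub> b" unfolding ceq using F.m_assoc[OF ia(1) k(2) ib(1)] ib(3) ia(1) by simp
    then have "inv (\<phi> a) = \<phi> c \<otimes> inv (\<phi> b)"
      using phi_mult[OF c(1) ib(1)] phi_inv[OF k(1) a0] phi_inv[OF k(2) b(2)] by simp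
    then have "inv (\<phi> a) \<in> W" using W'(6)[OF c(2) not_P(1)[OF ab(2) b(1)]] by simp
    then show False using aP phi_nonzero[OF k(1) a0] N_iff unfolding P_def by blast
  qed
  have "W \<inter> \<phi> ` carrier F = \<phi> ` V"
    using VW WV loc.V_carrier by blast
  then have "W \<in> valuation_extensions F L \<phi> V" using W(1) by (simp add: valuation_extensions_def)
  then have "W \<in> (\<lambda>j. val_ge L (v i j) 0) ` {1..s i}"
    using bij_betw_imp_surj_on[OF extensions[OF i(1)]] V_def by simp
  then show ?thesis using i(1) by blast
qed

text \<open>
  Let \<open>C\<close> be the subring generated by \<open>D\<close> and the inverse of \<open>x\<close>, and \<open>B\<close> its localization at the
  denominators. If \<open>x\<close> were not in \<open>B\<close>, then some valuation ring above \<open>B\<close> would avoid \<open>x\<close>; it would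
  belong to the family, contrary to the choice of \<open>x\<close>. So \<open>d x \<in> C\<close> for some denominator \<open>d\<close>. Then
  \<open>d x\<close> lies in every valuation ring above \<open>D\<close>: either \<open>x\<close> does, or the inverse of \<open>x\<close> does and with
  it the whole of \<open>C\<close>.
\<close>

lemma exists_denominator:
  assumes x: "x \<in> carrier L" "\<And>i j. i \<in> A \<Longrightarrow> j \<in> {1..s i} \<Longrightarrow> x \<in> val_ge L (v i j) 0"
  obtains d where "d \<in> denominators" "\<phi> d \<otimes> x \<in> E"
proof (cases "x = \<zero>")
  case True
  then have "\<phi> \<one>\<^bsub>F\<^esub> \<otimes> x \<in> E" using E_closed(2) phi_one by simp
  then show ?thesis using that denominators_one by blast
next
  case False
  note ix = nonzero_inv[OF x(1) False]
  define C where "C = simple_extension (\<phi> ` D) (inv x)"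
  have Csub: "subring C L" unfolding C_def by (rule simple_extension_is_subring[OF phi_D_subring ix(1)])
  note C' = subringE[OF Csub]
  have DC: "\<phi> ` D \<subseteq> C" unfolding C_def by (rule simple_extension_incl[OF subringE(1)[OF phi_D_subring] ix(1)])
  have ixC: "inv x \<in> C" unfolding C_def by (rule simple_extension_mem[OF phi_D_subring ix(1)])
  define B where "B = {z \<in> carrier L. \<exists>d\<in>denominators. \<phi> d \<otimes> z \<in> C}"
  have dc: "\<phi> d \<in> carrier L" "\<phi> d \<in> C" "\<phi> d \<noteq> \<zero>" if "d \<in> denominators" for d
    using that DC denominators_D phi_closed phi_nonzero denominators_nonzero D_carrier by blast+
  have phi_dd: "\<phi> (d \<otimes>\<^bsub>F\<^esub> d') = \<phi> d \<otimes> \<phi> d'" if "d \<in> denominators" "d' \<in> denominators" for d d'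
    using that phi_mult denominators_D D_carrier by blast
  have CB: "C \<subseteq> B"
  proof
    fix c assume c: "c \<in> C"
    then have cc: "c \<in> carrier L" using C'(1) by blast
    then have "\<phi> \<one>\<^bsub>F\<^esub> \<otimes> c \<in> C" using c phi_one by simp
    then show "c \<in> B" unfolding B_def using cc denominators_one by blast
  qed
  have Bsub: "subring B L"
  proof (rule subringI)
    show "B \<subseteq> carrier L" unfolding B_def by blast
    show "\<one> \<in> B" using CB C'(3) by blast
    fix a assume "a \<in> B"
    then obtain d where a: "a \<in> carrier L" "d \<in> denominators" "\<phi> d \<otimes> a \<in> C" unfolding B_def by blast
    have "\<phi> d \<otimes> (\<ominus> a) = \<ominus> (\<phi> d \<otimes> a)" using r_minus[OF dc(1)[OF a(2)] a(1)] .
    then have "\<phi> d \<otimes> (\<ominus> a) \<in> C" using C'(5)[OF a(3)] by simp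
    then show "\<ominus> a \<in> B" unfolding B_def using a_inv_closed[OF a(1)] a(2) by blast
    fix b assume "b \<in> B"
    then obtain d' where b: "b \<in> carrier L" "d' \<in> denominators" "\<phi> d' \<otimes> b \<in> C" unfolding B_def by blast
    note k = dc(1)[OF a(2)] dc(1)[OF b(2)]
    note dd = denominators_mult[OF a(2) b(2)]
    have "\<phi> (d \<otimes>\<^bsub>F\<^esub> d') \<otimes> (a \<otimes> b) = (\<phi> d \<otimes> a) \<otimes> (\<phi> d' \<otimes> b)"
      unfolding phi_dd[OF a(2) b(2)] using k a(1) b(1) by algebra
    then have "\<phi> (d \<otimes>\<^bsub>F\<^esub> d') \<otimes> (a \<otimes> b) \<in> C" using C'(6)[OF a(3) b(3)] by simp
    then show "a \<otimes> b \<in> B" unfolding B_def using m_closed[OF a(1) b(1)] dd by blast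
    have "\<phi> (d \<otimes>\<^bsub>F\<^esub> d') \<otimes> (a \<oplus> b) = \<phi> d' \<otimes> (\<phi> d \<otimes> a) \<oplus> \<phi> d \<otimes> (\<phi> d' \<otimes> b)"
      unfolding phi_dd[OF a(2) b(2)] using k a(1) b(1) by algebra
    then have "\<phi> (d \<otimes>\<^bsub>F\<^esub> d') \<otimes> (a \<oplus> b) \<in> C"
      using C'(7)[OF C'(6)[OF dc(2)[OF b(2)] a(3)] C'(6)[OF dc(2)[OF a(2)] b(3)]] by simp
    then show "a \<oplus> b \<in> B" unfolding B_def using a_closed[OF a(1) b(1)] dd by blast
  qed
  have "x \<in> B"
  proof (rule ccontr)
    assume "x \<notin> B"
    moreover have "inv x \<in> B" using CB ixC by blast
    ultimately obtain W where W: "valuation_ring_of L W" "B \<subseteq> W" "x \<notin> W"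
      by (rule exists_valuation_ring_avoiding[OF Bsub x(1)])
    have "inv (\<phi> d) \<in> W" if d: "d \<in> denominators" for d
    proof -
      note id = nonzero_inv[OF dc(1,3)[OF d]]
      have "\<phi> d \<otimes> inv (\<phi> d) \<in> C" using id(3) C'(3) by simp
      then show ?thesis using W(2) id(1) d unfolding B_def by blast
    qed
    moreover have "\<phi> ` D \<subseteq> W" using DC CB W(2) by blast
    moreover have "W \<noteq> carrier L" using x(1) W(3) by blast
    ultimately show False using valuation_ring_in_family[OF W(1)] x(2) W(3) by blast
  qed
  then obtain d where d: "d \<in> denominators" "\<phi> d \<otimes> x \<in> C" unfolding B_def by blast
  have "\<phi> d \<otimes> x \<in> W" if W: "valuation_ring_of L W" "\<phi> ` D \<subseteq> W" for W
  proof (cases "x \<in> W")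
    case True
    have "\<phi> d \<in> W" using W(2) denominators_D[OF d(1)] by blast
    then show ?thesis using True subringE(6)[OF valuation_ring_ofE(1)[OF W(1)]] by blast
  next
    case nx: False
    then have "inv x \<in> W" using valuation_ring_ofE(2)[OF W(1) x(1) False] by blast
    then have "C \<subseteq> W" unfolding C_def
      by (rule simple_extension_subring_incl[OF valuation_ring_ofE(1)[OF W(1)] W(2)])
    then show ?thesis using d(2) by blast
  qed
  then have "\<phi> d \<otimes> x \<in> E" unfolding E_iff using dc(1)[OF d(1)] x(1) by simp
  then show ?thesis using that d(1) by blast
qed

end

context valuation_family
begin

section \<open>The extension of a product of powers\<close>

abbreviation "RE \<equiv> L\<lparr>carrier := E\<rparr>"

lemma RE_cring: "plain_cring RE"
  using subcringI'[OF E_subring] subcring_iff[OF E_closed(1)] by (simp add: plain_cring_def)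

lemma RE_pow: "x [^]\<^bsub>RE\<^esub> (n::nat) = x [^] n"
  by (simp add: nat_pow_def)

lemma denominator_unit:
  assumes "d \<in> denominators" "i \<in> A" "j \<in> {1..s i}"
  shows "v i j (\<phi> d) = 0"
  using assms val_unit unfolding denominators_def by blast

lemma phi_denominator: "d \<in> denominators \<Longrightarrow> \<phi> d \<in> carrier L \<and> \<phi> d \<noteq> \<zero>"
  using phi_closed phi_nonzero D_carrier denominators_D denominators_nonzero by blast

lemma exists_integral_uniformizer:
  obtains y where "y \<in> E" "y \<noteq> \<zero>" "\<And>i j. i \<in> A \<Longrightarrow> j \<in> {1..s i} \<Longrightarrow> v i j y = 1"
proof -
  obtain x where x: "x \<in> carrier L" "x \<noteq> \<zero>" "\<And>i j. i \<in> A \<Longrightarrow> j \<in> {1..s i} \<Longrightarrow> v i j x = 1"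
    using exists_simultaneous_uniformizer by blast
  have "x \<in> val_ge L (v i j) 0" if "i \<in> A" "j \<in> {1..s i}" for i j
    using x that by (simp add: val_ge_def)
  then obtain d where d: "d \<in> denominators" "\<phi> d \<otimes> x \<in> E" by (rule exists_denominator[OF x(1)])
  note pd = conjunct1[OF phi_denominator[OF d(1)]] conjunct2[OF phi_denominator[OF d(1)]]
  show ?thesis
  proof (rule that[OF d(2) nonzero_mult[OF pd(1) x(1) pd(2) x(2)]])
    show "v i j (\<phi> d \<otimes> x) = 1" if ij: "i \<in> A" "j \<in> {1..s i}" for i j
      using discrete_valuation.val_mult[OF val[OF ij] pd(1) x(1) pd(2) x(2)] denominator_unit[OF d(1) ij] x(3)[OF ij] by simp
  qed
qed

context
  fixes e :: "nat \<Rightarrow> nat"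
begin

definition base_ideal :: "'a set" where
  "base_ideal = (\<Otimes>\<^bsub>ideals_set DR\<^esub>i\<in>A. ideal_power DR (M i) (e i))"

definition extended_ideal :: "'l set" where
  "extended_ideal = Idl\<^bsub>RE\<^esub> (\<phi> ` base_ideal)"

lemma M_power_ideal: "i \<in> A \<Longrightarrow> ideal (ideal_power DR (M i) (e i)) DR"
  by (rule D.ideal_power_ideal[OF M_ideal])

lemma base_ideal_ideal: "ideal base_ideal DR"
  unfolding base_ideal_def by (rule D.finprod_ideals(1)[OF finite M_power_ideal])

lemma base_ideal_D: "base_ideal \<subseteq> D"
  using ideal_memD(1)[OF base_ideal_ideal] by simp

lemma phi_base_ideal_E: "\<phi> ` base_ideal \<subseteq> E"
  using base_ideal_D phi_D_E by blast

lemma base_ideal_val_ge: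
  assumes ij: "i \<in> A" "j \<in> {1..s i}" and a: "a \<in> base_ideal"
  shows "\<phi> a \<in> val_ge L (v i j) (int (e i * r i j))"
proof -
  interpret v: discrete_valuation L "v i j" by (rule val[OF ij])
  have "ideal_power DR (M i) (e i) \<subseteq>
      {a \<in> D. \<phi> a \<in> val_ge L (v i j) (int (e i * r i j))}"
  proof (rule ideal_power_filtration, simp_all)
    show "D \<subseteq> {a \<in> D. \<phi> a \<in> val_ge L (v i j) 0}" using phi_D_val_ge[OF ij] by blast
    fix n a b assume a: "a \<in> D \<and> \<phi> a \<in> val_ge L (v i j) (int n * int (r i j))"
    note ac = D_carrier[OF conjunct1[OF a]]
    show "a \<oplus>\<^bsub>F\<^esub> b \<in> D \<and> \<phi> (a \<oplus>\<^bsub>F\<^esub> b) \<in> val_ge L (v i j) (int n * int (r i j))"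
      if b: "b \<in> D \<and> \<phi> b \<in> val_ge L (v i j) (int n * int (r i j))"
      using v.val_ge_add[OF conjunct2[OF a] conjunct2[OF b]] D_closed(7) a b
        phi_add[OF ac D_carrier[OF conjunct1[OF b]]] by simp
    show "a \<otimes>\<^bsub>F\<^esub> b \<in> D \<and> \<phi> (a \<otimes>\<^bsub>F\<^esub> b) \<in> val_ge L (v i j) (int (r i j) + int n * int (r i j))"
      if b: "b \<in> M i"
    proof -
      have bD: "b \<in> D" using b M_subset[OF ij(1)] by blast
      show ?thesis
        using v.val_ge_mult[OF conjunct2[OF a] val_M[OF ij b]] D_closed(6)[OF conjunct1[OF a] bD]
          phi_mult[OF ac D_carrier[OF bD]] by (simp add: add.commute)
    qed
  qed
  moreover have "base_ideal \<subseteq> ideal_power DR (M i) (e i)"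
    unfolding base_ideal_def by (rule D.finprod_ideals(2)[OF finite M_power_ideal ij(1)])
  ultimately show ?thesis using a by blast
qed

text \<open>
  A generator of the base ideal at all \<open>M i\<close> simultaneously, in the style of the Chinese remainder theorem: let
  \<open>c i\<close> be the \<open>e i\<close>-th power of a local generator of \<open>M i\<close> times the product over \<open>k \<noteq> i\<close> of powers
  \<open>e k + 1\<close> of elements of \<open>M k\<close> outside \<open>M i\<close>. Then \<open>c i\<close> has the required values above \<open>M i\<close> and
  larger values than required above the other \<open>M k\<close>, so the sum of the \<open>c i\<close> has the required
  values everywhere.
\<close>

lemma base_ideal_exact_element:
  obtains c where "c \<in> base_ideal" "\<phi> c \<noteq> \<zero>"
    "\<And>i j. i \<in> A \<Longrightarrow> j \<in> {1..s i} \<Longrightarrow> v i j (\<phi> c) = int (e i * r i j)"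
proof -
  have "\<exists>p. p \<in> M i \<and> p \<noteq> \<zero>\<^bsub>F\<^esub> \<and> (\<forall>j\<in>{1..s i}. v i j (\<phi> p) = int (r i j))" if "i \<in> A" for i
    using generator[OF that] by blast
  then obtain p where p: "\<And>i. i \<in> A \<Longrightarrow> p i \<in> M i \<and> p i \<noteq> \<zero>\<^bsub>F\<^esub> \<and> (\<forall>j\<in>{1..s i}. v i j (\<phi> (p i)) = int (r i j))"
    by metis
  have "\<exists>q. q \<in> M k \<and> q \<notin> M i" if "i \<in> A" "k \<in> A" "i \<noteq> k" for i k
    using M_not_subset[OF that] by blast
  then obtain q where q: "\<And>i k. i \<in> A \<Longrightarrow> k \<in> A \<Longrightarrow> i \<noteq> k \<Longrightarrow> q i k \<in> M k \<and> q i k \<notin> M i"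
    by metis
  define h where "h i k = (if k = i then p i [^]\<^bsub>F\<^esub> e i else q i k [^]\<^bsub>F\<^esub> Suc (e k))" for i k
  have pow_M: "a [^]\<^bsub>F\<^esub> n \<in> ideal_power DR (M k) n" if "a \<in> M k" for a n k
    using D.pow_mem_ideal_power[OF that, of n] by (simp add: D_pow)
  have hM: "h i k \<in> ideal_power DR (M k) (e k)" if "i \<in> A" "k \<in> A" for i k
  proof (cases "k = i")
    case True
    then show ?thesis using p[OF that(1)] pow_M unfolding h_def by simp
  next
    case False
    then have "q i k \<in> M k" using q that by blast
    moreover from this have "q i k \<in> carrier DR" using M_subset[OF that(2)] by auto
    ultimately have "q i k [^]\<^bsub>F\<^esub> e k \<otimes>\<^bsub>F\<^esub> q i k \<in> ideal_power DR (M k) (e k)"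
      using ideal.I_r_closed[OF M_power_ideal[OF that(2)] pow_M] by simp
    then show ?thesis using False unfolding h_def by simp
  qed
  have hD: "h i k \<in> D" if "i \<in> A" "k \<in> A" for i k
    using hM[OF that] ideal_memD(1)[OF M_power_ideal[OF that(2)]] by auto
  have hnz: "h i k \<noteq> \<zero>\<^bsub>F\<^esub>" if "i \<in> A" "k \<in> A" for i k
  proof (cases "k = i")
    case True
    then show ?thesis using F.nonzero_pow p[OF that(1)] M_subset[OF that(1)] D_carrier unfolding h_def by auto
  next
    case False
    have "q i k \<noteq> \<zero>\<^bsub>F\<^esub>" using q[OF that] False ideal_memD(2)[OF M_ideal[OF that(1)]] by auto
    moreover have "q i k \<in> carrier F" using q[OF that] False M_subset[OF that(2)] D_carrier by blast
    ultimately have "q i k [^]\<^bsub>F\<^esub> Suc (e k) \<noteq> \<zero>\<^bsub>F\<^esub>" by (intro F.nonzero_pow)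
    then show ?thesis using False unfolding h_def by simp
  qed
  define c where "c i = (\<Otimes>\<^bsub>DR\<^esub>k\<in>A. h i k)" for i
  have cI: "c i \<in> base_ideal" if "i \<in> A" for i
    unfolding c_def base_ideal_def by (rule D.finprod_ideals(3)[OF finite M_power_ideal hM[OF that]])
  have cD: "c i \<in> D" if "i \<in> A" for i using cI[OF that] base_ideal_D by blast
  \<comment> \<open>for the induction the product runs over a subset of \<open>A\<close>\<close>
  have vprod: "(\<Otimes>\<^bsub>DR\<^esub>k\<in>B. h i k) \<in> D \<and> \<phi> (\<Otimes>\<^bsub>DR\<^esub>k\<in>B. h i k) \<noteq> \<zero> \<and>
      v k l (\<phi> (\<Otimes>\<^bsub>DR\<^esub>k\<in>B. h i k)) = (\<Sum>m\<in>B. v k l (\<phi> (h i m)))"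
    if i: "i \<in> A" and kl: "k \<in> A" "l \<in> {1..s k}" and B: "B \<subseteq> A" for i k l B
  proof -
    interpret w: discrete_valuation L "v k l" by (rule val[OF kl])
    have "finite B" using B finite by (rule finite_subset)
    then show ?thesis using B
    proof (induction B)
      case empty
      then show ?case using D_closed(3) phi_one w.val_one one_not_zero by simp
    next
      case (insert m B)
      define g where "g = (\<Otimes>\<^bsub>DR\<^esub>k\<in>B. h i k)"
      have mA: "m \<in> A" using insert.prems by blast
      have IH: "g \<in> D" "\<phi> g \<noteq> \<zero>" "v k l (\<phi> g) = (\<Sum>m\<in>B. v k l (\<phi> (h i m)))"
        using insert unfolding g_def by blast+
      have "(\<Otimes>\<^bsub>DR\<^esub>k\<in>insert m B. h i k) = h i m \<otimes>\<^bsub>DR\<^esub> g"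
        unfolding g_def using insert hD[OF i] by (intro D.finprod_insert) auto
      then have eq: "(\<Otimes>\<^bsub>DR\<^esub>k\<in>insert m B. h i k) = h i m \<otimes>\<^bsub>F\<^esub> g" by simp
      note hm = hD[OF i mA]
      note ph = phi_closed[OF D_carrier[OF hm]] phi_nonzero[OF D_carrier[OF hm] hnz[OF i mA]]
      note pg = phi_closed[OF D_carrier[OF IH(1)]]
      show ?case
        unfolding eq phi_mult[OF D_carrier[OF hm] D_carrier[OF IH(1)]]
        using D_closed(6)[OF hm IH(1)] nonzero_mult[OF ph(1) pg ph(2) IH(2)]
          w.val_mult[OF ph(1) pg ph(2) IH(2)] IH(3) insert.hyps by simp
    qed
  qed
  have vh: "v k l (\<phi> (h i m)) = (if m = i then int (e i) * v k l (\<phi> (p i)) else int (Suc (e m)) * v k l (\<phi> (q i m)))"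
    if i: "i \<in> A" "m \<in> A" and kl: "k \<in> A" "l \<in> {1..s k}" for i m k l
  proof -
    interpret w: discrete_valuation L "v k l" by (rule val[OF kl])
    show ?thesis
    proof (cases "m = i")
      case True
      have pc: "p i \<in> carrier F" using p[OF i(1)] M_subset[OF i(1)] D_carrier by blast
      have "p i \<noteq> \<zero>\<^bsub>F\<^esub>" using p[OF i(1)] by blast
      then show ?thesis
        using True w.val_pow[OF phi_closed[OF pc] phi_nonzero[OF pc]] phi_pow[OF pc] unfolding h_def by simp
    next
      case False
      have qc: "q i m \<in> carrier F" using q[OF i] False M_subset[OF i(2)] D_carrier by blast
      have "q i m \<noteq> \<zero>\<^bsub>F\<^esub>" using q[OF i] False ideal_memD(2)[OF M_ideal[OF i(1)]] by auto
      then show ?thesis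
        using False w.val_pow[OF phi_closed[OF qc] phi_nonzero[OF qc], of "Suc (e m)"] phi_pow[OF qc, of "Suc (e m)"]
        unfolding h_def by (simp del: nat_pow_Suc F.nat_pow_Suc)
    qed
  qed
  have v_same: "v i j (\<phi> (c i)) = int (e i * r i j)" if ij: "i \<in> A" "j \<in> {1..s i}" for i j
  proof -
    have "v i j (\<phi> (h i m)) = 0" if m: "m \<in> A - {i}" for m
    proof -
      have "q i m \<in> D" "q i m \<notin> M i" using q[OF ij(1), of m] m M_subset[of m] by blast+
      then show ?thesis using vh[OF ij(1) _ ij, of m] val_unit[OF ij] m by simp
    qed
    then have "(\<Sum>m\<in>A. v i j (\<phi> (h i m))) = v i j (\<phi> (h i i))"
      using finite ij(1) by (simp add: sum.remove[of A i])
    then show ?thesis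
      using vprod[OF ij(1) ij subset_refl] vh[OF ij(1,1) ij] p[OF ij(1)] ij(2) unfolding c_def by simp
  qed
  have v_other: "int (e k * r k l) + 1 \<le> v k l (\<phi> (c i))" if i: "i \<in> A" "i \<noteq> k" and kl: "k \<in> A" "l \<in> {1..s k}" for i k l
  proof -
    interpret w: discrete_valuation L "v k l" by (rule val[OF kl])
    have nn: "0 \<le> v k l (\<phi> (h i m))" if m: "m \<in> A" for m
      using w.val_geD(2)[OF phi_D_val_ge[OF kl hD[OF i(1) m]]] phi_nonzero[OF D_carrier[OF hD[OF i(1) m]] hnz[OF i(1) m]] .
    have "q i k \<in> M k" "q i k \<notin> M i" using q[OF i(1) kl(1) i(2)] by blast+
    then have "q i k \<in> carrier F" "q i k \<noteq> \<zero>\<^bsub>F\<^esub>"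
      using M_subset[OF kl(1)] D_carrier ideal_memD(2)[OF M_ideal[OF i(1)]] by auto
    then have "int (r k l) \<le> v k l (\<phi> (q i k))"
      using w.val_geD(2)[OF val_M[OF kl \<open>q i k \<in> M k\<close>] phi_nonzero] by blast
    then have "int (Suc (e k)) * int (r k l) \<le> v k l (\<phi> (h i k))"
      using vh[OF i(1) kl(1) kl] i(2) mult_left_mono[of "int (r k l)" "v k l (\<phi> (q i k))" "int (Suc (e k))"] by simp
    moreover have "v k l (\<phi> (h i k)) \<le> (\<Sum>m\<in>A. v k l (\<phi> (h i m)))"
      using nn finite kl(1) by (intro member_le_sum) auto
    moreover have "1 \<le> int (r k l)" using r_pos[OF kl] by simp
    ultimately show ?thesis
      using vprod[OF i(1) kl subset_refl] unfolding c_def by (simp add: algebra_simps)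
  qed
  have nz: "\<phi> (c i) \<noteq> \<zero>" if i: "i \<in> A" for i
  proof -
    have "1 \<in> {1..s i}" using s_pos[OF i] by simp
    then show ?thesis using vprod[OF i i _ subset_refl] unfolding c_def by blast
  qed
  have sum: "B \<subseteq> A \<Longrightarrow> finsum DR c B \<in> base_ideal \<and>
      \<phi> (finsum DR c B) = (\<Oplus>i\<in>B. \<phi> (c i))" if "finite B" for B
    using that
  proof (induction B)
    case empty
    then show ?case using ideal_memD(2)[OF base_ideal_ideal] phi_zero by simp
  next
    case (insert m B)
    have "finsum DR c (insert m B) = c m \<oplus>\<^bsub>DR\<^esub> finsum DR c B"
      using insert cD by (intro D.finsum_insert) auto
    moreover have "(\<Oplus>i\<in>insert m B. \<phi> (c i)) = \<phi> (c m) \<oplus> (\<Oplus>i\<in>B. \<phi> (c i))"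
      using insert cD phi_closed D_carrier by (intro finsum_insert) auto
    moreover have "c m \<in> base_ideal" "finsum DR c B \<in> base_ideal"
      "\<phi> (finsum DR c B) = (\<Oplus>i\<in>B. \<phi> (c i))" using insert cI by blast+
    moreover from this have "c m \<in> carrier F" "finsum DR c B \<in> carrier F"
      using base_ideal_D D_carrier by blast+
    ultimately show ?case using ideal_memD(3)[OF base_ideal_ideal] phi_add by simp
  qed
  define d where "d = finsum DR c A"
  have d: "d \<in> base_ideal" "\<phi> d = (\<Oplus>i\<in>A. \<phi> (c i))" using sum[OF finite subset_refl] unfolding d_def by blast+
  have vd: "\<phi> d \<noteq> \<zero> \<and> v i j (\<phi> d) = int (e i * r i j)" if ij: "i \<in> A" "j \<in> {1..s i}" for i j
  proof -
    interpret w: discrete_valuation L "v i j" by (rule val[OF ij])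
    have cc: "\<phi> (c k) \<in> carrier L" if "k \<in> A" for k using phi_closed[OF D_carrier[OF cD[OF that]]] .
    have "\<phi> (c k) \<in> val_ge L (v i j) (v i j (\<phi> (c i)) + 1)" if "k \<in> A" "k \<noteq> i" for k
      using v_other[OF that ij] v_same[OF ij] cc[OF that(1)] by (simp add: val_ge_def)
    then show ?thesis
      using w.val_finsum_dominated[OF finite ij(1), of "\<lambda>i. \<phi> (c i)"] cc[OF ij(1)] nz[OF ij(1)] v_same[OF ij] d(2) by simp
  qed
  obtain i where i: "i \<in> A" using nonempty by blast
  have "1 \<in> {1..s i}" using s_pos[OF i] by simp
  then have "\<phi> d \<noteq> \<zero>" using vd[OF i] by blast
  then show ?thesis using that d(1) vd by blast
qed

end

end

sublocale valuation_family \<subseteq> E: plain_cring "L\<lparr>carrier := integral_closure L (\<phi> ` D)\<rparr>"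
  by (rule RE_cring)

context valuation_family
begin

text \<open>
  The elements of \<open>D\<close> that multiply \<open>x\<close> into \<open>B\<close> form an ideal \<open>Q\<close>, which contains \<open>d\<close> and thus is
  contained in no \<open>M i\<close>. By comaximality some \<open>z\<close> in the base ideal is congruent to \<open>\<one>\<close> modulo \<open>Q\<close>, and so is its
  \<open>t\<close>-th power. Since this power lies in \<open>B\<close>, it follows that \<open>x \<in> B\<close>.
\<close>

lemma cancel_denominator:
  assumes B: "ideal B RE" and x: "x \<in> E" and d: "d \<in> denominators" "\<phi> d \<otimes> x \<in> B"
    and z: "\<And>z. z \<in> base_ideal e \<Longrightarrow> \<phi> z [^] (t::nat) \<in> B"
  shows "x \<in> B"
proof -
  note B' = ideal_memD[OF B, simplified]
  have xc: "x \<in> carrier L" using x E_closed(1) by blast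
  define Q where "Q = {q \<in> D. \<phi> q \<otimes> x \<in> B}"
  have Q: "ideal Q DR"
  proof (rule D.idealI_commutative, simp_all)
    show "Q \<subseteq> D" unfolding Q_def by blast
    show "\<zero>\<^bsub>F\<^esub> \<in> Q" unfolding Q_def using D_closed(2) phi_zero xc B'(2) by simp
    fix a assume "a \<in> Q"
    then have a: "a \<in> D" "\<phi> a \<otimes> x \<in> B" unfolding Q_def by blast+
    note ac = D_carrier[OF a(1)]
    show "a \<oplus>\<^bsub>F\<^esub> b \<in> Q" if bQ: "b \<in> Q" for b
    proof -
      have b: "b \<in> D" "\<phi> b \<otimes> x \<in> B" using bQ unfolding Q_def by blast+
      note bc = D_carrier[OF b(1)]
      have "\<phi> (a \<oplus>\<^bsub>F\<^esub> b) \<otimes> x = \<phi> a \<otimes> x \<oplus> \<phi> b \<otimes> x"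
        unfolding phi_add[OF ac bc] by (rule l_distr[OF phi_closed[OF ac] phi_closed[OF bc] xc])
      then show ?thesis unfolding Q_def using D_closed(7)[OF a(1) b(1)] B'(3)[OF a(2) b(2)] by simp
    qed
    show "y \<otimes>\<^bsub>F\<^esub> a \<in> Q" if y: "y \<in> D" for y
    proof -
      note yc = D_carrier[OF y]
      have "\<phi> (y \<otimes>\<^bsub>F\<^esub> a) \<otimes> x = \<phi> y \<otimes> (\<phi> a \<otimes> x)"
        unfolding phi_mult[OF yc ac] by (rule m_assoc[OF phi_closed[OF yc] phi_closed[OF ac] xc])
      then show ?thesis unfolding Q_def using D_closed(6)[OF y a(1)] B'(4)[OF a(2) phi_D_E[OF y]] by simp
    qed
  qed
  have nQ: "\<not> Q \<subseteq> M i" if "i \<in> A" for i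
    using d that unfolding Q_def denominators_def by blast
  obtain z q where zq: "z \<in> base_ideal e" "q \<in> Q" "z \<oplus>\<^bsub>DR\<^esub> q = \<one>\<^bsub>DR\<^esub>"
    unfolding base_ideal_def by (rule D.comaximal_prod_powers[OF finite maximal Q nQ])
  have zD: "z \<in> D" using zq(1) base_ideal_D by blast
  have "\<exists>r\<in>Q. z [^]\<^bsub>DR\<^esub> t \<oplus>\<^bsub>DR\<^esub> r = \<one>\<^bsub>DR\<^esub>"
    using D.congruent_one_pow[OF Q _ zq(2,3)] zD by simp
  then obtain r where r: "r \<in> Q" "z [^]\<^bsub>F\<^esub> t \<oplus>\<^bsub>F\<^esub> r = \<one>\<^bsub>F\<^esub>" by (auto simp: D_pow)
  have rD: "r \<in> D" "\<phi> r \<otimes> x \<in> B" using r(1) unfolding Q_def by blast+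
  note zc = D_carrier[OF zD] and rc = D_carrier[OF rD(1)]
  have k: "\<phi> z [^] t \<in> carrier L" "\<phi> r \<in> carrier L" using phi_closed zc rc by simp_all
  have "\<phi> (z [^]\<^bsub>F\<^esub> t \<oplus>\<^bsub>F\<^esub> r) = \<phi> z [^] t \<oplus> \<phi> r"
    using phi_add[of "z [^]\<^bsub>F\<^esub> t" r] phi_pow[OF zc] zc rc by simp
  then have "\<phi> z [^] t \<oplus> \<phi> r = \<one>" using r(2) phi_one by simp
  then have "x = (\<phi> z [^] t \<oplus> \<phi> r) \<otimes> x" using xc by simp
  also have "\<dots> = x \<otimes> \<phi> z [^] t \<oplus> \<phi> r \<otimes> x" using k xc by algebra
  also have "\<dots> \<in> B" using B'(3)[OF B'(4)[OF z[OF zq(1)] x] rD(2)] .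
  finally show ?thesis .
qed

lemma extended_ideal_ideal: "ideal (extended_ideal e) RE"
  unfolding extended_ideal_def using E.genideal_ideal[of "\<phi> ` base_ideal e"] phi_base_ideal_E by simp

lemma phi_base_ideal_extended: "z \<in> base_ideal e \<Longrightarrow> \<phi> z \<in> extended_ideal e"
  unfolding extended_ideal_def using E.genideal_self[of "\<phi> ` base_ideal e"] phi_base_ideal_E by auto

lemma val_ge_ideal:
  fixes h :: "nat \<Rightarrow> nat \<Rightarrow> nat"
  shows "ideal {x \<in> E. \<forall>i\<in>A. \<forall>j\<in>{1..s i}. x \<in> val_ge L (v i j) (int (h i j))} RE"
proof -
  define J where "J = {x \<in> E. \<forall>i\<in>A. \<forall>j\<in>{1..s i}. x \<in> val_ge L (v i j) (int (h i j))}"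
  have JI: "x \<in> J" if "x \<in> E" "\<And>i j. i \<in> A \<Longrightarrow> j \<in> {1..s i} \<Longrightarrow> x \<in> val_ge L (v i j) (int (h i j))" for x
    unfolding J_def using that by blast
  have JD: "x \<in> E" "\<And>i j. i \<in> A \<Longrightarrow> j \<in> {1..s i} \<Longrightarrow> x \<in> val_ge L (v i j) (int (h i j))" if "x \<in> J" for x
    using that unfolding J_def by blast+
  have "ideal J RE"
  proof (rule E.idealI_commutative, simp_all)
    show "J \<subseteq> E" using JD(1) by blast
    show "\<zero> \<in> J" by (rule JI[OF E_closed(2)]) (simp add: val_ge_def)
    fix a assume a: "a \<in> J"
    show "a \<oplus> b \<in> J" if b: "b \<in> J" for b
      by (rule JI[OF E_closed(7)[OF JD(1)[OF a] JD(1)[OF b]]])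
        (rule discrete_valuation.val_ge_add[OF val JD(2)[OF a] JD(2)[OF b]])
    show "x \<otimes> a \<in> J" if x: "x \<in> E" for x
    proof (rule JI[OF E_closed(6)[OF x JD(1)[OF a]]])
      fix i j assume ij: "i \<in> A" "j \<in> {1..s i}"
      show "x \<otimes> a \<in> val_ge L (v i j) (int (h i j))"
        using discrete_valuation.val_ge_mult[OF val[OF ij] E_val_ge[OF ij x] JD(2)[OF a ij]] by simp
    qed
  qed
  then show ?thesis unfolding J_def .
qed

text \<open>
  If \<open>x\<close> satisfies the inequalities, then \<open>x / c\<close> is integral at the whole family for the simultaneous
  local generator \<open>c\<close> of the base ideal. Hence \<open>d x\<close> is in \<open>c E\<close> for some denominator \<open>d\<close>, which can be cancelled.
\<close>

theorem extended_ideal_iff: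
  "x \<in> extended_ideal e \<longleftrightarrow>
    x \<in> E \<and> (\<forall>i\<in>A. \<forall>j\<in>{1..s i}. x \<in> val_ge L (v i j) (int (e i * r i j)))"
proof
  assume "x \<in> extended_ideal e"
  moreover have "extended_ideal e \<subseteq>
      {x \<in> E. \<forall>i\<in>A. \<forall>j\<in>{1..s i}. x \<in> val_ge L (v i j) (int (e i * r i j))}"
    unfolding extended_ideal_def
  proof (rule E.genideal_minimal[OF val_ge_ideal])
    show "\<phi> ` base_ideal e \<subseteq> {x \<in> E. \<forall>i\<in>A. \<forall>j\<in>{1..s i}. x \<in> val_ge L (v i j) (int (e i * r i j))}"
      using phi_base_ideal_E base_ideal_val_ge by blast
  qed
  ultimately show "x \<in> E \<and> (\<forall>i\<in>A. \<forall>j\<in>{1..s i}. x \<in> val_ge L (v i j) (int (e i * r i j)))" by blast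
next
  assume x: "x \<in> E \<and> (\<forall>i\<in>A. \<forall>j\<in>{1..s i}. x \<in> val_ge L (v i j) (int (e i * r i j)))"
  have xE: "x \<in> E" using x by blast
  have xc: "x \<in> carrier L" using xE E_closed(1) by blast
  obtain c where c: "c \<in> base_ideal e" "\<phi> c \<noteq> \<zero>"
    "\<And>i j. i \<in> A \<Longrightarrow> j \<in> {1..s i} \<Longrightarrow> v i j (\<phi> c) = int (e i * r i j)"
    using base_ideal_exact_element[of e] by blast
  have cc: "\<phi> c \<in> carrier L" using c(1) base_ideal_D phi_closed D_carrier by blast
  note ic = nonzero_inv[OF cc c(2)]
  have "x \<otimes> inv (\<phi> c) \<in> val_ge L (v i j) 0" if ij: "i \<in> A" "j \<in> {1..s i}" for i j
  proof -
    interpret w: discrete_valuation L "v i j" by (rule val[OF ij])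
    have "inv (\<phi> c) \<in> val_ge L (v i j) (- int (e i * r i j))"
      using ic(1) w.val_inv[OF cc c(2)] c(3)[OF ij] by (simp add: val_ge_def)
    moreover have "x \<in> val_ge L (v i j) (int (e i * r i j))" using x ij by blast
    ultimately show ?thesis using w.val_ge_mult by fastforce
  qed
  then obtain d where d: "d \<in> denominators" "\<phi> d \<otimes> (x \<otimes> inv (\<phi> c)) \<in> E"
    by (rule exists_denominator[OF m_closed[OF xc ic(1)]])
  have dc: "\<phi> d \<in> carrier L" using phi_denominator[OF d(1)] by blast
  have "(\<phi> d \<otimes> (x \<otimes> inv (\<phi> c))) \<otimes> \<phi> c = \<phi> d \<otimes> x \<otimes> (inv (\<phi> c) \<otimes> \<phi> c)"
    using dc xc ic(1) cc by algebra
  also have "\<dots> = \<phi> d \<otimes> x" using ic(4) dc xc by simp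
  finally have "\<phi> d \<otimes> x \<in> extended_ideal e"
    using ideal_memD(4)[OF extended_ideal_ideal phi_base_ideal_extended[OF c(1)], of "\<phi> d \<otimes> (x \<otimes> inv (\<phi> c))"] d(2)
    by simp
  moreover have "\<phi> z [^] (1::nat) \<in> extended_ideal e" if "z \<in> base_ideal e" for z
    using phi_base_ideal_extended[OF that] phi_closed[OF D_carrier[OF subsetD[OF base_ideal_D that]]] by simp
  ultimately show "x \<in> extended_ideal e"
    by (rule cancel_denominator[OF extended_ideal_ideal xE d(1)])
qed

lemma val_ge_pow_iff:
  assumes ij: "i \<in> A" "j \<in> {1..s i}" and x: "x \<in> carrier L" "x \<noteq> \<zero>"
  shows "x [^] (n::nat) \<in> val_ge L (v i j) k \<longleftrightarrow> k \<le> int n * v i j x"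
  using discrete_valuation.val_pow[OF val[OF ij] x] x nonzero_pow[OF x] by (simp add: val_ge_def)

context
  fixes e :: "nat \<Rightarrow> nat"
  assumes e_pos: "\<And>i. i \<in> A \<Longrightarrow> 0 < e i"
begin

text \<open>
  The value of a power is a multiple of the value, so the radical is cut out by positive values; as an
  exponent that works for all \<open>i\<close> and \<open>j\<close> the proof takes a number above the sum of all \<open>e i * r i j\<close>.
\<close>

lemma radical_extended_ideal:
  "radical_of RE (extended_ideal e) = {x \<in> E. \<forall>i\<in>A. \<forall>j\<in>{1..s i}. x \<in> val_ge L (v i j) 1}"
proof (intro Set.equalityI subsetI)
  fix x assume "x \<in> radical_of RE (extended_ideal e)"
  then obtain k :: nat where k: "0 < k" "x \<in> E" "x [^] k \<in> extended_ideal e"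
    unfolding radical_of_def by (auto simp: RE_pow)
  have xc: "x \<in> carrier L" using k(2) E_closed(1) by blast
  have "x \<in> val_ge L (v i j) 1" if ij: "i \<in> A" "j \<in> {1..s i}" for i j
  proof (cases "x = \<zero>")
    case True
    then show ?thesis by (simp add: val_ge_def)
  next
    case False
    have "x [^] k \<in> val_ge L (v i j) (int (e i * r i j))" using k(3) ij extended_ideal_iff by blast
    then have "int (e i * r i j) \<le> int k * v i j x" using val_ge_pow_iff[OF ij xc False] by blast
    moreover have "0 < int (e i * r i j)" using e_pos[OF ij(1)] r_pos[OF ij] by simp
    ultimately have "0 < int k * v i j x" by linarith
    then have "0 < v i j x" using k(1) by (simp add: zero_less_mult_iff)
    then show ?thesis using xc by (simp add: val_ge_def)
  qed
  then show "x \<in> {x \<in> E. \<forall>i\<in>A. \<forall>j\<in>{1..s i}. x \<in> val_ge L (v i j) 1}" using k(2) by blast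
next
  fix x assume x: "x \<in> {x \<in> E. \<forall>i\<in>A. \<forall>j\<in>{1..s i}. x \<in> val_ge L (v i j) 1}"
  define n where "n = Suc (\<Sum>i\<in>A. \<Sum>j\<in>{1..s i}. e i * r i j)"
  have n: "e i * r i j \<le> n" if ij: "i \<in> A" "j \<in> {1..s i}" for i j
  proof -
    have "e i * r i j \<le> (\<Sum>j\<in>{1..s i}. e i * r i j)" using ij(2) by (intro member_le_sum) auto
    also have "\<dots> \<le> (\<Sum>i\<in>A. \<Sum>j\<in>{1..s i}. e i * r i j)" using ij(1) finite
      by (intro member_le_sum[of i A "\<lambda>i. \<Sum>j\<in>{1..s i}. e i * r i j"]) auto
    finally show ?thesis unfolding n_def by simp
  qed
  have "x [^] n \<in> val_ge L (v i j) (int (e i * r i j))" if ij: "i \<in> A" "j \<in> {1..s i}" for i j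
  proof -
    interpret w: discrete_valuation L "v i j" by (rule val[OF ij])
    have "x \<in> val_ge L (v i j) 1" using x ij by blast
    then have "x [^] n \<in> val_ge L (v i j) (int n * 1)" by (rule w.val_ge_pow)
    moreover have "int (e i * r i j) \<le> int n * 1" using n[OF ij] by (simp only: mult_1_right of_nat_le_iff)
    ultimately show ?thesis using w.val_ge_antimono by blast
  qed
  moreover have "x [^] n \<in> E" using subring_pow_closed[OF E_subring] x by blast
  ultimately have "x [^] n \<in> extended_ideal e" using extended_ideal_iff by blast
  moreover have "0 < n" unfolding n_def by simp
  ultimately show "x \<in> radical_of RE (extended_ideal e)"
    using x unfolding radical_of_def by (auto simp: RE_pow)
qed

lemma radical_extended_ideal_radical: "radical_ideal RE (radical_of RE (extended_ideal e))"
proof -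
  let ?J = "radical_of RE (extended_ideal e)"
  have "ideal ?J RE" unfolding radical_extended_ideal using val_ge_ideal[of "\<lambda>_ _. 1"] by simp
  moreover have "radical_of RE ?J = ?J"
  proof (intro Set.equalityI subsetI)
    fix x assume "x \<in> radical_of RE ?J"
    then obtain k :: nat where k: "0 < k" "x \<in> E" "x [^] k \<in> ?J"
      unfolding radical_of_def[of RE ?J] by (auto simp: RE_pow)
    obtain l :: nat where l: "0 < l" "(x [^] k) [^] l \<in> extended_ideal e"
      using k(3) unfolding radical_of_def[of RE "extended_ideal e"] by (auto simp: RE_pow)
    have "x [^] (k * l) \<in> extended_ideal e" using l(2) nat_pow_pow[of x k l] k(2) E_closed(1) by auto
    moreover have "0 < k * l" using k l by simp
    ultimately show "x \<in> ?J" unfolding radical_of_def using k(2) by (auto simp: RE_pow intro!: exI[of _ "k * l"])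
  next
    fix x assume x: "x \<in> ?J"
    then have "x \<in> E" unfolding radical_of_def by simp
    moreover have "x [^] (1::nat) \<in> ?J" using x subsetD[OF E_closed(1) \<open>x \<in> E\<close>] by simp
    ultimately show "x \<in> radical_of RE ?J"
      unfolding radical_of_def[of RE ?J] by (auto simp: RE_pow intro!: exI[of _ "1::nat"])
  qed
  ultimately show ?thesis unfolding radical_ideal_def by blast
qed

lemma ideal_power_val_ge:
  assumes ij: "i \<in> A" "j \<in> {1..s i}" and J: "J \<subseteq> val_ge L (v i j) 1"
  shows "ideal_power RE J t \<subseteq> val_ge L (v i j) (int t)"
proof -
  interpret w: discrete_valuation L "v i j" by (rule val[OF ij])
  show ?thesis
  proof (rule ideal_power_filtration, simp_all)
    show "E \<subseteq> val_ge L (v i j) 0" using E_val_ge[OF ij] by blast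
    show "a \<oplus> b \<in> val_ge L (v i j) (int n)" if "a \<in> val_ge L (v i j) (int n)" "b \<in> val_ge L (v i j) (int n)" for n a b
      using w.val_ge_add that by blast
    show "a \<otimes> b \<in> val_ge L (v i j) (1 + int n)" if "a \<in> val_ge L (v i j) (int n)" "b \<in> J" for n a b
      using w.val_ge_mult[OF that(1) subsetD[OF J that(2)]] by (simp add: add.commute)
  qed
qed

text \<open>
  Both inequalities between \<open>t\<close> and \<open>e i * r i j\<close> come from one element each: \<open>y^t\<close>, for an integral
  simultaneous uniformizer \<open>y \<in> J\<close>, and the simultaneous local generator \<open>c\<close> of the base ideal.
\<close>

theorem radical_power_imp:
  assumes t: "0 < t" and J: "radical_ideal RE J" and eq: "extended_ideal e = ideal_power RE J t"
  shows "J = radical_of RE (extended_ideal e)"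
    and "\<And>i j. i \<in> A \<Longrightarrow> j \<in> {1..s i} \<Longrightarrow> e i * r i j = t"
proof -
  have Ji: "ideal J RE" and Jr: "radical_of RE J = J" using J unfolding radical_ideal_def by blast+
  have JE: "J \<subseteq> E" using ideal_memD(1)[OF Ji] by simp
  show J_eq: "J = radical_of RE (extended_ideal e)"
  proof (intro Set.equalityI subsetI)
    fix x assume x: "x \<in> J"
    have "x [^]\<^bsub>RE\<^esub> t \<in> extended_ideal e" unfolding eq by (rule E.pow_mem_ideal_power[OF x])
    then show "x \<in> radical_of RE (extended_ideal e)" using x JE t unfolding radical_of_def by auto
  next
    fix x assume "x \<in> radical_of RE (extended_ideal e)"
    then have "x \<in> radical_of RE J"
      using E.ideal_power_subset[OF Ji t] unfolding eq radical_of_def by blast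
    then show "x \<in> J" using Jr by simp
  qed
  fix i j assume ij: "i \<in> A" "j \<in> {1..s i}"
  interpret w: discrete_valuation L "v i j" by (rule val[OF ij])
  obtain y where y: "y \<in> E" "y \<noteq> \<zero>" "\<And>i j. i \<in> A \<Longrightarrow> j \<in> {1..s i} \<Longrightarrow> v i j y = 1"
    using exists_integral_uniformizer by blast
  have yc: "y \<in> carrier L" using y(1) E_closed(1) by blast
  have "y \<in> J" unfolding J_eq radical_extended_ideal using y yc by (auto simp: val_ge_def)
  then have "y [^] t \<in> extended_ideal e" unfolding eq using E.pow_mem_ideal_power[of y J t] by (simp add: RE_pow)
  then have "y [^] t \<in> val_ge L (v i j) (int (e i * r i j))" using ij extended_ideal_iff by blast
  then have "int (e i * r i j) \<le> int t" using val_ge_pow_iff[OF ij yc y(2)] y(3)[OF ij] by simp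
  moreover obtain c where c: "c \<in> base_ideal e" "\<phi> c \<noteq> \<zero>"
    "\<And>i j. i \<in> A \<Longrightarrow> j \<in> {1..s i} \<Longrightarrow> v i j (\<phi> c) = int (e i * r i j)"
    using base_ideal_exact_element[of e] by blast
  have "J \<subseteq> val_ge L (v i j) 1" unfolding J_eq radical_extended_ideal using ij by blast
  then have "\<phi> c \<in> val_ge L (v i j) (int t)"
    using ideal_power_val_ge[OF ij] phi_base_ideal_extended[OF c(1)] unfolding eq by blast
  then have "int t \<le> int (e i * r i j)" using w.val_geD(2)[OF _ c(2)] c(3)[OF ij] by metis
  ultimately show "e i * r i j = t" by (simp only: of_nat_le_iff)
qed

text \<open>
  For \<open>x\<close> in the extended ideal, \<open>x / y^t\<close> is integral at the whole family, so \<open>d x\<close> is in the \<open>t\<close>-th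
  power of the radical for some denominator \<open>d\<close>. This power contains the \<open>t\<close>-th powers of the
  elements of the base ideal, so the denominator can be cancelled.
\<close>

theorem radical_power_of_equal:
  assumes eq: "\<And>i j. i \<in> A \<Longrightarrow> j \<in> {1..s i} \<Longrightarrow> e i * r i j = t"
  shows "extended_ideal e = ideal_power RE (radical_of RE (extended_ideal e)) t"
proof -
  define J where "J = radical_of RE (extended_ideal e)"
  have J: "ideal J RE" using radical_extended_ideal_radical unfolding radical_ideal_def J_def by blast
  have J_eq: "J = {x \<in> E. \<forall>i\<in>A. \<forall>j\<in>{1..s i}. x \<in> val_ge L (v i j) 1}"
    unfolding J_def by (rule radical_extended_ideal)
  note Jt = E.ideal_power_ideal[OF J, of t]
  have "ideal_power RE J t \<subseteq> extended_ideal e"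
  proof
    fix x assume x: "x \<in> ideal_power RE J t"
    have "x \<in> E" using x ideal_memD(1)[OF Jt] by auto
    moreover have "x \<in> val_ge L (v i j) (int (e i * r i j))" if ij: "i \<in> A" "j \<in> {1..s i}" for i j
    proof -
      have "J \<subseteq> val_ge L (v i j) 1" unfolding J_eq using ij by blast
      then show ?thesis using ideal_power_val_ge[OF ij] x eq[OF ij] by blast
    qed
    ultimately show "x \<in> extended_ideal e" using extended_ideal_iff by blast
  qed
  moreover have "extended_ideal e \<subseteq> ideal_power RE J t"
  proof
    fix x assume x: "x \<in> extended_ideal e"
    then have xE: "x \<in> E" using extended_ideal_iff by blast
    then have xc: "x \<in> carrier L" using E_closed(1) by blast
    obtain y where y: "y \<in> E" "y \<noteq> \<zero>" "\<And>i j. i \<in> A \<Longrightarrow> j \<in> {1..s i} \<Longrightarrow> v i j y = 1"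
      using exists_integral_uniformizer by blast
    have yc: "y \<in> carrier L" using y(1) E_closed(1) by blast
    have "y \<in> J" unfolding J_eq using y yc by (auto simp: val_ge_def)
    then have yJ: "y [^] t \<in> ideal_power RE J t" using E.pow_mem_ideal_power[of y J t] by (simp add: RE_pow)
    have yt: "y [^] t \<in> carrier L" "y [^] t \<noteq> \<zero>" using yc nonzero_pow[OF yc y(2)] by simp_all
    note iy = nonzero_inv[OF yt]
    have "x \<otimes> inv (y [^] t) \<in> val_ge L (v i j) 0" if ij: "i \<in> A" "j \<in> {1..s i}" for i j
    proof -
      interpret w: discrete_valuation L "v i j" by (rule val[OF ij])
      have "inv (y [^] t) \<in> val_ge L (v i j) (- int t)"
        using iy(1) w.val_inv[OF yt] w.val_pow[OF yc y(2)] y(3)[OF ij] by (simp add: val_ge_def)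
      moreover have "x \<in> val_ge L (v i j) (int t)" using x ij extended_ideal_iff eq[OF ij] by metis
      ultimately show ?thesis using w.val_ge_mult by fastforce
    qed
    then obtain d where d: "d \<in> denominators" "\<phi> d \<otimes> (x \<otimes> inv (y [^] t)) \<in> E"
      by (rule exists_denominator[OF m_closed[OF xc iy(1)]])
    have dc: "\<phi> d \<in> carrier L" using phi_denominator[OF d(1)] by blast
    have "(\<phi> d \<otimes> (x \<otimes> inv (y [^] t))) \<otimes> y [^] t = \<phi> d \<otimes> x \<otimes> (inv (y [^] t) \<otimes> y [^] t)"
      using dc xc iy(1) yt(1) by algebra
    also have "\<dots> = \<phi> d \<otimes> x" using iy(4) dc xc by simp
    finally have dx: "\<phi> d \<otimes> x \<in> ideal_power RE J t"
      using ideal_memD(4)[OF Jt yJ, of "\<phi> d \<otimes> (x \<otimes> inv (y [^] t))"] d(2) by simp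
    have "\<phi> z [^] t \<in> ideal_power RE J t" if z: "z \<in> base_ideal e" for z
    proof -
      have zE: "\<phi> z \<in> E" using z phi_base_ideal_E by blast
      then have "\<phi> z [^] (1::nat) \<in> extended_ideal e" using phi_base_ideal_extended[OF z] subsetD[OF E_closed(1) zE] by simp
      then have "\<phi> z \<in> J" unfolding J_def radical_of_def using zE by (auto simp: RE_pow intro!: exI[of _ "1::nat"])
      then show ?thesis using E.pow_mem_ideal_power[of "\<phi> z" J t] by (simp add: RE_pow)
    qed
    then show "x \<in> ideal_power RE J t" by (rule cancel_denominator[OF Jt xE d(1) dx])
  qed
  ultimately show ?thesis unfolding J_def by blast
qed

end

end

section \<open>Powers of radical ideals and ramification\<close>

text \<open>
  The generator of \<open>M\<close> in \<open>V\<close> is obtained from one extension of \<open>V\<close>, but as an element of \<open>F\<close> it serves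
  all extensions.
\<close>

lemma (in dedekind_extension) exists_extension_valuations:
  assumes M: "maximalideal M DR" "M \<noteq> {\<zero>\<^bsub>F\<^esub>}" and s: "0 < (s::nat)"
    and V: "V = localization_at F D M"
    and W: "bij_betw W {1..s} (valuation_extensions F L \<phi> V)"
    and r: "\<And>j. j \<in> {1..s} \<Longrightarrow> 0 < r j"
    and ram: "\<And>j. j \<in> {1..s} \<Longrightarrow> Idl\<^bsub>L\<lparr>carrier := W j\<rparr>\<^esub> (\<phi> ` max_ideal_of F V) =
      ideal_power (L\<lparr>carrier := W j\<rparr>) (max_ideal_of L (W j)) (r j)"
  shows "\<exists>v. bij_betw (\<lambda>j. val_ge L (v j) 0) {1..s} (valuation_extensions F L \<phi> V) \<and>
    (\<forall>j\<in>{1..s}. discrete_valuation L (v j) \<and> (\<exists>w\<in>carrier L - {\<zero>}. v j w = 1) \<and>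
      (\<forall>a\<in>D. a \<notin> M \<longrightarrow> v j (\<phi> a) = 0) \<and> (\<forall>a\<in>M. \<phi> a \<in> val_ge L (v j) (int (r j)))) \<and>
    (\<exists>p\<in>M. p \<noteq> \<zero>\<^bsub>F\<^esub> \<and> (\<forall>j\<in>{1..s}. v j (\<phi> p) = int (r j)))"
proof -
  have loc: "localized_extension L F D \<phi> M V (W j)" if "j \<in> {1..s}" for j
    using bij_betwE[OF W] that M V
    by (intro localized_extension.intro localized_extension_axioms.intro dedekind_extension_axioms) simp_all
  have "1 \<in> {1..s}" using s by simp
  then interpret one: localized_extension L F D \<phi> M V "W 1" by (rule loc)
  obtain p where p: "p \<in> M \<and> (\<forall>a\<in>M. \<exists>c\<in>V. a = p \<otimes>\<^bsub>F\<^esub> c)" using one.exists_local_generator by blast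
  have p0: "p \<noteq> \<zero>\<^bsub>F\<^esub>" by (rule one.generator_nonzero[OF p])
  have "\<forall>j\<in>{1..s}. \<exists>v. discrete_valuation L v \<and> W j = val_ge L v 0 \<and> (\<exists>w\<in>carrier L - {\<zero>}. v w = 1) \<and>
      v (\<phi> p) = int (r j) \<and> (\<forall>a\<in>D. a \<notin> M \<longrightarrow> v (\<phi> a) = 0) \<and> (\<forall>a\<in>M. \<phi> a \<in> val_ge L v (int (r j)))"
  proof
    fix j assume j: "j \<in> {1..s}"
    interpret j: localized_extension L F D \<phi> M V "W j" by (rule loc[OF j])
    show "\<exists>v. discrete_valuation L v \<and> W j = val_ge L v 0 \<and> (\<exists>w\<in>carrier L - {\<zero>}. v w = 1) \<and>
      v (\<phi> p) = int (r j) \<and> (\<forall>a\<in>D. a \<notin> M \<longrightarrow> v (\<phi> a) = 0) \<and> (\<forall>a\<in>M. \<phi> a \<in> val_ge L v (int (r j)))"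
      by (rule j.exists_extension_valuation[OF p r[OF j] ram[OF j]]) blast
  qed
  from bchoice[OF this] obtain v where v: "\<forall>j\<in>{1..s}. discrete_valuation L (v j) \<and> W j = val_ge L (v j) 0 \<and>
      (\<exists>w\<in>carrier L - {\<zero>}. v j w = 1) \<and> v j (\<phi> p) = int (r j) \<and> (\<forall>a\<in>D. a \<notin> M \<longrightarrow> v j (\<phi> a) = 0) \<and>
      (\<forall>a\<in>M. \<phi> a \<in> val_ge L (v j) (int (r j)))" by blast
  have "bij_betw (\<lambda>j. val_ge L (v j) 0) {1..s} (valuation_extensions F L \<phi> V)"
    using W v by (subst bij_betw_cong[where g = W]) auto
  then show ?thesis using v p p0 by blast
qed

theorem proposition3p13:
  fixes F :: "'a ring" and D :: "'a set"
    and n m :: nat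
    and M :: "nat \<Rightarrow> 'a set" and e :: "nat \<Rightarrow> nat" and I :: "'a set"
    and s :: "nat \<Rightarrow> nat" and K :: "nat \<Rightarrow> nat \<Rightarrow> 'k ring"
    and \<kappa> :: "nat \<Rightarrow> nat \<Rightarrow> 'a set \<Rightarrow> 'k"
    and f r :: "nat \<Rightarrow> nat \<Rightarrow> nat"
    and L :: "'l ring" and \<phi> :: "'a \<Rightarrow> 'l"
    and E :: "'l set" and RE :: "'l ring" and IE :: "'l set"
  assumes dedekind: "dedekind_domain_with_quotient_field D F"
    and not_field: "carrier F \<noteq> D"
    and n: "n > 1"
    and maximal: "\<And>i. i \<in> {1..n} \<Longrightarrow> maximalideal (M i) (F\<lparr>carrier := D\<rparr>)"
    and distinct: "inj_on M {1..n}"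
    and e_pos: "\<And>i. i \<in> {1..n} \<Longrightarrow> e i > 0"
    and I: "I = (\<Otimes>\<^bsub>ideals_set (F\<lparr>carrier := D\<rparr>)\<^esub> i\<in>{1..n}. ideal_power (F\<lparr>carrier := D\<rparr>) (M i) (e i))"
    and m: "m > 0"
    and consistent: "consistent_system m F n (\<lambda>i. localization_at F D (M i)) s K \<kappa> f r"
    and realizable: "realizable TYPE('l) m F n (\<lambda>i. localization_at F D (M i)) s K \<kappa> r"
    and realizes: "realizes L \<phi> m F n (\<lambda>i. localization_at F D (M i)) s K \<kappa> r"
    and E: "E = integral_closure L (\<phi> ` D)"
    and RE: "RE = L\<lparr>carrier := E\<rparr>"
    and IE: "IE = Idl\<^bsub>RE\<^esub> (\<phi> ` I)"
  shows
    "(((\<exists>J t. t > 0 \<and> radical_ideal RE J \<and> IE = ideal_power RE J t) \<longleftrightarrow>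
         (\<forall>i\<in>{1..n}. \<forall>j\<in>{1..s i}. \<forall>i'\<in>{1..n}. \<forall>j'\<in>{1..s i'}. e i * r i j = e i' * r i' j')) \<and>
      (\<forall>J t. t > 0 \<and> radical_ideal RE J \<and> IE = ideal_power RE J t \<longrightarrow>
         J = radical_of RE IE \<and> (\<forall>i\<in>{1..n}. \<forall>j\<in>{1..s i}. e i * r i j = t)))
     \<and>
     (\<forall>J. radical_ideal RE J \<and> IE = ideal_power RE J m \<longrightarrow>
        (\<forall>i\<in>{1..n}. (\<Sum>j=1..s i. f i j) = e i))
     \<and>
     (\<forall>J t. t > 0 \<and> radical_ideal RE J \<and> IE = ideal_power RE J t \<and>
        \<not> (\<exists>p::nat. Factorial_Ring.prime p \<and> (\<forall>i\<in>{1..n}. p dvd e i)) \<longrightarrow>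
        (\<exists>k>0. m = k * t) \<and>
        (\<forall>i\<in>{1..n}. (\<exists>k>0. t = k * e i) \<and> (\<exists>k>0. m = k * e i)))"
proof -
  have L: "field L" "\<phi> \<in> ring_hom F L" "separable_algebraic_extension L (\<phi> ` carrier F)"
    using realizes unfolding realizes_def by blast+
  interpret ext: dedekind_extension L F D \<phi>
  proof (intro dedekind_extension.intro dedekind_extension_axioms.intro dedekind L(2))
    show "plain_field L" using L(1) by (simp add: plain_field_def)
    show "ring.algebraic L (\<phi> ` carrier F) x" if "x \<in> carrier L" for x
      using L(3) that unfolding separable_algebraic_extension_def by blast
  qed
  have sys: "0 < s i" "(\<Sum>j=1..s i. r i j * f i j) = m" "\<And>j. j \<in> {1..s i} \<Longrightarrow> 0 < r i j" if "i \<in> {1..n}" for i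
    using consistent that unfolding consistent_system_def by blast+
  have M_ideal: "ideal (M i) (F\<lparr>carrier := D\<rparr>)" if "i \<in> {1..n}" for i
    using maximalideal.axioms(1)[OF maximal[OF that]] .
  \<comment> \<open>two distinct maximal ideals are both nonzero\<close>
  have nonzero: "M i \<noteq> {\<zero>\<^bsub>F\<^esub>}" if i: "i \<in> {1..n}" for i
  proof
    assume zero: "M i = {\<zero>\<^bsub>F\<^esub>}"
    obtain k where k: "k \<in> {1..n}" "k \<noteq> i"
    proof (cases "i = 1")
      case True
      then show ?thesis using that[of 2] n by simp
    next
      case False
      then show ?thesis using that[of 1] n by simp
    qed
    note Mk = ideal_memD[OF M_ideal[OF k(1)], simplified]
    have "M i \<subseteq> M k" using zero Mk(2) by simp
    then have "M k = M i \<or> M k = carrier (F\<lparr>carrier := D\<rparr>)"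
      using maximalideal.I_maximal[OF maximal[OF i] M_ideal[OF k(1)]] Mk(1) by simp
    moreover have "M k \<noteq> M i" using inj_onD[OF distinct] k i by metis
    moreover have "M k \<noteq> carrier (F\<lparr>carrier := D\<rparr>)"
      using maximalideal.I_notcarr[OF maximal[OF k(1)]] by metis
    ultimately show False by blast
  qed
  define V where "V i = localization_at F D (M i)" for i
  have "\<exists>v. bij_betw (\<lambda>j. val_ge L (v j) 0) {1..s i} (valuation_extensions F L \<phi> (V i)) \<and>
    (\<forall>j\<in>{1..s i}. discrete_valuation L (v j) \<and> (\<exists>w\<in>carrier L - {\<zero>\<^bsub>L\<^esub>}. v j w = 1) \<and>
      (\<forall>a\<in>D. a \<notin> M i \<longrightarrow> v j (\<phi> a) = 0) \<and> (\<forall>a\<in>M i. \<phi> a \<in> val_ge L (v j) (int (r i j)))) \<and>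
    (\<exists>p\<in>M i. p \<noteq> \<zero>\<^bsub>F\<^esub> \<and> (\<forall>j\<in>{1..s i}. v j (\<phi> p) = int (r i j)))" if i: "i \<in> {1..n}" for i
  proof -
    have "\<exists>W. bij_betw W {1..s i} (valuation_extensions F L \<phi> (V i)) \<and>
        (\<forall>j\<in>{1..s i}. Idl\<^bsub>L\<lparr>carrier := W j\<rparr>\<^esub> (\<phi> ` max_ideal_of F (V i)) =
             ideal_power (L\<lparr>carrier := W j\<rparr>) (max_ideal_of L (W j)) (r i j))"
      using realizes i unfolding realizes_def V_def by blast
    then obtain W where W: "bij_betw W {1..s i} (valuation_extensions F L \<phi> (V i))"
      "\<And>j. j \<in> {1..s i} \<Longrightarrow> Idl\<^bsub>L\<lparr>carrier := W j\<rparr>\<^esub> (\<phi> ` max_ideal_of F (V i)) =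
             ideal_power (L\<lparr>carrier := W j\<rparr>) (max_ideal_of L (W j)) (r i j)" by blast
    show ?thesis
      by (rule ext.exists_extension_valuations[OF maximal[OF i] nonzero[OF i] sys(1)[OF i] V_def W(1) sys(3)[OF i] W(2)])
  qed
  then have "\<forall>i\<in>{1..n}. \<exists>v. bij_betw (\<lambda>j. val_ge L (v j) 0) {1..s i} (valuation_extensions F L \<phi> (V i)) \<and>
    (\<forall>j\<in>{1..s i}. discrete_valuation L (v j) \<and> (\<exists>w\<in>carrier L - {\<zero>\<^bsub>L\<^esub>}. v j w = 1) \<and>
      (\<forall>a\<in>D. a \<notin> M i \<longrightarrow> v j (\<phi> a) = 0) \<and> (\<forall>a\<in>M i. \<phi> a \<in> val_ge L (v j) (int (r i j)))) \<and>
    (\<exists>p\<in>M i. p \<noteq> \<zero>\<^bsub>F\<^esub> \<and> (\<forall>j\<in>{1..s i}. v j (\<phi> p) = int (r i j)))" by blast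
  from bchoice[OF this] obtain v where v: "\<And>i. i \<in> {1..n} \<Longrightarrow>
      bij_betw (\<lambda>j. val_ge L (v i j) 0) {1..s i} (valuation_extensions F L \<phi> (V i)) \<and>
    (\<forall>j\<in>{1..s i}. discrete_valuation L (v i j) \<and> (\<exists>w\<in>carrier L - {\<zero>\<^bsub>L\<^esub>}. v i j w = 1) \<and>
      (\<forall>a\<in>D. a \<notin> M i \<longrightarrow> v i j (\<phi> a) = 0) \<and> (\<forall>a\<in>M i. \<phi> a \<in> val_ge L (v i j) (int (r i j)))) \<and>
    (\<exists>p\<in>M i. p \<noteq> \<zero>\<^bsub>F\<^esub> \<and> (\<forall>j\<in>{1..s i}. v i j (\<phi> p) = int (r i j)))" by blast
  interpret fam: valuation_family L F D \<phi> "{1..n}" M s r v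
  proof (intro valuation_family.intro valuation_family_axioms.intro ext.dedekind_extension_axioms)
    show "finite {1..n}" "{1..n} \<noteq> {}" "inj_on M {1..n}" using n distinct by simp_all
    fix i assume i: "i \<in> {1..n}"
    note vi = v[OF i]
    show "maximalideal (M i) (F\<lparr>carrier := D\<rparr>)" "M i \<noteq> {\<zero>\<^bsub>F\<^esub>}" "0 < s i"
      using maximal[OF i] nonzero[OF i] sys(1)[OF i] .
    show "bij_betw (\<lambda>j. val_ge L (v i j) 0) {1..s i} (valuation_extensions F L \<phi> (localization_at F D (M i)))"
      using vi unfolding V_def by blast
    show "\<exists>p\<in>M i. p \<noteq> \<zero>\<^bsub>F\<^esub> \<and> (\<forall>j\<in>{1..s i}. v i j (\<phi> p) = int (r i j))" using vi by blast
    fix j assume j: "j \<in> {1..s i}"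
    show "0 < r i j" using sys(3)[OF i j] .
    show "discrete_valuation L (v i j)" "\<exists>w\<in>carrier L - {\<zero>\<^bsub>L\<^esub>}. v i j w = 1" using vi j by blast+
    show "v i j (\<phi> a) = 0" if "a \<in> D" "a \<notin> M i" for a using vi j that by blast
    show "\<phi> a \<in> val_ge L (v i j) (int (r i j))" if "a \<in> M i" for a using vi j that by blast
  qed
  have RE': "RE = fam.RE" and IE': "IE = fam.extended_ideal e"
    unfolding IE RE E I fam.extended_ideal_def fam.base_ideal_def by (rule refl)+
  have power: "J = radical_of RE IE \<and> (\<forall>i\<in>{1..n}. \<forall>j\<in>{1..s i}. e i * r i j = t)"
    if "0 < t" "radical_ideal RE J" "IE = ideal_power RE J t" for J t
    using fam.radical_power_imp[OF e_pos that[unfolded RE' IE']] unfolding RE' IE' by blast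
  have equal: "radical_ideal RE (radical_of RE IE) \<and> IE = ideal_power RE (radical_of RE IE) t"
    if "\<And>i j. i \<in> {1..n} \<Longrightarrow> j \<in> {1..s i} \<Longrightarrow> e i * r i j = t" for t
    unfolding RE' IE'
    by (intro conjI fam.radical_extended_ideal_radical fam.radical_power_of_equal) (rule e_pos that, assumption+)+
  have first: "1 \<in> {1..n}" "1 \<in> {1..s 1}" using n sys(1)[of 1] by simp_all
  have iff: "(\<exists>J t. t > 0 \<and> radical_ideal RE J \<and> IE = ideal_power RE J t) \<longleftrightarrow>
      (\<forall>i\<in>{1..n}. \<forall>j\<in>{1..s i}. \<forall>i'\<in>{1..n}. \<forall>j'\<in>{1..s i'}. e i * r i j = e i' * r i' j')"
  proof
    assume "\<exists>J t. t > 0 \<and> radical_ideal RE J \<and> IE = ideal_power RE J t"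
    then show "\<forall>i\<in>{1..n}. \<forall>j\<in>{1..s i}. \<forall>i'\<in>{1..n}. \<forall>j'\<in>{1..s i'}. e i * r i j = e i' * r i' j'"
      using power by metis
  next
    assume a: "\<forall>i\<in>{1..n}. \<forall>j\<in>{1..s i}. \<forall>i'\<in>{1..n}. \<forall>j'\<in>{1..s i'}. e i * r i j = e i' * r i' j'"
    have "e i * r i j = e 1 * r 1 1" if "i \<in> {1..n}" "j \<in> {1..s i}" for i j using a that first by blast
    moreover have "0 < e 1 * r 1 1" using e_pos[OF first(1)] sys(3)[OF first] by simp
    ultimately show "\<exists>J t. t > 0 \<and> radical_ideal RE J \<and> IE = ideal_power RE J t" using equal by blast
  qed
  have fsum: "m * e i = t * (\<Sum>j=1..s i. f i j)"
    if t: "\<forall>i\<in>{1..n}. \<forall>j\<in>{1..s i}. e i * r i j = t" and i: "i \<in> {1..n}" for i t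
  proof -
    have "m * e i = (\<Sum>j=1..s i. (e i * r i j) * f i j)"
      unfolding sys(2)[OF i, symmetric] by (simp add: sum_distrib_left mult_ac)
    also have "\<dots> = t * (\<Sum>j=1..s i. f i j)" using t i by (simp add: sum_distrib_left)
    finally show ?thesis .
  qed
  have degrees: "(\<Sum>j=1..s i. f i j) = e i"
    if "radical_ideal RE J" "IE = ideal_power RE J m" "i \<in> {1..n}" for J i
    using fsum[OF conjunct2[OF power[OF m that(1,2)]] that(3)] m by simp
  have multiples: "(\<exists>k>0. m = k * t) \<and> (\<forall>i\<in>{1..n}. (\<exists>k>0. t = k * e i) \<and> (\<exists>k>0. m = k * e i))"
    if t: "0 < t" and J: "radical_ideal RE J" "IE = ideal_power RE J t"
      and np: "\<not> (\<exists>p::nat. Factorial_Ring.prime p \<and> (\<forall>i\<in>{1..n}. p dvd e i))" for J t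
  proof -
    note te = conjunct2[OF power[OF t J]]
    have "t dvd Gcd ((\<lambda>k. m * k) ` e ` {1..n})"
    proof (rule Gcd_greatest)
      fix b assume "b \<in> (\<lambda>k. m * k) ` e ` {1..n}"
      then obtain i where "i \<in> {1..n}" "b = m * e i" by blast
      then show "t dvd b" using fsum[OF te] by simp
    qed
    then have "t dvd m * Gcd (e ` {1..n})" by (simp add: Gcd_mult)
    moreover have "Gcd (e ` {1..n}) = 1"
    proof (rule ccontr)
      assume "Gcd (e ` {1..n}) \<noteq> 1"
      then obtain p :: nat where p: "Factorial_Ring.prime p" "p dvd Gcd (e ` {1..n})"
        using prime_factor_nat by blast
      then have "p dvd e i" if "i \<in> {1..n}" for i using that by (meson Gcd_dvd dvd_trans imageI)
      then show False using np p(1) by blast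
    qed
    ultimately have "t dvd m" by simp
    moreover have et: "e i dvd t" if "i \<in> {1..n}" for i
    proof -
      have "1 \<in> {1..s i}" using sys(1)[OF that] by simp
      then show ?thesis using te that by (metis dvd_triv_left)
    qed
    moreover have mult: "\<exists>k>0. b = k * a" if "a dvd b" "0 < b" for a b :: nat
      using that by (metis dvd_div_mult_self div_greater_zero_iff dvd_imp_le dvd_pos_nat)
    ultimately show ?thesis using t m by (meson dvd_trans)
  qed
  show ?thesis
  proof (intro conjI)
    show "(\<exists>J t. t > 0 \<and> radical_ideal RE J \<and> IE = ideal_power RE J t) \<longleftrightarrow>
      (\<forall>i\<in>{1..n}. \<forall>j\<in>{1..s i}. \<forall>i'\<in>{1..n}. \<forall>j'\<in>{1..s i'}. e i * r i j = e i' * r i' j')"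
      by (rule iff)
    show "\<forall>J t. t > 0 \<and> radical_ideal RE J \<and> IE = ideal_power RE J t \<longrightarrow>
         J = radical_of RE IE \<and> (\<forall>i\<in>{1..n}. \<forall>j\<in>{1..s i}. e i * r i j = t)"
      by (intro allI impI, elim conjE) (rule power)
    show "\<forall>J. radical_ideal RE J \<and> IE = ideal_power RE J m \<longrightarrow>
        (\<forall>i\<in>{1..n}. (\<Sum>j=1..s i. f i j) = e i)"
      by (intro allI impI ballI, elim conjE) (rule degrees)
    show "\<forall>J t. t > 0 \<and> radical_ideal RE J \<and> IE = ideal_power RE J t \<and>
        \<not> (\<exists>p::nat. Factorial_Ring.prime p \<and> (\<forall>i\<in>{1..n}. p dvd e i)) \<longrightarrow>
        (\<exists>k>0. m = k * t) \<and>
        (\<forall>i\<in>{1..n}. (\<exists>k>0. t = k * e i) \<and> (\<exists>k>0. m = k * e i))"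
      by (intro allI impI, elim conjE) (rule multiples)
  qed
qed

end
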